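(* Suppose the real input sequence $\{x_i\}_{i\ge 0}$ satisfies (A1) or (A2) or (A3). Let $\widetilde{SC}_n=S_n\odot SC_n$ and $\widetilde{PT}_n=S_n\odot PT_n$ be the $n\times n$ skew-symmetric versions of the Symmetric Circulant matrix $SC_n$ and of the Palindromic Toeplitz matrix $PT_n$, respectively. Then the LSD of $n^{-1/2}\widetilde{SC}_n$ and the LSD of $n^{-1/2}\widetilde{PT}_n$ both exist and equal $\mathcal{N}(0,1)$, the standard Gaussian distribution on $\mathbb{R}$.
   Context: Assumptions on the real input random variables: (A1) they are independent and uniformly bounded with mean $0$ and variance $1$; (A2) they are i.i.d. with mean $0$ and variance $1$; (A3) they are independent with mean $0$ and variance $1$, and with uniformly bounded moments of all orders. $SC_n=((x_{L(i,j)}))_{1\le i,j\le n}$ with $L(i,j)=\frac n2-\left|\frac n2-|i-j|\right|=\min\{|i-j|,\,n-|i-j|\}$. $PT_n$ is the symmetric Toeplitz matrix built from the input sequence whose first row is a palindrome, i.e. $PT_n=((x_{L'(i,j)}))_{1\le i,j\le n}$ with $L'(i,j)=\min\{|i-j|,\,n-1-|i-j|\}$. $S_n=((s_{ij}))_{1\le i,j\le n}$ is the skew-symmetric sign matrix with $s_{ij}=1$ if $i<j$, $s_{ii}=0$, $s_{ij}=-1$ if $i>j$. The symbol $\odot$ denotes the entrywise (Schur–Hadamard) product. For a real skew-symmetric $n\times n$ matrix $A$ with (purely imaginary) eigenvalues $\lambda_1,\dots,\lambda_n$, the empirical spectral distribution is the distribution function on $\mathbb{R}$ given by $F^A(x)=\frac1n\#\{j: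 \mathrm{i}\lambda_j\le x\}$, where $\mathrm{i}=\sqrt{-1}$. A non-random distribution function $F$ is the limiting spectral distribution (LSD) of a sequence $A_n$ if, outside a null set, $F^{A_n}(x)\to F(x)$ as $n\to\infty$ at all continuity points $x$ of $F$. *)

theory Defs
  imports "HOL-Probability.Probability" "Jordan_Normal_Form.Char_Poly"
begin

(* Matrix indices run over {0..<n} instead of {1..n}; every entry below depends on i and j only
   through i - j, so the shift changes nothing. *)

definition SC_link :: "nat \<Rightarrow> nat \<Rightarrow> nat \<Rightarrow> nat" where
  "SC_link n i j = (let d = nat \<bar>int i - int j\<bar> in min d (n - d))"

definition PT_link :: "nat \<Rightarrow> nat \<Rightarrow> nat \<Rightarrow> nat" where
  "PT_link n i j = (let d = nat \<bar>int i - int j\<bar> in min d (n - 1 - d))"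

definition sym_circulant :: "nat \<Rightarrow> (nat \<Rightarrow> real) \<Rightarrow> real mat" where
  "sym_circulant n x = Matrix.mat n n (\<lambda>(i, j). x (SC_link n i j))"

definition palindromic_toeplitz :: "nat \<Rightarrow> (nat \<Rightarrow> real) \<Rightarrow> real mat" where
  "palindromic_toeplitz n x = Matrix.mat n n (\<lambda>(i, j). x (PT_link n i j))"

definition sign_matrix :: "nat \<Rightarrow> real mat" where
  "sign_matrix n = Matrix.mat n n (\<lambda>(i, j). if i < j then 1 else if i = j then 0 else - 1)"

definition hadamard :: "real mat \<Rightarrow> real mat \<Rightarrow> real mat" where
  "hadamard A B = Matrix.mat (dim_row A) (dim_col A) (\<lambda>(i, j). A $$ (i, j) * B $$ (i, j))"

definition skew_sym_circulant :: "nat \<Rightarrow> (nat \<Rightarrow> real) \<Rightarrow> real mat" where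
  "skew_sym_circulant n x = hadamard (sign_matrix n) (sym_circulant n x)"

definition skew_palindromic_toeplitz :: "nat \<Rightarrow> (nat \<Rightarrow> real) \<Rightarrow> real mat" where
  "skew_palindromic_toeplitz n x = hadamard (sign_matrix n) (palindromic_toeplitz n x)"

(* Complex eigenvalues, listed with algebraic multiplicity. *)
definition eigenvalue_mset :: "real mat \<Rightarrow> complex multiset" where
  "eigenvalue_mset A = proots (char_poly (map_mat complex_of_real A))"

(* Meant for skew-symmetric A: then every eigenvalue l is purely imaginary, so that i * l is real
   and Re only changes its type. *)
definition skew_ESD :: "real mat \<Rightarrow> real \<Rightarrow> real" where
  "skew_ESD A x =
     real (size (filter_mset (\<lambda>l. Re (\<i> * l) \<le> x) (eigenvalue_mset A))) / real (dim_row A)"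

(* The non-random limiting distribution function is represented as the cdf of a probability measure
   on the real line; weak_conv is pointwise convergence at the continuity points of the limit. *)
definition skew_LSD :: "'a measure \<Rightarrow> (nat \<Rightarrow> 'a \<Rightarrow> real mat) \<Rightarrow> real measure \<Rightarrow> bool" where
  "skew_LSD M A \<mu> \<longleftrightarrow>
     real_distribution \<mu> \<and> (AE \<omega> in M. weak_conv (\<lambda>n. skew_ESD (A n \<omega>)) (cdf \<mu>))"

context prob_space
begin

definition indep_standardized :: "(nat \<Rightarrow> 'a \<Rightarrow> real) \<Rightarrow> bool" where
  "indep_standardized X \<longleftrightarrow>
     indep_vars (\<lambda>_. borel) X UNIV \<and>
     (\<forall>i. integrable M (X i) \<and> integrable M (\<lambda>\<omega>. (X i \<omega>)\<^sup>2) \<and>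
          expectation (X i) = 0 \<and> variance (X i) = 1)"

definition assumption_A1 :: "(nat \<Rightarrow> 'a \<Rightarrow> real) \<Rightarrow> bool" where
  "assumption_A1 X \<longleftrightarrow>
     indep_standardized X \<and> (\<exists>C. \<forall>i. AE \<omega> in M. \<bar>X i \<omega>\<bar> \<le> C)"

definition assumption_A2 :: "(nat \<Rightarrow> 'a \<Rightarrow> real) \<Rightarrow> bool" where
  "assumption_A2 X \<longleftrightarrow>
     indep_standardized X \<and> (\<forall>i j. distr M borel (X i) = distr M borel (X j))"

definition assumption_A3 :: "(nat \<Rightarrow> 'a \<Rightarrow> real) \<Rightarrow> bool" where
  "assumption_A3 X \<longleftrightarrow>
     indep_standardized X \<and>
     (\<forall>k::nat. \<exists>C. \<forall>i. integrable M (\<lambda>\<omega>. \<bar>X i \<omega>\<bar> ^ k) \<and>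
                          expectation (\<lambda>\<omega>. \<bar>X i \<omega>\<bar> ^ k) \<le> C)"

end

end

theory Submission
  imports Defs
begin

text \<open>
  The sign pattern turns the symmetric circulant into a negacyclic matrix: its entries depend on
  \<open>j - i\<close> only and change sign when \<open>j - i\<close> is shifted by \<open>n\<close>. Hence it is diagonalised by the
  fixed vectors \<open>j \<mapsto> exp (\<i> \<pi> (2 k + 1) j / n)\<close>, whatever the input, and \<open>\<i>\<close> times its \<open>k\<close>-th
  eigenvalue is a real linear form \<open>eigval n k x = (\<Sum>d = 1..n div 2. mode n k d * x d)\<close> in the input. The
  spectral distribution is therefore the empirical distribution of \<open>n\<close> explicit linear forms, and by
  Levy's continuity theorem it suffices that, almost surely, the empirical characteristic function
  \<open>emp_char n t x\<close> tends to \<open>exp (- t\<^sup>2 / 2)\<close> for every \<open>t\<close>.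

  The modes are orthogonal over \<open>k\<close>. This has two consequences: \<open>emp_char\<close> is Lipschitz with constant
  \<open>O(1 / sqrt n)\<close> in the Euclidean norm of \<open>x\<close> (\<open>emp_char_lipschitz\<close>), and the sum over all sites of the
  squared changes of \<open>emp_char\<close> under resampling one bounded coordinate is \<open>O(1 / n)\<close>, uniformly over all
  configurations (\<open>emp_char_sites\<close>).
  The Efron-Stein inequality, applied to \<open>f\<close> and then to \<open>(f - E f)\<^sup>2\<close>, converts the second bound into a
  fourth central moment of order \<open>1 / n\<^sup>2\<close> (\<open>fourth_central_moment_bound\<close>). This is summable, so for
  bounded inputs the difference between \<open>emp_char\<close> and its expectation tends to \<open>0\<close> almost surely.

  General inputs are clipped at a level \<open>K\<close>. By the Lipschitz bound the error is controlled by
  the running averages of the squared tails, which a one-sided strong law of large numbers keeps of the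
  order of their expectations (\<open>averages_eventually_bounded\<close>). The expectation of \<open>emp_char\<close> is evaluated on
  the unclipped inputs by a Lindeberg estimate; each linear form has variance \<open>1 + O(1 / n)\<close> after
  normalisation, except the one with \<open>2 k + 1 = n\<close>. Besides independence and standardisation, the inputs enter through
  the uniform integrability of their squares and one summability condition; both follow from each of the three assumptions.

  The palindromic Toeplitz matrix of size \<open>n + 1\<close> contains the circulant one of size \<open>n\<close> as its leading
  principal submatrix, signs included. Cauchy interlacing, proved here from a spectral theorem for
  skew-Hermitian matrices, shows that the two eigenvalue counting functions differ by at most one.
\<close>


section \<open>Variance inequalities on product spaces\<close>

lemma (in prob_space) integrable_bounded:
  fixes f :: "'a \<Rightarrow> real"
  assumes "f \<in> borel_measurable M" "\<And>x. \<bar>f x\<bar> \<le> B"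
  shows "integrable M f"
  by (rule integrable_const_bound[where B = B]) (use assms in auto)

text \<open>
  The integral of a non-integrable function is \<open>0\<close>, so in iterated integrals the bound passes to the inner integral at every
  point, inside or outside the space.
\<close>
lemma (in prob_space) abs_expectation_le:
  fixes f :: "'a \<Rightarrow> real"
  assumes "\<And>x. \<bar>f x\<bar> \<le> B"
  shows "\<bar>expectation f\<bar> \<le> B"
proof (cases "integrable M f")
  case True
  have "\<bar>expectation f\<bar> \<le> expectation (\<lambda>x. \<bar>f x\<bar>)"
    by (rule integral_abs_bound)
  also have "\<dots> \<le> expectation (\<lambda>_. B)"
    by (rule integral_mono) (use True assms in auto)
  finally show ?thesis by (simp add: prob_space)
next
  case False
  then show ?thesis
    using order_trans[OF abs_ge_zero assms] by (simp add: not_integrable_integral_eq)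
qed

lemma (in prob_space) expectation_square_le:
  fixes f :: "'a \<Rightarrow> real"
  assumes [measurable]: "f \<in> borel_measurable M" and "\<And>x. \<bar>f x\<bar> \<le> B"
  shows "(expectation f)\<^sup>2 \<le> expectation (\<lambda>x. (f x)\<^sup>2)"
proof -
  have i: "integrable M f" by (rule integrable_bounded) (use assms in auto)
  have i2: "integrable M (\<lambda>x. (f x)\<^sup>2)"
    by (rule integrable_bounded[where B="B\<^sup>2"]) (use assms(2) power_mono[OF assms(2), where n = 2] in auto)
  show ?thesis
    using variance_eq[OF i i2] variance_positive[of f] by simp
qed

text \<open>
  Resampling a single coordinate independently produces twice the variance; this is the one-dimensional
  case of the Efron-Stein inequality.
\<close>
lemma (in prob_space) expectation_square_diff:
  fixes f :: "'a \<Rightarrow> real"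
  assumes [measurable]: "f \<in> borel_measurable M" and B: "\<And>x. \<bar>f x\<bar> \<le> B"
  shows "expectation (\<lambda>y. expectation (\<lambda>z. (f y - f z)\<^sup>2)) 
    = 2 * (expectation (\<lambda>x. (f x)\<^sup>2) - (expectation f)\<^sup>2)"
proof -
  have i: "integrable M f" by (rule integrable_bounded) (use assms in auto)
  have i2: "integrable M (\<lambda>x. (f x)\<^sup>2)"
    by (rule integrable_bounded[where B="B\<^sup>2"]) (use assms(2) power_mono[OF assms(2), where n = 2] in auto)
  have "expectation (\<lambda>z. (f y - f z)\<^sup>2) = (f y)\<^sup>2 - 2 * f y * expectation f + expectation (\<lambda>x. (f x)\<^sup>2)" for y
  proof -
    have "expectation (\<lambda>z. (f y - f z)\<^sup>2) = expectation (\<lambda>z. (f y)\<^sup>2 - 2 * f y * f z + (f z)\<^sup>2)"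
      by (simp add: power2_diff algebra_simps)
    also have "\<dots> = (f y)\<^sup>2 - 2 * f y * expectation f + expectation (\<lambda>x. (f x)\<^sup>2)"
      using i i2 by (simp add: prob_space)
    finally show ?thesis .
  qed
  then have "expectation (\<lambda>y. expectation (\<lambda>z. (f y - f z)\<^sup>2)) = 
     expectation (\<lambda>y. (f y)\<^sup>2 - 2 * f y * expectation f + expectation (\<lambda>x. (f x)\<^sup>2))" by simp
  also have "\<dots> = expectation (\<lambda>y. (f y)\<^sup>2) - 2 * expectation f * expectation f + expectation (\<lambda>x. (f x)\<^sup>2)"
    using i i2 by (simp add: prob_space)
  finally show ?thesis by (simp add: power2_eq_square)
qed

lemma diff_square_bound:
  fixes a b B :: real
  assumes "\<bar>a\<bar> \<le> B" "\<bar>b\<bar> \<le> B"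
  shows "\<bar>(a - b)\<^sup>2\<bar> \<le> (2 * B)\<^sup>2"
proof -
  have "\<bar>a - b\<bar> \<le> \<bar>2 * B\<bar>" using assms by linarith
  then show ?thesis by (simp only: abs_power2 abs_le_square_iff)
qed

lemma measurable_update_PiM:
  assumes "d \<in> I"
  shows "(\<lambda>(x, z). x(d := z)) \<in> PiM I \<mu> \<Otimes>\<^sub>M \<mu> d \<rightarrow>\<^sub>M PiM I \<mu>"
  using measurable_add_dim[of d I \<mu>] assms by (simp add: insert_absorb)

text \<open>
  The Efron-Stein inequality, without the optimal factor \<open>1 / 2\<close>. Induction on the index set: averaging \<open>f\<close>
  over the new coordinate \<open>i\<close> gives \<open>F\<close>, and the variance splits into the mean conditional variance, which is
  the contribution of \<open>i\<close>, and the variance of \<open>F\<close>. For the latter the induction hypothesis applies, and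
  the squared differences of \<open>F\<close> are at most the averaged squared differences of \<open>f\<close> by Jensen's inequality.
\<close>
theorem efron_stein:
  fixes \<mu> :: "'i \<Rightarrow> 'b measure" and f :: "('i \<Rightarrow> 'b) \<Rightarrow> real"
  assumes prob: "\<And>i. prob_space (\<mu> i)" and fin: "finite I"
    and f: "f \<in> borel_measurable (PiM I \<mu>)" and bd: "\<And>x. \<bar>f x\<bar> \<le> B"
  shows "(\<integral>x. (f x)\<^sup>2 \<partial>PiM I \<mu>) - (\<integral>x. f x \<partial>PiM I \<mu>)\<^sup>2
    \<le> (\<Sum>d\<in>I. \<integral>x. (\<integral>y. (f x - f (x(d := y)))\<^sup>2 \<partial>\<mu> d) \<partial>PiM I \<mu>)"
  using fin f bd
proof (induction I arbitrary: f rule: finite_induct)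
  case empty
  interpret prob_space "PiM {} \<mu>" by (rule prob_space_PiM) (rule prob)
  show ?case
    by (simp add: lebesgue_integral_count_space_finite PiM_empty)
next
  case (insert i I f)
  interpret m: prob_space "\<mu> d" for d by (rule prob)
  let ?P = "PiM I \<mu>" and ?P' = "PiM (insert i I) \<mu>"
  interpret pp: product_prob_space \<mu> by (rule product_prob_spaceI) (rule prob)
  interpret P: prob_space "?P" by (rule prob_space_PiM) (rule prob)
  interpret P': prob_space "?P'" by (rule prob_space_PiM) (rule prob)
  have sf: "sigma_finite_measure (\<mu> d)" for d by (rule prob_space_imp_sigma_finite) (rule prob)
  note [measurable] = insert.prems(1)
  note bd = insert.prems(2)
  have B0: "0 \<le> B" using order_trans[OF abs_ge_zero bd] .
  have [measurable]: "(\<lambda>(x, y). x(i := y)) \<in> ?P \<Otimes>\<^sub>M \<mu> i \<rightarrow>\<^sub>M ?P'"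
    by (rule measurable_add_dim)
  have upd [measurable]: "(\<lambda>(x, z). x(d := z)) \<in> ?P' \<Otimes>\<^sub>M \<mu> d \<rightarrow>\<^sub>M ?P'"
    if "d \<in> insert i I" for d using measurable_update_PiM[OF that] .
  have updI [measurable]: "(\<lambda>(x, z). x(d := z)) \<in> ?P \<Otimes>\<^sub>M \<mu> d \<rightarrow>\<^sub>M ?P"
    if "d \<in> I" for d using measurable_update_PiM[OF that] .
  have fm [measurable]: "(\<lambda>(x, y). f (x(i := y))) \<in> borel_measurable (?P \<Otimes>\<^sub>M \<mu> i)"
    using measurable_compose[OF measurable_add_dim insert.prems(1)] by (simp add: split_def)
  have fmx [measurable]: "(\<lambda>y. f (x(i := y))) \<in> borel_measurable (\<mu> i)" if "x \<in> space (?P)" for x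
    using measurable_Pair2[OF fm that] by simp
  define F where "F x = (\<integral>y. f (x(i := y)) \<partial>\<mu> i)" for x
  define G where "G d x = (\<integral>z. (f x - f (x(d := z)))\<^sup>2 \<partial>\<mu> d)" for d x
  have Fm [measurable]: "F \<in> borel_measurable (?P)"
    unfolding F_def using fm by (rule sigma_finite_measure.borel_measurable_lebesgue_integral[OF sf])
  have Fb: "\<bar>F x\<bar> \<le> B" for x
    unfolding F_def by (rule m.abs_expectation_le) (rule bd)
  have Gm [measurable]: "G d \<in> borel_measurable (?P')" if d: "d \<in> insert i I" for d
  proof -
    note upd[OF d, measurable]
    have "(\<lambda>w. f (fst w) - f ((fst w)(d := snd w))) \<in> borel_measurable (?P' \<Otimes>\<^sub>M \<mu> d)"
      using measurable_compose[OF upd[OF d] insert.prems(1)] by (simp add: split_def)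
    then show ?thesis
      unfolding G_def by (intro sigma_finite_measure.borel_measurable_lebesgue_integral[OF sf]) (simp add: split_def)
  qed
  have Gb: "\<bar>G d x\<bar> \<le> (2 * B)\<^sup>2" for d x
    unfolding G_def by (rule m.abs_expectation_le) (rule diff_square_bound[OF bd bd])
  have split: "(\<integral>x. h x \<partial>?P') = (\<integral>x. (\<integral>y. h (x(i := y)) \<partial>\<mu> i) \<partial>?P)"
    if h: "h \<in> borel_measurable (?P')" and hb: "\<And>x. \<bar>h x\<bar> \<le> C" for h :: "_ \<Rightarrow> real" and C
    by (rule pp.product_integral_insert) (use insert.hyps P'.integrable_bounded[OF h hb] in auto)
  have hsplit: "integrable (?P) (\<lambda>x. \<integral>y. h (x(i := y)) \<partial>\<mu> i)"
    if h: "h \<in> borel_measurable (?P')" and hb: "\<And>x. \<bar>h x\<bar> \<le> C" for h :: "_ \<Rightarrow> real" and C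
  proof (rule P.integrable_bounded)
    have "(\<lambda>(x, y). h (x(i := y))) \<in> borel_measurable (?P \<Otimes>\<^sub>M \<mu> i)"
      using measurable_compose[OF measurable_add_dim h] by (simp add: split_def)
    then show "(\<lambda>x. \<integral>y. h (x(i := y)) \<partial>\<mu> i) \<in> borel_measurable (?P)"
      by (rule sigma_finite_measure.borel_measurable_lebesgue_integral[OF sf])
    show "\<bar>\<integral>y. h (x(i := y)) \<partial>\<mu> i\<bar> \<le> C" for x by (rule m.abs_expectation_le) (rule hb)
  qed
  have f2b: "\<bar>(f x)\<^sup>2\<bar> \<le> B\<^sup>2" for x using power_mono[OF bd, of x 2] by simp
  have f2m: "(\<lambda>x. (f x)\<^sup>2) \<in> borel_measurable (?P')" by measurable
  have F2i: "integrable (?P) (\<lambda>x. (F x)\<^sup>2)"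
    by (rule P.integrable_bounded[where B="B\<^sup>2"]) (use power_mono[OF Fb, where n = 2] in auto)
  \<comment> \<open>With \<open>x\<close> frozen, the integral of \<open>G i\<close> is twice the conditional variance of \<open>f\<close>.\<close>
  have A: "(\<integral>x. (f x)\<^sup>2 \<partial>?P') - (\<integral>x. (F x)\<^sup>2 \<partial>?P)
     \<le> (\<integral>x. G i x \<partial>?P')"
  proof -
    have "(\<integral>x. (f x)\<^sup>2 \<partial>?P') - (\<integral>x. (F x)\<^sup>2 \<partial>?P)
      = (\<integral>x. (\<integral>y. (f (x(i := y)))\<^sup>2 \<partial>\<mu> i) - (F x)\<^sup>2 \<partial>?P)"
      using split[OF f2m f2b] hsplit[OF f2m f2b] F2i by simp
    also have "\<dots> \<le> (\<integral>x. (\<integral>y. G i (x(i := y)) \<partial>\<mu> i) \<partial>?P)"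
    proof (rule integral_mono)
      show "integrable (?P) (\<lambda>x. (\<integral>y. (f (x(i := y)))\<^sup>2 \<partial>\<mu> i) - (F x)\<^sup>2)"
        using hsplit[OF f2m f2b] F2i by simp
      show "integrable (?P) (\<lambda>x. (\<integral>y. G i (x(i := y)) \<partial>\<mu> i))"
        by (rule hsplit[OF Gm Gb]) simp
      fix x assume x: "x \<in> space (?P)"
      have "(\<integral>y. G i (x(i := y)) \<partial>\<mu> i) = (\<integral>y. (\<integral>z. (f (x(i := y)) - f (x(i := z)))\<^sup>2 \<partial>\<mu> i) \<partial>\<mu> i)"
        by (simp add: G_def)
      also have "\<dots> = 2 * ((\<integral>y. (f (x(i := y)))\<^sup>2 \<partial>\<mu> i) - (F x)\<^sup>2)"
        unfolding F_def by (rule m.expectation_square_diff[OF fmx[OF x] bd])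
      moreover have "(F x)\<^sup>2 \<le> (\<integral>y. (f (x(i := y)))\<^sup>2 \<partial>\<mu> i)"
        unfolding F_def by (rule m.expectation_square_le[OF fmx[OF x] bd])
      ultimately show "(\<integral>y. (f (x(i := y)))\<^sup>2 \<partial>\<mu> i) - (F x)\<^sup>2 \<le> (\<integral>y. G i (x(i := y)) \<partial>\<mu> i)"
        by simp
    qed
    also have "\<dots> = (\<integral>x. G i x \<partial>?P')"
      by (rule split[OF Gm Gb, symmetric]) simp
    finally show ?thesis .
  qed
  \<comment> \<open>Jensen under the integral over the new coordinate, then Fubini to exchange it with the resampled one.\<close>
  have Bd: "(\<integral>x. (\<integral>z. (F x - F (x(d := z)))\<^sup>2 \<partial>\<mu> d) \<partial>?P) \<le> (\<integral>x. G d x \<partial>?P')"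
    if d: "d \<in> I" for d
  proof -
    have di: "d \<noteq> i" using d insert.hyps by auto
    have Gm': "G d \<in> borel_measurable (?P')" using Gm d by simp
    have Fd: "(\<lambda>(x, z). F (x(d := z))) \<in> borel_measurable (?P \<Otimes>\<^sub>M \<mu> d)"
      using measurable_compose[OF updI[OF d] Fm] by (simp add: split_def)
    have "(\<integral>x. (\<integral>z. (F x - F (x(d := z)))\<^sup>2 \<partial>\<mu> d) \<partial>?P)
       \<le> (\<integral>x. (\<integral>y. G d (x(i := y)) \<partial>\<mu> i) \<partial>?P)"
    proof (rule integral_mono)
      show "integrable (?P) (\<lambda>x. (\<integral>y. G d (x(i := y)) \<partial>\<mu> i))"
        by (rule hsplit[OF Gm' Gb])
      show "integrable (?P) (\<lambda>x. \<integral>z. (F x - F (x(d := z)))\<^sup>2 \<partial>\<mu> d)"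
      proof (rule P.integrable_bounded)
        have "(\<lambda>w. (F (fst w) - F ((fst w)(d := snd w)))\<^sup>2) \<in> borel_measurable (?P \<Otimes>\<^sub>M \<mu> d)"
          using Fd by (simp add: split_def)
        then show "(\<lambda>x. \<integral>z. (F x - F (x(d := z)))\<^sup>2 \<partial>\<mu> d) \<in> borel_measurable (?P)"
          by (intro sigma_finite_measure.borel_measurable_lebesgue_integral[OF sf]) (simp add: split_def)
        show "\<bar>\<integral>z. (F x - F (x(d := z)))\<^sup>2 \<partial>\<mu> d\<bar> \<le> (2 * B)\<^sup>2" for x
          by (rule m.abs_expectation_le) (rule diff_square_bound[OF Fb Fb])
      qed
      fix x assume x: "x \<in> space (?P)"
      interpret md: pair_sigma_finite "\<mu> d" "\<mu> i" ..
      interpret mdp: pair_prob_space "\<mu> d" "\<mu> i" ..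
      have xd: "x(d := z) \<in> space (?P)" if "z \<in> space (\<mu> d)" for z
        using x that d by (auto simp: space_PiM PiE_iff extensional_def)
      have m1: "(\<lambda>z. x(d := z)) \<in> \<mu> d \<rightarrow>\<^sub>M ?P"
        using measurable_Pair2[OF updI[OF d] x] by simp
      have m2: "(\<lambda>w. f (x(d := fst w, i := snd w))) \<in> borel_measurable (\<mu> d \<Otimes>\<^sub>M \<mu> i)"
      proof -
        have "(\<lambda>w. (x(d := fst w), snd w)) \<in> (\<mu> d \<Otimes>\<^sub>M \<mu> i) \<rightarrow>\<^sub>M (?P \<Otimes>\<^sub>M \<mu> i)"
          using measurable_compose[OF measurable_fst m1] by (intro measurable_Pair) auto
        from measurable_compose[OF this fm] show ?thesis by simp
      qed
      have m3: "(\<lambda>w. (f (x(i := snd w)) - f (x(d := fst w, i := snd w)))\<^sup>2) \<in> borel_measurable (\<mu> d \<Otimes>\<^sub>M \<mu> i)"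
        using m2 measurable_compose[OF measurable_snd fmx[OF x]] by measurable
      have int: "integrable (\<mu> d \<Otimes>\<^sub>M \<mu> i) (\<lambda>(z, y). (f (x(i := y)) - f (x(d := z, i := y)))\<^sup>2)"
      proof (rule mdp.P.integrable_bounded)
        show "(\<lambda>(z, y). (f (x(i := y)) - f (x(d := z, i := y)))\<^sup>2) \<in> borel_measurable (\<mu> d \<Otimes>\<^sub>M \<mu> i)"
          using m3 by (simp add: split_def)
        show "\<bar>case w of (z, y) \<Rightarrow> (f (x(i := y)) - f (x(d := z, i := y)))\<^sup>2\<bar> \<le> (2 * B)\<^sup>2" for w
          using diff_square_bound[OF bd bd] by (cases w) auto
      qed
      have "(\<integral>z. (F x - F (x(d := z)))\<^sup>2 \<partial>\<mu> d)
         \<le> (\<integral>z. (\<integral>y. (f (x(i := y)) - f (x(d := z, i := y)))\<^sup>2 \<partial>\<mu> i) \<partial>\<mu> d)"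
      proof (rule integral_mono)
        show "integrable (\<mu> d) (\<lambda>z. (F x - F (x(d := z)))\<^sup>2)"
          by (rule m.integrable_bounded[OF _ diff_square_bound[OF Fb Fb]])
             (use measurable_compose[OF m1 Fm] in measurable)
        show "integrable (\<mu> d) (\<lambda>z. (\<integral>y. (f (x(i := y)) - f (x(d := z, i := y)))\<^sup>2 \<partial>\<mu> i))"
          using md.integrable_fst[OF int] .
        fix z assume z: "z \<in> space (\<mu> d)"
        have "F x - F (x(d := z)) = (\<integral>y. f (x(i := y)) - f (x(d := z, i := y)) \<partial>\<mu> i)"
          unfolding F_def
          by (rule Bochner_Integration.integral_diff[symmetric])
             (rule m.integrable_bounded[OF fmx[OF x] bd] m.integrable_bounded[OF fmx[OF xd[OF z]] bd])+
        also have "(\<dots>)\<^sup>2 \<le> (\<integral>y. (f (x(i := y)) - f (x(d := z, i := y)))\<^sup>2 \<partial>\<mu> i)"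
        proof (rule m.expectation_square_le[where B = "2 * B"])
          show "(\<lambda>y. f (x(i := y)) - f (x(d := z, i := y))) \<in> borel_measurable (\<mu> i)"
            using fmx[OF x] fmx[OF xd[OF z]] by measurable
          show "\<bar>f (x(i := y)) - f (x(d := z, i := y))\<bar> \<le> 2 * B" for y
            using bd[of "x(i := y)"] bd[of "x(d := z, i := y)"] by linarith
        qed
        finally show "(F x - F (x(d := z)))\<^sup>2 \<le> (\<integral>y. (f (x(i := y)) - f (x(d := z, i := y)))\<^sup>2 \<partial>\<mu> i)" .
      qed
      also have "\<dots> = (\<integral>y. (\<integral>z. (f (x(i := y)) - f (x(d := z, i := y)))\<^sup>2 \<partial>\<mu> d) \<partial>\<mu> i)"
        using md.Fubini_integral[OF int] by simp
      also have "\<dots> = (\<integral>y. G d (x(i := y)) \<partial>\<mu> i)"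
        unfolding G_def using di by (simp add: fun_upd_twist)
      finally show "(\<integral>z. (F x - F (x(d := z)))\<^sup>2 \<partial>\<mu> d) \<le> (\<integral>y. G d (x(i := y)) \<partial>\<mu> i)" .
    qed
    also have "\<dots> = (\<integral>x. G d x \<partial>?P')"
      by (rule split[OF Gm' Gb, symmetric])
    finally show ?thesis .
  qed
  have Ef: "(\<integral>x. f x \<partial>?P') = (\<integral>x. F x \<partial>?P)"
    unfolding F_def by (rule split[OF insert.prems(1) bd])
  moreover have "(\<integral>x. (F x)\<^sup>2 \<partial>?P) - (\<integral>x. F x \<partial>?P)\<^sup>2
     \<le> (\<Sum>d\<in>I. \<integral>x. (\<integral>z. (F x - F (x(d := z)))\<^sup>2 \<partial>\<mu> d) \<partial>?P)"
    by (rule insert.IH[OF Fm Fb])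
  moreover have "\<dots> \<le> (\<Sum>d\<in>I. \<integral>x. G d x \<partial>?P')"
    by (rule sum_mono) (rule Bd)
  moreover have "(\<Sum>d\<in>insert i I. \<integral>x. G d x \<partial>?P')
     = (\<integral>x. G i x \<partial>?P') + (\<Sum>d\<in>I. \<integral>x. G d x \<partial>?P')"
    using insert.hyps by simp
  ultimately show ?case unfolding G_def[symmetric] Ef using A by linarith
qed

text \<open>
  For \<open>V = f - E f\<close> the Efron-Stein inequality gives \<open>E V\<^sup>2 \<le> L\<close>. A second application, to \<open>V\<^sup>2\<close>, bounds
  \<open>E V ^ 4 - (E V\<^sup>2)\<^sup>2\<close>, because the increment of \<open>V\<^sup>2\<close> in one coordinate is the increment \<open>D\<close> of \<open>V\<close> times
  \<open>2 V - D\<close>, and \<open>(2 V - D)\<^sup>2 \<le> 8 V\<^sup>2 + 2 L\<close>. The bound \<open>L\<close> is required pathwise, with an arbitrary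
  replacement value in each coordinate, so that it can be multiplied by \<open>V\<^sup>2\<close> before integrating.
\<close>
theorem fourth_central_moment_bound:
  fixes \<mu> :: "'i \<Rightarrow> 'b measure" and f :: "('i \<Rightarrow> 'b) \<Rightarrow> real"
  assumes prob: "\<And>i. prob_space (\<mu> i)" and fin: "finite I"
    and f: "f \<in> borel_measurable (PiM I \<mu>)" and bd: "\<And>x. \<bar>f x\<bar> \<le> B"
    and L: "\<And>x y. (\<Sum>d\<in>I. (f x - f (x(d := y d)))\<^sup>2) \<le> L"
  shows "(\<integral>x. (f x - (\<integral>x. f x \<partial>PiM I \<mu>)) ^ 4 \<partial>PiM I \<mu>) \<le> 11 * L\<^sup>2"
proof -
  let ?P = "PiM I \<mu>"
  interpret m: prob_space "\<mu> d" for d by (rule prob)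
  interpret P: prob_space "?P" by (rule prob_space_PiM) (rule prob)
  note [measurable] = f
  have B0: "0 \<le> B" using order_trans[OF abs_ge_zero bd] .
  define c where "c = (\<integral>x. f x \<partial>?P)"
  define V where "V x = f x - c" for x
  have cb: "\<bar>c\<bar> \<le> B" unfolding c_def by (rule P.abs_expectation_le) (rule bd)
  have Vm [measurable]: "V \<in> borel_measurable (?P)" unfolding V_def by measurable
  have Vb: "\<bar>V x\<bar> \<le> 2 * B" for x using bd[of x] cb unfolding V_def by linarith
  have V2b: "\<bar>(V x)\<^sup>2\<bar> \<le> (2 * B)\<^sup>2" for x using power_mono[OF Vb, of x 2] by simp
  have V4b: "\<bar>(V x) ^ 4\<bar> \<le> (2 * B) ^ 4" for x using power_mono[OF Vb, of x 4] by simp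
  define D where "D d x y = V x - V (x(d := y))" for d x y
  have Df: "D d x y = f x - f (x(d := y))" for d x y unfolding D_def V_def by simp
  have Db: "\<bar>(D d x y)\<^sup>2\<bar> \<le> (2 * (2 * B))\<^sup>2" for d x y
    unfolding D_def by (rule diff_square_bound[OF Vb Vb])
  have LD: "(\<Sum>d\<in>I. (D d x (y d))\<^sup>2) \<le> L" for x y using L unfolding Df .
  have L0: "0 \<le> L" using order_trans[OF sum_nonneg LD] by simp
  have upd: "(\<lambda>w. (D d (fst w) (snd w))) \<in> borel_measurable (?P \<Otimes>\<^sub>M \<mu> d)" if "d \<in> I" for d
    using measurable_compose[OF measurable_update_PiM[OF that] Vm] unfolding D_def by (simp add: split_def)
  have updx: "(\<lambda>z. D d x z) \<in> borel_measurable (\<mu> d)" if "d \<in> I" "x \<in> space (?P)" for d x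
    using measurable_Pair2[OF upd[OF that(1)] that(2)] by simp
  define s where "s d x = (\<integral>y. (D d x y)\<^sup>2 \<partial>\<mu> d)" for d x
  have sb: "\<bar>s d x\<bar> \<le> (2 * (2 * B))\<^sup>2" for d x
    unfolding s_def by (rule m.abs_expectation_le) (rule Db)
  have sm: "s d \<in> borel_measurable (?P)" if d: "d \<in> I" for d
    unfolding s_def using upd[OF d] by (intro m.borel_measurable_lebesgue_integral) (simp add: split_def)
  have si: "integrable (?P) (s d)" if "d \<in> I" for d
    by (rule P.integrable_bounded[OF sm[OF that] sb])
  have sL: "(\<Sum>d\<in>I. s d x) \<le> L" if x: "x \<in> space (?P)" for x
  proof -
    \<comment> \<open>In each coordinate some value reaches the average \<open>s d x\<close>; the pathwise bound applies to these values.\<close>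
    have "\<exists>y. s d x \<le> (D d x y)\<^sup>2" if d: "d \<in> I" for d
    proof (rule ccontr)
      assume "\<not> (\<exists>y. s d x \<le> (D d x y)\<^sup>2)"
      then have lt: "(D d x y)\<^sup>2 < s d x" for y by (auto simp: not_le)
      have i: "integrable (\<mu> d) (\<lambda>y. (D d x y)\<^sup>2)"
        by (rule m.integrable_bounded[OF _ Db]) (use updx[OF d x] in measurable)
      have "(\<integral>y. (D d x y)\<^sup>2 \<partial>\<mu> d) < (\<integral>y. s d x \<partial>\<mu> d)"
        by (rule m.integral_less_AE_space[OF i]) (use lt in \<open>auto simp: m.emeasure_space_1\<close>)
      then show False unfolding s_def by (simp add: m.prob_space)
    qed
    then obtain y where "\<And>d. d \<in> I \<Longrightarrow> s d x \<le> (D d x (y d))\<^sup>2" by metis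
    then have "(\<Sum>d\<in>I. s d x) \<le> (\<Sum>d\<in>I. (D d x (y d))\<^sup>2)" by (rule sum_mono)
    also have "\<dots> \<le> L" by (rule LD)
    finally show ?thesis .
  qed
  have i: "integrable (?P) f" by (rule P.integrable_bounded[OF f bd])
  have Vi2: "integrable (?P) (\<lambda>x. (V x)\<^sup>2)" by (rule P.integrable_bounded[OF _ V2b]) measurable
  have EV: "(\<integral>x. V x \<partial>?P) = 0"
    unfolding V_def c_def using i by (simp add: P.prob_space)
  have var: "(\<integral>x. (V x)\<^sup>2 \<partial>?P) \<le> L"
  proof -
    have "(\<integral>x. (V x)\<^sup>2 \<partial>?P) \<le> (\<Sum>d\<in>I. \<integral>x. s d x \<partial>?P)"
      using efron_stein[OF prob fin Vm Vb] EV unfolding s_def D_def by simp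
    also have "\<dots> = (\<integral>x. (\<Sum>d\<in>I. s d x) \<partial>?P)"
      using si by (intro Bochner_Integration.integral_sum[symmetric]) auto
    also have "\<dots> \<le> (\<integral>x. L \<partial>?P)"
      by (rule integral_mono) (use si sL in auto)
    finally show ?thesis by (simp add: P.prob_space)
  qed
  have step: "((V x)\<^sup>2 - (V (x(d := y)))\<^sup>2)\<^sup>2 \<le> (8 * (V x)\<^sup>2 + 2 * L) * (D d x y)\<^sup>2" if d: "d \<in> I" for d x y
  proof -
    have "(D d x y)\<^sup>2 \<le> (\<Sum>e\<in>I. (D e x y)\<^sup>2)"
      using d fin by (intro member_le_sum) auto
    also have "\<dots> \<le> L" by (rule LD)
    finally have DL: "(D d x y)\<^sup>2 \<le> L" .
    have "(2 * V x - D d x y)\<^sup>2 + (2 * V x + D d x y)\<^sup>2 = 8 * (V x)\<^sup>2 + 2 * (D d x y)\<^sup>2"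
      by (simp add: power2_eq_square algebra_simps)
    then have "(2 * V x - D d x y)\<^sup>2 \<le> 8 * (V x)\<^sup>2 + 2 * L"
      using DL zero_le_power2[of "2 * V x + D d x y"] by linarith
    moreover have "((V x)\<^sup>2 - (V (x(d := y)))\<^sup>2)\<^sup>2 = (2 * V x - D d x y)\<^sup>2 * (D d x y)\<^sup>2"
      unfolding D_def by (simp add: power2_eq_square algebra_simps)
    ultimately show ?thesis by (simp add: mult_right_mono)
  qed
  have wsi: "integrable (?P) (\<lambda>x. (8 * (V x)\<^sup>2 + 2 * L) * s d x)" if d: "d \<in> I" for d
  proof (rule P.integrable_bounded)
    show "(\<lambda>x. (8 * (V x)\<^sup>2 + 2 * L) * s d x) \<in> borel_measurable (?P)"
      using sm[OF d] by measurable
    have "\<bar>8 * (V x)\<^sup>2 + 2 * L\<bar> \<le> 8 * (2 * B)\<^sup>2 + 2 * L" for x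
      using V2b[of x] L0 zero_le_power2[of "V x"] by linarith
    then show "\<bar>(8 * (V x)\<^sup>2 + 2 * L) * s d x\<bar> \<le> (8 * (2 * B)\<^sup>2 + 2 * L) * (2 * (2 * B))\<^sup>2" for x
      unfolding abs_mult using L0 by (intro mult_mono sb) auto
  qed
  have "(\<integral>x. ((V x)\<^sup>2)\<^sup>2 \<partial>?P) - (\<integral>x. (V x)\<^sup>2 \<partial>?P)\<^sup>2
     \<le> (\<Sum>d\<in>I. \<integral>x. (\<integral>y. ((V x)\<^sup>2 - (V (x(d := y)))\<^sup>2)\<^sup>2 \<partial>\<mu> d) \<partial>?P)"
    by (rule efron_stein[OF prob fin _ V2b]) measurable
  also have "\<dots> \<le> (\<Sum>d\<in>I. \<integral>x. (8 * (V x)\<^sup>2 + 2 * L) * s d x \<partial>?P)"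
  proof (rule sum_mono)
    fix d assume d: "d \<in> I"
    show "(\<integral>x. (\<integral>y. ((V x)\<^sup>2 - (V (x(d := y)))\<^sup>2)\<^sup>2 \<partial>\<mu> d) \<partial>?P)
      \<le> (\<integral>x. (8 * (V x)\<^sup>2 + 2 * L) * s d x \<partial>?P)"
    proof (rule integral_mono)
      have m: "(\<lambda>w. ((V (fst w))\<^sup>2 - (V ((fst w)(d := snd w)))\<^sup>2)\<^sup>2) \<in> borel_measurable (?P \<Otimes>\<^sub>M \<mu> d)"
        using measurable_compose[OF measurable_update_PiM[OF d] Vm] by (simp add: split_def)
      show "integrable (?P) (\<lambda>x. \<integral>y. ((V x)\<^sup>2 - (V (x(d := y)))\<^sup>2)\<^sup>2 \<partial>\<mu> d)"
      proof (rule P.integrable_bounded)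
        show "(\<lambda>x. \<integral>y. ((V x)\<^sup>2 - (V (x(d := y)))\<^sup>2)\<^sup>2 \<partial>\<mu> d) \<in> borel_measurable (?P)"
          using m by (intro m.borel_measurable_lebesgue_integral) (simp add: split_def)
        show "\<bar>\<integral>y. ((V x)\<^sup>2 - (V (x(d := y)))\<^sup>2)\<^sup>2 \<partial>\<mu> d\<bar> \<le> (2 * (2 * B)\<^sup>2)\<^sup>2" for x
          by (rule m.abs_expectation_le) (rule diff_square_bound[OF V2b V2b])
      qed
      show "integrable (?P) (\<lambda>x. (8 * (V x)\<^sup>2 + 2 * L) * s d x)" by (rule wsi[OF d])
      fix x assume x: "x \<in> space (?P)"
      have "(\<integral>y. ((V x)\<^sup>2 - (V (x(d := y)))\<^sup>2)\<^sup>2 \<partial>\<mu> d) \<le> (\<integral>y. (8 * (V x)\<^sup>2 + 2 * L) * (D d x y)\<^sup>2 \<partial>\<mu> d)"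
      proof (rule integral_mono)
        have "(\<lambda>y. (D d x y)\<^sup>2) \<in> borel_measurable (\<mu> d)" using updx[OF d x] by measurable
        from m.integrable_bounded[OF this Db]
        show "integrable (\<mu> d) (\<lambda>y. (8 * (V x)\<^sup>2 + 2 * L) * (D d x y)\<^sup>2)" by simp
        show "integrable (\<mu> d) (\<lambda>y. ((V x)\<^sup>2 - (V (x(d := y)))\<^sup>2)\<^sup>2)"
          by (rule m.integrable_bounded[OF _ diff_square_bound[OF V2b V2b]])
             (use measurable_Pair2[OF m x] in simp)
      qed (rule step[OF d])
      then show "(\<integral>y. ((V x)\<^sup>2 - (V (x(d := y)))\<^sup>2)\<^sup>2 \<partial>\<mu> d) \<le> (8 * (V x)\<^sup>2 + 2 * L) * s d x"
        unfolding s_def by simp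
    qed
  qed
  also have "\<dots> = (\<integral>x. (\<Sum>d\<in>I. (8 * (V x)\<^sup>2 + 2 * L) * s d x) \<partial>?P)"
    by (rule Bochner_Integration.integral_sum[symmetric]) (rule wsi)
  also have "\<dots> \<le> (\<integral>x. (8 * (V x)\<^sup>2 + 2 * L) * L \<partial>?P)"
  proof (rule integral_mono)
    show "integrable (?P) (\<lambda>x. (8 * (V x)\<^sup>2 + 2 * L) * L)" using Vi2 by auto
    show "integrable (?P) (\<lambda>x. \<Sum>d\<in>I. (8 * (V x)\<^sup>2 + 2 * L) * s d x)"
      by (rule Bochner_Integration.integrable_sum) (rule wsi)
    fix x assume x: "x \<in> space (?P)"
    show "(\<Sum>d\<in>I. (8 * (V x)\<^sup>2 + 2 * L) * s d x) \<le> (8 * (V x)\<^sup>2 + 2 * L) * L"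
      unfolding sum_distrib_left[symmetric] using sL[OF x] L0 by (intro mult_left_mono) auto
  qed
  also have "\<dots> = (8 * (\<integral>x. (V x)\<^sup>2 \<partial>?P) + 2 * L) * L"
    using Vi2 by (simp add: P.prob_space)
  also have "\<dots> \<le> (8 * L + 2 * L) * L"
    using var L0 by (intro mult_right_mono) auto
  finally have "(\<integral>x. ((V x)\<^sup>2)\<^sup>2 \<partial>?P) \<le> (\<integral>x. (V x)\<^sup>2 \<partial>?P)\<^sup>2 + 10 * L\<^sup>2"
    by (simp add: power2_eq_square)
  also have "(\<integral>x. (V x)\<^sup>2 \<partial>?P)\<^sup>2 \<le> L\<^sup>2"
    using var by (intro power_mono) auto
  finally show ?thesis unfolding V_def c_def by (simp add: power_mult[symmetric])
qed

section \<open>Orthogonality of the sine modes\<close>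

abbreviation freqs :: "nat \<Rightarrow> nat set" where
  "freqs n \<equiv> {1..n div 2}"

definition angle :: "nat \<Rightarrow> nat \<Rightarrow> real" where
  "angle n k = pi * real (2 * k + 1) / real n"

text \<open>
  How many offsets \<open>e\<close> with \<open>0 < e < n\<close> carry the input variable of index \<open>d\<close>, that is, satisfy
  \<open>min e (n - e) = d\<close>, for \<open>1 \<le> d \<le> n div 2\<close>.
\<close>
definition multiplicity_in_row :: "nat \<Rightarrow> nat \<Rightarrow> real" where
  "multiplicity_in_row n d = (if 2 * d = n then 1 else 2)"

definition mode :: "nat \<Rightarrow> nat \<Rightarrow> nat \<Rightarrow> real" where
  "mode n k d = - multiplicity_in_row n d * sin (angle n k * real d)"

text \<open>
  This is \<open>\<i>\<close> times the \<open>k\<close>-th eigenvalue of the skew-symmetric circulant matrix with input \<open>x\<close>, expressed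
  through the distinct input variables.
\<close>
definition eigval :: "nat \<Rightarrow> nat \<Rightarrow> (nat \<Rightarrow> real) \<Rightarrow> real" where
  "eigval n k x = (\<Sum>d\<in>freqs n. mode n k d * x d)"

text \<open>
  The offsets \<open>e\<close> and \<open>n - e\<close> are paired; the middle one, \<open>n / 2\<close>, stays alone.
\<close>
lemma sum_palindrome:
  fixes f :: "nat \<Rightarrow> real"
  assumes sym: "\<And>e. 0 < e \<Longrightarrow> e < n \<Longrightarrow> f (n - e) = f e"
  shows "(\<Sum>e\<in>{1..<n}. f e) = (\<Sum>d\<in>freqs n. multiplicity_in_row n d * f d)"
proof -
  have "(\<Sum>e\<in>{1..<n}. f e) = (\<Sum>d\<in>freqs n. \<Sum>e\<in>{e\<in>{1..<n}. min e (n - e) = d}. f e)"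
    by (rule sum.group[symmetric]) auto
  also have "\<dots> = (\<Sum>d\<in>freqs n. multiplicity_in_row n d * f d)"
  proof (rule sum.cong)
    fix d assume d: "d \<in> freqs n"
    have "{e\<in>{1..<n}. min e (n - e) = d} = {d, n - d}" using d by auto
    moreover have "f (n - d) = f d" using d by (intro sym) auto
    ultimately show "(\<Sum>e\<in>{e\<in>{1..<n}. min e (n - e) = d}. f e) = multiplicity_in_row n d * f d"
      using d by (cases "2 * d = n") (auto simp: multiplicity_in_row_def sum.insert_if)
  qed simp
  finally show ?thesis .
qed

text \<open>
  Since \<open>n * angle n k\<close> is an odd multiple of \<open>\<pi>\<close>, the sine is symmetric about \<open>n / 2\<close>. This is why the
  palindromic pattern of the circulant survives in the skew-symmetric version.
\<close>
lemma sin_angle_reflect: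
  assumes "e \<le> n" "0 < n"
  shows "sin (angle n k * real (n - e)) = sin (angle n k * real e)"
proof -
  have "angle n k * real (n - e) = real (2 * k + 1) * pi - angle n k * real e"
    using assms by (simp add: angle_def of_nat_diff field_simps)
  also have "sin \<dots> = sin (angle n k * real e)"
    unfolding sin_diff using sin_npi[of "2 * k + 1"] cos_npi[of "2 * k + 1"] by simp
  finally show ?thesis .
qed

lemma eigval_eq_row_sum:
  "eigval n k x = - (\<Sum>e\<in>{1..<n}. x (min e (n - e)) * sin (angle n k * real e))"
proof -
  have "(\<Sum>e\<in>{1..<n}. x (min e (n - e)) * sin (angle n k * real e))
     = (\<Sum>d\<in>freqs n. multiplicity_in_row n d * (x (min d (n - d)) * sin (angle n k * real d)))"
  proof (rule sum_palindrome)
    fix e assume "0 < e" "e < n"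
    then show "x (min (n - e) (n - (n - e))) * sin (angle n k * real (n - e)) =
      x (min e (n - e)) * sin (angle n k * real e)"
      using sin_angle_reflect[of e n k] by (simp add: min.commute)
  qed
  also have "\<dots> = - eigval n k x"
    unfolding eigval_def mode_def sum_negf[symmetric]
    by (rule sum.cong) (auto simp: min_def)
  finally show ?thesis by simp
qed

text \<open>
  The sum telescopes after multiplication by \<open>2 sin (\<pi> m / n)\<close>, which is nonzero for \<open>0 < m < n\<close>.
\<close>
lemma sum_cos_odd_multiples:
  assumes "0 < m" "m < n"
  shows "(\<Sum>k<n. cos (angle n k * real m)) = 0"
proof -
  define \<phi> where "\<phi> = pi * real m / real n"
  have "0 < \<phi>" "\<phi> < pi" using assms by (auto simp: \<phi>_def field_simps)
  then have s: "sin \<phi> \<noteq> 0" using sin_gt_zero[of \<phi>] by simp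
  have "2 * sin \<phi> * (\<Sum>k<n. cos (angle n k * real m)) = (\<Sum>k<n. sin (2 * real (Suc k) * \<phi>) - sin (2 * real k * \<phi>))"
    unfolding sum_distrib_left
  proof (rule sum.cong)
    fix k
    define a where "a = angle n k * real m"
    have 1: "2 * real (Suc k) * \<phi> = a + \<phi>" and 2: "2 * real k * \<phi> = a - \<phi>"
      by (simp_all add: a_def angle_def \<phi>_def field_simps add_divide_distrib)
    show "2 * sin \<phi> * cos (angle n k * real m) = sin (2 * real (Suc k) * \<phi>) - sin (2 * real k * \<phi>)"
      unfolding 1 2 a_def[symmetric] by (simp add: sin_add sin_diff)
  qed simp
  also have "\<dots> = sin (2 * real n * \<phi>)"
    by (subst sum_lessThan_telescope) simp
  also have "2 * real n * \<phi> = real (2 * m) * pi" using assms by (simp add: \<phi>_def field_simps)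
  also have "sin \<dots> = 0" by (rule sin_npi)
  finally show ?thesis using s by simp
qed

lemma sum_cos_angle:
  assumes "m \<le> n" "0 < n"
  shows "(\<Sum>k<n. cos (angle n k * real m)) = (if m = 0 then real n else if m = n then - real n else 0)"
proof -
  have "cos (angle n k * real n) = -1" for k
  proof -
    have "angle n k * real n = real (2 * k + 1) * pi" using assms by (simp add: angle_def)
    then show ?thesis using cos_npi[of "2 * k + 1"] by simp
  qed
  then show ?thesis using sum_cos_odd_multiples[of m n] assms by auto
qed

text \<open>
  Product-to-sum formulas reduce the inner product to \<open>sum_cos_angle\<close> at \<open>d - e\<close> and \<open>d + e\<close>. In the range
  \<open>1 \<le> d, e \<le> n div 2\<close> the second frequency reaches \<open>n\<close> only if \<open>d = e = n / 2\<close>, where the value \<open>- n\<close> is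
  compensated by the smaller multiplicity.
\<close>
lemma mode_orthogonal:
  assumes d: "d \<in> freqs n" and e: "e \<in> freqs n"
  shows "(\<Sum>k<n. mode n k d * mode n k e) = (if d = e then multiplicity_in_row n d * real n else 0)"
proof -
  have aux: "(\<Sum>k<n. mode n k d * mode n k e) = (if d = e then multiplicity_in_row n d * real n else 0)"
    if d: "d \<in> freqs n" and e: "e \<in> freqs n" and le: "e \<le> d" for d e
  proof -
    have n: "0 < n" using d by auto
    have "(\<Sum>k<n. mode n k d * mode n k e)
      = (\<Sum>k<n. multiplicity_in_row n d * multiplicity_in_row n e / 2 *
           (cos (angle n k * real (d - e)) - cos (angle n k * real (d + e))))"
      using le by (intro sum.cong) (auto simp: mode_def of_nat_diff algebra_simps cos_add cos_diff)
    also have "\<dots> = multiplicity_in_row n d * multiplicity_in_row n e / 2 *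
      ((\<Sum>k<n. cos (angle n k * real (d - e))) - (\<Sum>k<n. cos (angle n k * real (d + e))))"
      by (simp only: sum_distrib_left[symmetric] sum_subtractf)
    also have "\<dots> = (if d = e then multiplicity_in_row n d * real n else 0)"
      using d e le n by (subst (1 2) sum_cos_angle) (auto simp: multiplicity_in_row_def)
    finally show ?thesis .
  qed
  show ?thesis
  proof (cases "e \<le> d")
    case True
    then show ?thesis by (rule aux[OF d e])
  next
    case False
    then show ?thesis using aux[OF e d] by (auto simp: mult.commute)
  qed
qed

text \<open>
  Orthogonality of the modes makes the map from inputs to eigenvalues, up to the factor \<open>sqrt (2 n)\<close>, a
  contraction for the Euclidean norms.
\<close>
lemma eigval_energy:
  "(\<Sum>k<n. (eigval n k x)\<^sup>2) \<le> 2 * real n * (\<Sum>d\<in>freqs n. (x d)\<^sup>2)"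
proof -
  have "(\<Sum>k<n. (eigval n k x)\<^sup>2)
     = (\<Sum>k<n. \<Sum>d\<in>freqs n. \<Sum>e\<in>freqs n. x d * x e * (mode n k d * mode n k e))"
    unfolding eigval_def power2_eq_square sum_product by (simp add: mult_ac)
  also have "\<dots> = (\<Sum>d\<in>freqs n. \<Sum>e\<in>freqs n. x d * x e * (\<Sum>k<n. mode n k d * mode n k e))"
  proof -
    have "(\<Sum>d\<in>freqs n. \<Sum>e\<in>freqs n. x d * x e * (\<Sum>k<n. mode n k d * mode n k e))
      = (\<Sum>d\<in>freqs n. \<Sum>k<n. \<Sum>e\<in>freqs n. x d * x e * (mode n k d * mode n k e))"
      unfolding sum_distrib_left by (rule sum.cong[OF refl], rule sum.swap)
    also have "\<dots> = (\<Sum>k<n. \<Sum>d\<in>freqs n. \<Sum>e\<in>freqs n. x d * x e * (mode n k d * mode n k e))"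
      by (rule sum.swap)
    finally show ?thesis ..
  qed
  also have "\<dots> = (\<Sum>d\<in>freqs n. \<Sum>e\<in>freqs n. if d = e then x d * x e * (multiplicity_in_row n d * real n) else 0)"
    by (intro sum.cong refl) (simp only: mode_orthogonal split: if_splits, simp)
  also have "\<dots> = (\<Sum>d\<in>freqs n. (x d)\<^sup>2 * (multiplicity_in_row n d * real n))"
    by (simp add: sum.delta power2_eq_square cong: if_cong)
  also have "\<dots> \<le> (\<Sum>d\<in>freqs n. (x d)\<^sup>2 * (2 * real n))"
    by (intro sum_mono mult_left_mono mult_right_mono) (auto simp: multiplicity_in_row_def)
  finally show ?thesis by (simp add: sum_distrib_left mult_ac)
qed

text \<open>
  The adjoint form of \<open>eigval_energy\<close>, obtained by duality: with \<open>z\<close> the vector of coefficients, its squared norm is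
  the pairing of \<open>u\<close> with \<open>eigval n k z\<close>, and Cauchy-Schwarz leaves one factor of the norm to cancel.
\<close>
lemma bessel_modes:
  "(\<Sum>d\<in>freqs n. (\<Sum>k<n. u k * mode n k d)\<^sup>2) \<le> 2 * real n * (\<Sum>k<n. (u k)\<^sup>2)"
proof -
  define z where "z d = (\<Sum>k<n. u k * mode n k d)" for d
  define Z where "Z = (\<Sum>d\<in>freqs n. (z d)\<^sup>2)"
  have Z0: "0 \<le> Z" unfolding Z_def by (rule sum_nonneg) simp
  have "Z = (\<Sum>k<n. u k * eigval n k z)"
    unfolding Z_def eigval_def power2_eq_square sum_distrib_left
    by (subst sum.swap) (simp add: z_def sum_distrib_right mult_ac)
  then have "Z\<^sup>2 \<le> (\<Sum>k<n. (u k)\<^sup>2) * (\<Sum>k<n. (eigval n k z)\<^sup>2)"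
    using Cauchy_Schwarz_ineq_sum[of u "\<lambda>k. eigval n k z" "{..<n}"] by simp
  also have "\<dots> \<le> (\<Sum>k<n. (u k)\<^sup>2) * (2 * real n * Z)"
    unfolding Z_def by (intro mult_left_mono eigval_energy sum_nonneg) simp
  finally have "Z * Z \<le> (2 * real n * (\<Sum>k<n. (u k)\<^sup>2)) * Z"
    by (simp add: power2_eq_square mult_ac)
  moreover have "0 \<le> 2 * real n * (\<Sum>k<n. (u k)\<^sup>2)" by (intro mult_nonneg_nonneg sum_nonneg) auto
  ultimately have "Z \<le> 2 * real n * (\<Sum>k<n. (u k)\<^sup>2)"
    using Z0 by (cases "Z = 0") (auto simp: mult_le_cancel_right)
  then show ?thesis unfolding Z_def z_def .
qed

text \<open>
  The sum telescopes after multiplication by \<open>2 sin (angle n k)\<close>, which vanishes only for \<open>2 k + 1 = n\<close>.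
\<close>
lemma sum_cos_double_angle:
  assumes k: "k < n" and ne: "2 * k + 1 \<noteq> n"
  shows "(\<Sum>e<n. cos (2 * angle n k * real e)) = 0"
proof -
  define \<phi> where "\<phi> = angle n k"
  have n: "0 < n" using k by simp
  have "sin \<phi> \<noteq> 0"
  proof
    assume "sin \<phi> = 0"
    then obtain i :: int where "\<phi> = of_int i * pi" using sin_zero_iff_int2 by auto
    then have "pi * real (2 * k + 1) = pi * of_int (i * int n)"
      using n by (simp add: \<phi>_def angle_def field_simps)
    then have "real (2 * k + 1) = of_int (i * int n)" by (simp only: mult_cancel_left) simp
    then have i: "int (2 * k + 1) = i * int n" by linarith
    have "0 < i"
    proof (rule ccontr)
      assume "\<not> 0 < i"
      then have "i * int n \<le> 0" by (intro mult_nonpos_nonneg) auto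
      with i show False by linarith
    qed
    have "i * int n < 2 * int n" unfolding i[symmetric] using k by simp
    then have "i < 2" by (rule mult_right_less_imp_less) simp
    with \<open>0 < i\<close> have "i = 1" by simp
    with i have "2 * k + 1 = n" by simp
    with ne show False by simp
  qed
  have "2 * sin \<phi> * (\<Sum>e<n. cos (2 * \<phi> * real e)) = (\<Sum>e<n. sin (2 * real (Suc e) * \<phi> - \<phi>) - sin (2 * real e * \<phi> - \<phi>))"
    unfolding sum_distrib_left
  proof (rule sum.cong)
    fix e
    have 1: "2 * real (Suc e) * \<phi> - \<phi> = 2 * \<phi> * real e + \<phi>"
      and 2: "2 * real e * \<phi> - \<phi> = 2 * \<phi> * real e - \<phi>" by (simp_all add: algebra_simps)
    show "2 * sin \<phi> * cos (2 * \<phi> * real e) = sin (2 * real (Suc e) * \<phi> - \<phi>) - sin (2 * real e * \<phi> - \<phi>)"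
      unfolding 1 2 by (simp add: sin_add sin_diff)
  qed simp
  also have "\<dots> = sin (2 * real n * \<phi> - \<phi>) + sin \<phi>"
    by (subst sum_lessThan_telescope) simp
  also have "2 * real n * \<phi> = 2 * pi * real (2 * k + 1)" using n by (simp add: \<phi>_def angle_def field_simps)
  also have "sin (2 * pi * real (2 * k + 1) - \<phi>) + sin \<phi> = 0"
    using sin_npi2[of "2 * (2 * k + 1)"] cos_2npi[of "2 * k + 1"] sin_2npi[of "2 * k + 1"]
    by (simp add: sin_diff mult_ac)
  finally show ?thesis using \<open>sin \<phi> \<noteq> 0\<close> by (simp add: \<phi>_def)
qed

text \<open>
  For inputs of variance \<open>1\<close> the sum is \<open>n\<close> times the variance of the \<open>k\<close>-th normalised eigenvalue. For \<open>2 k + 1 = n\<close> all the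
  angles are multiples of \<open>\<pi>\<close>, the modes vanish and the eigenvalue is \<open>0\<close>. The error \<open>1\<close> comes from
  the middle frequency \<open>n / 2\<close>, which occurs once in a row instead of twice.
\<close>
lemma mode_energy:
  assumes k: "k < n" and ne: "2 * k + 1 \<noteq> n"
  shows "\<bar>(\<Sum>d\<in>freqs n. (mode n k d)\<^sup>2) - real n\<bar> \<le> 1"
proof -
  have n: "0 < n" using k by simp
  let ?s = "\<lambda>d. (sin (angle n k * real d))\<^sup>2"
  have "(\<Sum>d\<in>freqs n. multiplicity_in_row n d * ?s d) = (\<Sum>e\<in>{1..<n}. ?s e)"
    by (rule sum_palindrome[symmetric]) (use n in \<open>simp add: sin_angle_reflect del: of_nat_diff\<close>)
  also have "\<dots> = (\<Sum>e<n. ?s e)"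
    by (rule sum.mono_neutral_left) (auto simp: Suc_le_eq)
  also have "\<dots> = (\<Sum>e<n. 1 / 2 - cos (2 * angle n k * real e) / 2)"
  proof (intro sum.cong refl)
    fix e
    have "cos (2 * angle n k * real e) = 1 - 2 * (sin (angle n k * real e))\<^sup>2"
      unfolding mult.assoc by (rule cos_double_sin)
    then show "?s e = 1 / 2 - cos (2 * angle n k * real e) / 2" by linarith
  qed
  also have "\<dots> = real n / 2"
    using sum_cos_double_angle[OF assms] by (simp add: sum_subtractf sum_divide_distrib[symmetric])
  finally have S: "(\<Sum>d\<in>freqs n. 2 * (multiplicity_in_row n d * ?s d)) = real n"
    by (simp add: sum_distrib_left[symmetric])
  have "real n - (\<Sum>d\<in>freqs n. (mode n k d)\<^sup>2)
     = (\<Sum>d\<in>freqs n. 2 * (multiplicity_in_row n d * ?s d) - (mode n k d)\<^sup>2)"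
    unfolding sum_subtractf S ..
  also have "\<dots> = (\<Sum>d\<in>freqs n. if 2 * d = n then ?s d else 0)"
    by (intro sum.cong refl) (auto simp: mode_def multiplicity_in_row_def power_mult_distrib)
  also have "\<dots> = (if even n then ?s (n div 2) else 0)"
  proof (cases "even n")
    case True
    then have "(\<Sum>d\<in>freqs n. if 2 * d = n then ?s d else 0) = (\<Sum>d\<in>freqs n. if d = n div 2 then ?s d else 0)"
      by (intro sum.cong refl) auto
    also have "\<dots> = ?s (n div 2)" using True n by (subst sum.delta) (auto elim!: evenE)
    finally show ?thesis using True by simp
  next
    case False
    then show ?thesis by (auto intro!: sum.neutral)
  qed
  finally have "real n - (\<Sum>d\<in>freqs n. (mode n k d)\<^sup>2) = (if even n then ?s (n div 2) else 0)" .
  moreover have "0 \<le> (if even n then ?s (n div 2) else 0)" "(if even n then ?s (n div 2) else 0) \<le> 1"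
    by (simp_all add: abs_square_le_1)
  ultimately show ?thesis by linarith
qed

lemma abs_mode_le: "\<bar>mode n k d\<bar> \<le> 2"
  using abs_sin_le_one[of "angle n k * real d"]
  by (simp add: mode_def multiplicity_in_row_def abs_mult del: abs_sin_le_one split: if_split)

lemma eigval_diff: "eigval n k x - eigval n k y = eigval n k (\<lambda>d. x d - y d)"
  by (simp add: eigval_def sum_subtractf algebra_simps)

lemma eigval_update:
  assumes "d \<in> freqs n"
  shows "eigval n k (x(d := y)) = eigval n k x + mode n k d * (y - x d)"
proof -
  have "eigval n k (x(d := y)) - eigval n k x = (\<Sum>e\<in>freqs n. if e = d then mode n k d * (y - x d) else 0)"
    unfolding eigval_diff unfolding eigval_def by (intro sum.cong) auto
  also have "\<dots> = mode n k d * (y - x d)" using assms by (subst sum.delta) auto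
  finally show ?thesis by simp
qed

section \<open>The empirical characteristic function and its sensitivity\<close>

definition clip :: "real \<Rightarrow> real \<Rightarrow> real" where
  "clip C y = max (- C) (min C y)"

lemma clip_bounds: "0 \<le> C \<Longrightarrow> \<bar>clip C y\<bar> \<le> C"
  by (auto simp: clip_def)

lemma borel_measurable_clip [measurable]: "clip C \<in> borel_measurable borel"
  unfolding clip_def by measurable

definition emp_char :: "nat \<Rightarrow> real \<Rightarrow> (nat \<Rightarrow> real) \<Rightarrow> complex" where
  "emp_char n t x = (\<Sum>k<n. iexp (t * eigval n k x / sqrt (real n))) / of_nat n"

lemma cmod_iexp_minus_one_le: "cmod (iexp a - 1) \<le> \<bar>a\<bar>"
  using iexp_approx1[of a 0] by simp

lemma cmod_iexp_diff_le: "cmod (iexp a - iexp b) \<le> \<bar>a - b\<bar>"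
proof -
  have "iexp a - iexp b = iexp b * (iexp (a - b) - 1)"
    by (simp add: algebra_simps flip: exp_add)
  then show ?thesis
    using cmod_iexp_minus_one_le[of "a - b"] by (simp add: norm_mult)
qed

lemma cmod_iexp_taylor1: "cmod (iexp a - 1 - \<i> * a) \<le> a\<^sup>2 / 2"
  using iexp_approx1[of a 1] by (simp add: numeral_2_eq_2 diff_diff_eq)

lemma cmod_emp_char_le: "cmod (emp_char n t x) \<le> 1"
proof -
  have "cmod (\<Sum>k<n. iexp (t * eigval n k x / sqrt (real n))) \<le> (\<Sum>k<n. 1)"
    by (rule sum_norm_le) simp
  then show ?thesis
    by (cases "n = 0") (simp_all add: emp_char_def norm_divide)
qed

text \<open>
  Cauchy-Schwarz over the \<open>n\<close> eigenvalues, followed by \<open>eigval_energy\<close>.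
\<close>
lemma emp_char_lipschitz:
  "cmod (emp_char n t x - emp_char n t y) \<le> \<bar>t\<bar> * sqrt (2 / real n * (\<Sum>d\<in>freqs n. (x d - y d)\<^sup>2))"
proof (cases "n = 0")
  case False
  then have n: "0 < real n" by simp
  let ?S = "\<Sum>d\<in>freqs n. (x d - y d)\<^sup>2"
  let ?r = "\<lambda>k. eigval n k (\<lambda>d. x d - y d)"
  have "cmod (\<Sum>k<n. iexp (t * eigval n k x / sqrt (real n)) - iexp (t * eigval n k y / sqrt (real n)))
     \<le> (\<Sum>k<n. \<bar>t\<bar> / sqrt (real n) * \<bar>?r k\<bar>)"
  proof (rule sum_norm_le)
    fix k
    have "cmod (iexp (t * eigval n k x / sqrt (real n)) - iexp (t * eigval n k y / sqrt (real n)))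
      \<le> \<bar>t * eigval n k x / sqrt (real n) - t * eigval n k y / sqrt (real n)\<bar>" by (rule cmod_iexp_diff_le)
    also have "t * eigval n k x / sqrt (real n) - t * eigval n k y / sqrt (real n) = t / sqrt (real n) * ?r k"
      unfolding eigval_diff[symmetric] by (simp add: algebra_simps diff_divide_distrib)
    finally show "cmod (iexp (t * eigval n k x / sqrt (real n)) - iexp (t * eigval n k y / sqrt (real n)))
      \<le> \<bar>t\<bar> / sqrt (real n) * \<bar>?r k\<bar>" by (simp add: abs_mult)
  qed
  also have "\<dots> = \<bar>t\<bar> / sqrt (real n) * (\<Sum>k<n. \<bar>?r k\<bar>)" by (rule sum_distrib_left[symmetric])
  also have "(\<Sum>k<n. \<bar>?r k\<bar>) \<le> real n * sqrt (2 * ?S)"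
  proof (rule power2_le_imp_le)
    have "(\<Sum>k<n. 1 * \<bar>?r k\<bar>)\<^sup>2 \<le> (\<Sum>k<n. 1\<^sup>2) * (\<Sum>k<n. \<bar>?r k\<bar>\<^sup>2)"
      by (rule Cauchy_Schwarz_ineq_sum)
    also have "\<dots> \<le> real n * (2 * real n * ?S)"
      using eigval_energy[of n "\<lambda>d. x d - y d"] by (simp add: mult_left_mono)
    also have "\<dots> = (real n * sqrt (2 * ?S))\<^sup>2"
      by (simp add: power_mult_distrib sum_nonneg power2_eq_square[of "real n"])
    finally show "(\<Sum>k<n. \<bar>?r k\<bar>)\<^sup>2 \<le> (real n * sqrt (2 * ?S))\<^sup>2" by simp
    show "0 \<le> real n * sqrt (2 * ?S)" by (simp add: sum_nonneg)
  qed
  finally have "cmod (\<Sum>k<n. iexp (t * eigval n k x / sqrt (real n)) - iexp (t * eigval n k y / sqrt (real n)))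
    \<le> \<bar>t\<bar> / sqrt (real n) * (real n * sqrt (2 * ?S))"
    by (simp add: mult_left_mono divide_right_mono)
  then have "cmod (\<Sum>k<n. iexp (t * eigval n k x / sqrt (real n)) - iexp (t * eigval n k y / sqrt (real n))) / real n
    \<le> \<bar>t\<bar> / sqrt (real n) * (real n * sqrt (2 * ?S)) / real n"
    by (rule divide_right_mono) simp
  moreover have "emp_char n t x - emp_char n t y
    = (\<Sum>k<n. iexp (t * eigval n k x / sqrt (real n)) - iexp (t * eigval n k y / sqrt (real n))) / of_nat n"
    unfolding emp_char_def sum_subtractf diff_divide_distrib ..
  ultimately have "cmod (emp_char n t x - emp_char n t y) \<le> \<bar>t\<bar> / sqrt (real n) * (real n * sqrt (2 * ?S)) / real n"
    by (simp only: norm_divide norm_of_nat)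
  also have "\<dots> = \<bar>t\<bar> * sqrt (2 / real n * ?S)"
    using n by (simp add: real_sqrt_mult real_sqrt_divide field_simps)
  finally show ?thesis .
qed (simp add: emp_char_def)

text \<open>
  A change of \<open>t\<close> amounts to a rescaling of the input.
\<close>
lemma emp_char_frequency_lipschitz:
  assumes "0 < n"
  shows "cmod (emp_char n t x - emp_char n s x) \<le> \<bar>t - s\<bar> * sqrt (2 / real n * (\<Sum>d\<in>freqs n. (x d)\<^sup>2))"
proof -
  have eq: "emp_char n 1 (\<lambda>d. t * x d) = emp_char n t x" for t
    by (simp add: emp_char_def eigval_def sum_distrib_left mult_ac)
  have "cmod (emp_char n t x - emp_char n s x)
    \<le> sqrt (2 / real n * (\<Sum>d\<in>freqs n. (t * x d - s * x d)\<^sup>2))"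
    using emp_char_lipschitz[of n 1 "\<lambda>d. t * x d" "\<lambda>d. s * x d"] by (simp add: eq)
  also have "(\<Sum>d\<in>freqs n. (t * x d - s * x d)\<^sup>2) = (t - s)\<^sup>2 * (\<Sum>d\<in>freqs n. (x d)\<^sup>2)"
    by (simp add: sum_distrib_left power2_eq_square algebra_simps)
  also have "sqrt (2 / real n * \<dots>) = \<bar>t - s\<bar> * sqrt (2 / real n * (\<Sum>d\<in>freqs n. (x d)\<^sup>2))"
    by (simp add: real_sqrt_mult real_sqrt_divide mult_ac)
  finally show ?thesis .
qed

text \<open>
  First-order Taylor expansion of the exponential in the changed coordinate. The linear term is a Fourier
  coefficient of \<open>k \<mapsto> iexp (t * eigval n k x / sqrt n)\<close> and is kept exactly, because only the sum of its squares over
  all sites is small; the quadratic remainder is \<open>O(1 / n)\<close> at each site.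
\<close>
lemma emp_char_single_site:
  assumes n: "0 < n" and d: "d \<in> freqs n"
    and x: "\<bar>x d\<bar> \<le> C" and y: "\<bar>y\<bar> \<le> C"
  shows "(cmod (emp_char n t x - emp_char n t (x(d := y))))\<^sup>2
    \<le> 8 * C\<^sup>2 * t\<^sup>2 / real n ^ 3 * (cmod (\<Sum>k<n. iexp (t * eigval n k x / sqrt (real n)) * mode n k d))\<^sup>2
      + 128 * C ^ 4 * t ^ 4 / (real n)\<^sup>2"
proof -
  have C0: "0 \<le> C" using x by simp
  have N: "0 < real n" using n by simp
  define a where "a k = t * eigval n k x / sqrt (real n)" for k
  define h where "h = t * (y - x d) / sqrt (real n)"
  define W where "W = (\<Sum>k<n. iexp (a k) * mode n k d)"
  have yx: "\<bar>y - x d\<bar> \<le> 2 * C" using x y by linarith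
  have h2: "h\<^sup>2 \<le> 4 * C\<^sup>2 * t\<^sup>2 / real n"
  proof -
    have "(y - x d)\<^sup>2 \<le> (2 * C)\<^sup>2" using yx by (rule power2_le_iff_abs_le[THEN iffD2, rotated]) (use C0 in simp)
    then have "t\<^sup>2 * (y - x d)\<^sup>2 / real n \<le> t\<^sup>2 * (2 * C)\<^sup>2 / real n"
      by (intro divide_right_mono mult_left_mono) auto
    then show ?thesis by (simp add: h_def power_divide power_mult_distrib mult_ac)
  qed
  have upd: "t * eigval n k (x(d := y)) / sqrt (real n) = a k + mode n k d * h" for k
    unfolding eigval_update[OF d] a_def h_def by (simp add: algebra_simps add_divide_distrib diff_divide_distrib)
  have expand: "iexp (a k + mode n k d * h) - iexp (a k)
     = \<i> * h * (iexp (a k) * mode n k d)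
       + iexp (a k) * (iexp (mode n k d * h) - 1 - \<i> * (mode n k d * h))" for k
    by (simp add: algebra_simps exp_add)
  have "emp_char n t (x(d := y)) - emp_char n t x
      = (\<Sum>k<n. iexp (a k + mode n k d * h) - iexp (a k)) / of_nat n"
    unfolding emp_char_def upd a_def[symmetric] by (simp add: sum_subtractf diff_divide_distrib)
  also have "(\<Sum>k<n. iexp (a k + mode n k d * h) - iexp (a k)) = \<i> * h * W
     + (\<Sum>k<n. iexp (a k) * (iexp (mode n k d * h) - 1 - \<i> * (mode n k d * h)))"
    unfolding expand W_def sum.distrib sum_distrib_left ..
  finally have eq: "emp_char n t (x(d := y)) - emp_char n t x = (\<i> * h * W
     + (\<Sum>k<n. iexp (a k) * (iexp (mode n k d * h) - 1 - \<i> * (mode n k d * h)))) / of_nat n" .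
  have rest: "cmod (\<Sum>k<n. iexp (a k) * (iexp (mode n k d * h) - 1 - \<i> * (mode n k d * h))) \<le> (\<Sum>k<n. 2 * h\<^sup>2)"
  proof (rule sum_norm_le)
    fix k
    have "(mode n k d)\<^sup>2 \<le> 4"
      using power_mono[OF abs_mode_le[of n k d], of 2] by simp
    then have "(mode n k d)\<^sup>2 * h\<^sup>2 \<le> 4 * h\<^sup>2" by (rule mult_right_mono) simp
    moreover have "cmod (iexp (mode n k d * h) - 1 - \<i> * complex_of_real (mode n k d * h)) \<le> (mode n k d * h)\<^sup>2 / 2"
      by (rule cmod_iexp_taylor1)
    ultimately show "cmod (iexp (a k) * (iexp (mode n k d * h) - 1 - \<i> * (mode n k d * h))) \<le> 2 * h\<^sup>2"
      by (simp add: norm_mult power_mult_distrib)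
  qed
  have "cmod (emp_char n t x - emp_char n t (x(d := y))) \<le> (\<bar>h\<bar> * cmod W + real n * (2 * h\<^sup>2)) / real n"
    unfolding norm_minus_commute[of "emp_char n t x"] eq norm_divide
    using rest by (intro divide_mono order_trans[OF norm_triangle_ineq] add_mono) (auto simp: norm_mult n)
  also have "\<dots> = \<bar>h\<bar> * cmod W / real n + 2 * h\<^sup>2" using N by (simp add: field_simps)
  finally have "(cmod (emp_char n t x - emp_char n t (x(d := y))))\<^sup>2 \<le> (\<bar>h\<bar> * cmod W / real n + 2 * h\<^sup>2)\<^sup>2"
    by (intro power_mono) auto
  moreover have "(\<bar>h\<bar> * cmod W / real n + 2 * h\<^sup>2)\<^sup>2 \<le> 2 * (\<bar>h\<bar> * cmod W / real n)\<^sup>2 + 2 * (2 * h\<^sup>2)\<^sup>2"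
    using sum_squares_bound[of "\<bar>h\<bar> * cmod W / real n" "2 * h\<^sup>2"] by (simp add: power2_sum)
  moreover have "(\<bar>h\<bar> * cmod W / real n)\<^sup>2 \<le> 4 * C\<^sup>2 * t\<^sup>2 / real n * ((cmod W)\<^sup>2 / (real n)\<^sup>2)"
  proof -
    have "(\<bar>h\<bar> * cmod W / real n)\<^sup>2 = h\<^sup>2 * ((cmod W)\<^sup>2 / (real n)\<^sup>2)"
      by (simp add: power_divide power_mult_distrib)
    also have "\<dots> \<le> 4 * C\<^sup>2 * t\<^sup>2 / real n * ((cmod W)\<^sup>2 / (real n)\<^sup>2)"
      using h2 by (rule mult_right_mono) simp
    finally show ?thesis .
  qed
  moreover have "(2 * h\<^sup>2)\<^sup>2 \<le> (2 * (4 * C\<^sup>2 * t\<^sup>2 / real n))\<^sup>2"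
    using h2 by (intro power_mono) auto
  ultimately have "(cmod (emp_char n t x - emp_char n t (x(d := y))))\<^sup>2
    \<le> 2 * (4 * C\<^sup>2 * t\<^sup>2 / real n * ((cmod W)\<^sup>2 / (real n)\<^sup>2)) + 2 * (2 * (4 * C\<^sup>2 * t\<^sup>2 / real n))\<^sup>2"
    by linarith
  also have "\<dots> = 8 * C\<^sup>2 * t\<^sup>2 / real n ^ 3 * (cmod W)\<^sup>2 + 128 * C ^ 4 * t ^ 4 / (real n)\<^sup>2"
    by (simp add: power_mult_distrib power_divide power2_eq_square power3_eq_cube power4_eq_xxxx mult_ac)
  finally show ?thesis unfolding W_def a_def .
qed

text \<open>
  Bessel's inequality for the linear terms of \<open>emp_char_single_site\<close>: they contribute \<open>O(1 / n)\<close> in total, although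
  the Lipschitz bound alone only gives a squared change of order \<open>1 / n\<close> at each of the \<open>n / 2\<close> sites. The remainders
  contribute \<open>n / 2\<close> times \<open>O(1 / n\<^sup>2)\<close>.
\<close>
lemma emp_char_sites:
  assumes n: "0 < n" and x: "\<And>d. \<bar>x d\<bar> \<le> C" and y: "\<And>d. \<bar>y d\<bar> \<le> C"
  shows "(\<Sum>d\<in>freqs n. (cmod (emp_char n t x - emp_char n t (x(d := y d))))\<^sup>2)
    \<le> (16 * C\<^sup>2 * t\<^sup>2 + 64 * C ^ 4 * t ^ 4) / real n"
proof -
  have N: "0 < real n" using n by simp
  define a where "a k = t * eigval n k x / sqrt (real n)" for k
  have "(\<Sum>d\<in>freqs n. (cmod (emp_char n t x - emp_char n t (x(d := y d))))\<^sup>2)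
    \<le> (\<Sum>d\<in>freqs n. 8 * C\<^sup>2 * t\<^sup>2 / real n ^ 3 * (cmod (\<Sum>k<n. iexp (a k) * mode n k d))\<^sup>2
      + 128 * C ^ 4 * t ^ 4 / (real n)\<^sup>2)"
    unfolding a_def by (intro sum_mono emp_char_single_site n x y)
  also have "\<dots> = 8 * C\<^sup>2 * t\<^sup>2 / real n ^ 3 * (\<Sum>d\<in>freqs n. (cmod (\<Sum>k<n. iexp (a k) * mode n k d))\<^sup>2)
      + real (n div 2) * (128 * C ^ 4 * t ^ 4 / (real n)\<^sup>2)"
    by (simp add: sum.distrib sum_distrib_left)
  finally have "(\<Sum>d\<in>freqs n. (cmod (emp_char n t x - emp_char n t (x(d := y d))))\<^sup>2)
    \<le> 8 * C\<^sup>2 * t\<^sup>2 / real n ^ 3 * (\<Sum>d\<in>freqs n. (cmod (\<Sum>k<n. iexp (a k) * mode n k d))\<^sup>2)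
      + real (n div 2) * (128 * C ^ 4 * t ^ 4 / (real n)\<^sup>2)" .
  moreover have "8 * C\<^sup>2 * t\<^sup>2 / real n ^ 3 * (\<Sum>d\<in>freqs n. (cmod (\<Sum>k<n. iexp (a k) * mode n k d))\<^sup>2)
    \<le> 8 * C\<^sup>2 * t\<^sup>2 / real n ^ 3 * (2 * (real n)\<^sup>2)"
  proof (rule mult_left_mono)
    have "(\<Sum>d\<in>freqs n. (cmod (\<Sum>k<n. iexp (a k) * mode n k d))\<^sup>2)
      = (\<Sum>d\<in>freqs n. (\<Sum>k<n. cos (a k) * mode n k d)\<^sup>2) + (\<Sum>d\<in>freqs n. (\<Sum>k<n. sin (a k) * mode n k d)\<^sup>2)"
      unfolding sum.distrib[symmetric]
      by (intro sum.cong refl) (simp add: cmod_power2 Re_exp Im_exp)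
    also have "\<dots> \<le> 2 * real n * (\<Sum>k<n. (cos (a k))\<^sup>2) + 2 * real n * (\<Sum>k<n. (sin (a k))\<^sup>2)"
      by (intro add_mono bessel_modes)
    also have "\<dots> = 2 * real n * (\<Sum>k<n. (cos (a k))\<^sup>2 + (sin (a k))\<^sup>2)"
      by (simp only: sum.distrib distrib_left)
    also have "\<dots> = 2 * (real n)\<^sup>2" by (simp add: power2_eq_square)
    finally show "(\<Sum>d\<in>freqs n. (cmod (\<Sum>k<n. iexp (a k) * mode n k d))\<^sup>2) \<le> 2 * (real n)\<^sup>2" .
  qed simp
  moreover have "8 * C\<^sup>2 * t\<^sup>2 / real n ^ 3 * (2 * (real n)\<^sup>2) = 16 * C\<^sup>2 * t\<^sup>2 / real n"
    using N by (simp add: power2_eq_square power3_eq_cube)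
  moreover have "real (n div 2) * (128 * C ^ 4 * t ^ 4 / (real n)\<^sup>2) \<le> (real n / 2) * (128 * C ^ 4 * t ^ 4 / (real n)\<^sup>2)"
  proof (rule mult_right_mono)
    have "real (2 * (n div 2)) \<le> real n" by (simp only: of_nat_le_iff)
    then show "real (n div 2) \<le> real n / 2" by simp
  qed simp
  moreover have "(real n / 2) * (128 * C ^ 4 * t ^ 4 / (real n)\<^sup>2) = 64 * C ^ 4 * t ^ 4 / real n"
    using N by (simp add: power2_eq_square)
  ultimately show ?thesis unfolding add_divide_distrib by linarith
qed

section \<open>Concentration for bounded inputs\<close>

text \<open>
  The sum of the \<open>W n\<close> has finite expectation, so it is almost surely finite and its terms tend to \<open>0\<close>. This
  replaces both Chebyshev's inequality and the Borel-Cantelli lemma below.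
\<close>
lemma AE_tendsto_zero_of_summable_expectation:
  fixes W :: "nat \<Rightarrow> 'a \<Rightarrow> real"
  assumes int: "\<And>n. integrable M (W n)" and nonneg: "\<And>n x. 0 \<le> W n x"
    and summ: "summable (\<lambda>n. \<integral>x. W n x \<partial>M)"
  shows "AE x in M. (\<lambda>n. W n x) \<longlonglongrightarrow> 0"
proof -
  have [measurable]: "W n \<in> borel_measurable M" for n using int by auto
  have "(\<integral>\<^sup>+x. (\<Sum>n. ennreal (W n x)) \<partial>M) = (\<Sum>n. \<integral>\<^sup>+x. ennreal (W n x) \<partial>M)"
    by (rule nn_integral_suminf) measurable
  also have "\<dots> = (\<Sum>n. ennreal (\<integral>x. W n x \<partial>M))"
    using int nonneg by (intro suminf_cong nn_integral_eq_integral) auto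
  also have "\<dots> = ennreal (\<Sum>n. \<integral>x. W n x \<partial>M)"
    using summ nonneg by (intro suminf_ennreal2) auto
  finally have "(\<integral>\<^sup>+x. (\<Sum>n. ennreal (W n x)) \<partial>M) \<noteq> \<infinity>" by simp
  then have "AE x in M. (\<Sum>n. ennreal (W n x)) \<noteq> \<infinity>"
    by (intro nn_integral_PInf_AE) measurable
  then show ?thesis
  proof (rule AE_mp, intro AE_I2 impI)
    fix x assume "(\<Sum>n. ennreal (W n x)) \<noteq> \<infinity>"
    then have "summable (\<lambda>n. W n x)" using nonneg by (intro summable_suminf_not_top) auto
    then show "(\<lambda>n. W n x) \<longlonglongrightarrow> 0" by (rule summable_LIMSEQ_zero)
  qed
qed

lemma (in prob_space) expectation_indep_vars_PiM:
  fixes f :: "('i \<Rightarrow> real) \<Rightarrow> real"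
  assumes indep: "indep_vars (\<lambda>_. borel) X I" and I: "I \<noteq> {}"
    and f: "f \<in> borel_measurable (PiM I (\<lambda>i. distr M borel (X i)))"
  shows "expectation (\<lambda>\<omega>. f (\<lambda>i\<in>I. X i \<omega>)) = (\<integral>x. f x \<partial>PiM I (\<lambda>i. distr M borel (X i)))"
proof -
  have rv: "\<And>i. i \<in> I \<Longrightarrow> random_variable borel (X i)"
    using indep by (auto simp: indep_vars_def)
  have eq: "distr M (PiM I (\<lambda>i. borel)) (\<lambda>\<omega>. \<lambda>i\<in>I. X i \<omega>) = PiM I (\<lambda>i. distr M borel (X i))"
    using indep_vars_iff_distr_eq_PiM'[OF I rv] indep by simp
  have "f \<in> borel_measurable (PiM I (\<lambda>i. borel))"
    using f by (simp add: measurable_def sets_PiM_cong[of I I "\<lambda>i. distr M borel (X i)" "\<lambda>_. borel"] space_PiM)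
  moreover have "(\<lambda>\<omega>. \<lambda>i\<in>I. X i \<omega>) \<in> M \<rightarrow>\<^sub>M PiM I (\<lambda>i. borel)"
    using rv by (intro measurable_restrict) auto
  ultimately show ?thesis unfolding eq[symmetric] by (subst integral_distr) auto
qed

lemma emp_char_cong:
  assumes "\<And>d. d \<in> freqs n \<Longrightarrow> x d = y d"
  shows "emp_char n t x = emp_char n t y"
proof -
  have "eigval n k x = eigval n k y" for k
    unfolding eigval_def by (rule sum.cong) (simp_all add: assms)
  then show ?thesis by (simp add: emp_char_def)
qed

lemma borel_measurable_emp_char_PiM:
  assumes "\<And>d. sets (\<mu> d) = sets borel"
  shows "(\<lambda>x. emp_char n t (\<lambda>d. clip C (x d))) \<in> borel_measurable (PiM (freqs n) \<mu>)"
proof -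
  have 1: "(\<lambda>x. clip C (x d)) \<in> borel_measurable (PiM (freqs n) \<mu>)" if "d \<in> freqs n" for d
  proof -
    have "(\<lambda>x. x d) \<in> PiM (freqs n) \<mu> \<rightarrow>\<^sub>M \<mu> d" by (rule measurable_component_singleton) (rule that)
    then have "(\<lambda>x. x d) \<in> PiM (freqs n) \<mu> \<rightarrow>\<^sub>M borel"
      using assms by (simp cong: measurable_cong_sets)
    then show ?thesis by measurable
  qed
  have 2: "(\<lambda>x. eigval n k (\<lambda>d. clip C (x d))) \<in> borel_measurable (PiM (freqs n) \<mu>)" for k
    unfolding eigval_def using 1 by (intro borel_measurable_sum borel_measurable_times) auto
  show ?thesis
    unfolding emp_char_def using 2 by measurable
qed

lemma (in prob_space) borel_measurable_emp_char:
  assumes [measurable]: "\<And>d. X d \<in> borel_measurable M"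
  shows "(\<lambda>\<omega>. emp_char n t (\<lambda>d. X d \<omega>)) \<in> borel_measurable M"
  unfolding emp_char_def eigval_def by measurable

text \<open>
  The clipping is part of the function of \<open>x\<close>, so the pathwise hypothesis of \<open>fourth_central_moment_bound\<close>
  holds at all points of the product space.
\<close>
lemma (in prob_space) emp_char_fourth_moment:
  fixes t :: real
  assumes indep: "indep_vars (\<lambda>_. borel) X (UNIV :: nat set)" and n: "2 \<le> n" and C: "0 \<le> C"
    and G: "G \<in> {Re, Im}"
  defines "g \<equiv> (\<lambda>\<omega>. G (emp_char n t (\<lambda>d. clip C (X d \<omega>))))"
  shows "expectation (\<lambda>\<omega>. (g \<omega> - expectation g) ^ 4)
    \<le> 11 * ((16 * C\<^sup>2 * t\<^sup>2 + 64 * C ^ 4 * t ^ 4) / real n)\<^sup>2"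
proof -
  define I where "I = freqs n"
  have I: "I \<noteq> {}" "finite I" using n by (auto simp: I_def)
  define \<mu> where "\<mu> d = distr M borel (X d)" for d
  define f where "f x = G (emp_char n t (\<lambda>d. clip C (x d)))" for x
  have rv: "random_variable borel (X d)" for d using indep by (auto simp: indep_vars_def)
  have indepI: "indep_vars (\<lambda>_. borel) X I" by (rule indep_vars_subset[OF indep]) simp
  have Gm: "G \<in> borel_measurable borel" using G by auto
  have fm: "f \<in> borel_measurable (PiM I \<mu>)"
    unfolding f_def I_def
    by (rule measurable_compose[OF borel_measurable_emp_char_PiM Gm]) (simp add: \<mu>_def)
  have G_le: "\<bar>G z\<bar> \<le> cmod z" for z using G abs_Re_le_cmod abs_Im_le_cmod by auto
  have G_diff: "G z - G w = G (z - w)" for z w using G by auto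
  have gf: "g \<omega> = f (\<lambda>d\<in>I. X d \<omega>)" for \<omega>
    unfolding g_def f_def I_def by (intro arg_cong[where f = G] emp_char_cong) simp
  have Ef: "expectation (\<lambda>\<omega>. h (f (\<lambda>d\<in>I. X d \<omega>))) = (\<integral>x. h (f x) \<partial>PiM I \<mu>)"
    if h: "h \<in> borel_measurable borel" for h :: "real \<Rightarrow> real"
    unfolding \<mu>_def
    by (rule expectation_indep_vars_PiM[OF indepI I(1)])
       (rule measurable_compose[OF fm[unfolded \<mu>_def] h])
  have "(\<integral>x. (f x - (\<integral>x. f x \<partial>PiM I \<mu>)) ^ 4 \<partial>PiM I \<mu>)
    \<le> 11 * ((16 * C\<^sup>2 * t\<^sup>2 + 64 * C ^ 4 * t ^ 4) / real n)\<^sup>2"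
  proof (rule fourth_central_moment_bound)
    show "prob_space (\<mu> d)" for d unfolding \<mu>_def by (rule prob_space_distr) (rule rv)
    show "finite I" by fact
    show "f \<in> borel_measurable (PiM I \<mu>)" by fact
    show "\<bar>f x\<bar> \<le> 1" for x
      unfolding f_def using G_le cmod_emp_char_le by (rule order_trans)
    fix x y :: "nat \<Rightarrow> real"
    have upd: "(\<lambda>e. clip C ((x(d := y d)) e)) = (\<lambda>e. clip C (x e))(d := clip C (y d))" for d
      by auto
    have "(\<Sum>d\<in>I. (f x - f (x(d := y d)))\<^sup>2)
      \<le> (\<Sum>d\<in>I. (cmod (emp_char n t (\<lambda>e. clip C (x e)) - emp_char n t ((\<lambda>e. clip C (x e))(d := clip C (y d)))))\<^sup>2)"
      unfolding f_def G_diff upd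
      by (intro sum_mono) (rule power2_le_iff_abs_le[THEN iffD2, OF norm_ge_zero G_le])
    also have "\<dots> \<le> (16 * C\<^sup>2 * t\<^sup>2 + 64 * C ^ 4 * t ^ 4) / real n"
      unfolding I_def using n C by (intro emp_char_sites clip_bounds) auto
    finally show "(\<Sum>d\<in>I. (f x - f (x(d := y d)))\<^sup>2) \<le> (16 * C\<^sup>2 * t\<^sup>2 + 64 * C ^ 4 * t ^ 4) / real n" .
  qed
  moreover have "expectation g = (\<integral>x. f x \<partial>PiM I \<mu>)"
    using Ef[of "\<lambda>y. y"] unfolding gf by simp
  ultimately show ?thesis
    using Ef[of "\<lambda>y. (y - (\<integral>x. f x \<partial>PiM I \<mu>)) ^ 4"] unfolding gf by simp
qed

text \<open>
  The fourth moments of order \<open>1 / n\<^sup>2\<close> are summable, whereas a bound of order \<open>1 / n\<close> on the variances would not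
  suffice.
\<close>
lemma (in prob_space) emp_char_concentration:
  assumes indep: "indep_vars (\<lambda>_. borel) X (UNIV :: nat set)" and C: "0 \<le> C"
  shows "AE \<omega> in M. (\<lambda>n. emp_char n t (\<lambda>d. clip C (X d \<omega>))
      - expectation (\<lambda>\<omega>. emp_char n t (\<lambda>d. clip C (X d \<omega>)))) \<longlonglongrightarrow> 0"
proof -
  have rv [measurable]: "random_variable borel (X d)" for d using indep by (auto simp: indep_vars_def)
  define Z where "Z n \<omega> = emp_char n t (\<lambda>d. clip C (X d \<omega>))" for n \<omega>
  have Zm [measurable]: "Z n \<in> borel_measurable M" for n
    unfolding Z_def by (rule borel_measurable_emp_char) measurable
  have Zi: "integrable M (Z n)" for n
    by (rule integrable_const_bound[where B = 1]) (use cmod_emp_char_le in \<open>auto simp: Z_def\<close>)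
  have part: "AE \<omega> in M. (\<lambda>n. G (Z n \<omega>) - expectation (\<lambda>\<omega>. G (Z n \<omega>))) \<longlonglongrightarrow> 0" if G: "G \<in> {Re, Im}" for G
  proof -
    have Gm [measurable]: "G \<in> borel_measurable borel" using G by auto
    have Gb: "\<bar>G (Z n \<omega>)\<bar> \<le> 1" for n \<omega>
      using G abs_Re_le_cmod abs_Im_le_cmod order_trans cmod_emp_char_le unfolding Z_def by blast
    define W where "W n \<omega> = (G (Z n \<omega>) - expectation (\<lambda>\<omega>. G (Z n \<omega>))) ^ 4" for n \<omega>
    have "AE \<omega> in M. (\<lambda>n. W n \<omega>) \<longlonglongrightarrow> 0"
    proof (rule AE_tendsto_zero_of_summable_expectation)
      have "\<bar>G (Z n \<omega>) - expectation (\<lambda>\<omega>. G (Z n \<omega>))\<bar> \<le> 2" for n \<omega>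
        using Gb[of n \<omega>] abs_expectation_le[of "\<lambda>\<omega>. G (Z n \<omega>)" 1, OF Gb] by linarith
      then have "\<bar>W n \<omega>\<bar> \<le> 2 ^ 4" for n \<omega>
        unfolding W_def power_abs by (rule power_mono) simp
      then show "integrable M (W n)" for n
        by (rule integrable_bounded[rotated]) (unfold W_def, measurable)
      show "0 \<le> W n \<omega>" for n \<omega> by (simp add: W_def)
      define K where "K = 11 * (16 * C\<^sup>2 * t\<^sup>2 + 64 * C ^ 4 * t ^ 4)\<^sup>2"
      show "summable (\<lambda>n. expectation (W n))"
      proof (rule summable_comparison_test_ev)
        show "\<forall>\<^sub>F n in sequentially. norm (expectation (W n)) \<le> K * inverse ((real n)\<^sup>2)"
        proof (rule eventually_sequentiallyI)
          fix n :: nat assume n: "2 \<le> n"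
          have "0 \<le> expectation (W n)" by (simp add: W_def)
          then show "norm (expectation (W n)) \<le> K * inverse ((real n)\<^sup>2)"
            using emp_char_fourth_moment[OF indep n C G, of t]
            by (simp add: W_def[abs_def] Z_def K_def power_divide divide_inverse power_mult_distrib power_inverse mult_ac)
        qed
        show "summable (\<lambda>n. K * inverse ((real n)\<^sup>2))"
          by (intro summable_mult inverse_power_summable) simp
      qed
    qed
    then show ?thesis
    proof (rule AE_mp, intro AE_I2 impI)
      fix \<omega> assume "(\<lambda>n. W n \<omega>) \<longlonglongrightarrow> 0"
      then have "(\<lambda>n. sqrt (sqrt (W n \<omega>))) \<longlonglongrightarrow> sqrt (sqrt 0)"
        by (intro tendsto_real_sqrt)
      moreover have "sqrt (sqrt (W n \<omega>)) = \<bar>G (Z n \<omega>) - expectation (\<lambda>\<omega>. G (Z n \<omega>))\<bar>" for n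
      proof -
        have "W n \<omega> = ((G (Z n \<omega>) - expectation (\<lambda>\<omega>. G (Z n \<omega>)))\<^sup>2)\<^sup>2"
          by (simp add: W_def flip: power_mult)
        then show ?thesis by (simp only: real_sqrt_abs abs_power2)
      qed
      ultimately show "(\<lambda>n. G (Z n \<omega>) - expectation (\<lambda>\<omega>. G (Z n \<omega>))) \<longlonglongrightarrow> 0"
        by (simp add: tendsto_rabs_zero_iff)
    qed
  qed
  have "AE \<omega> in M. (\<lambda>n. Re (Z n \<omega>) - expectation (\<lambda>\<omega>. Re (Z n \<omega>))) \<longlonglongrightarrow> 0
     \<and> (\<lambda>n. Im (Z n \<omega>) - expectation (\<lambda>\<omega>. Im (Z n \<omega>))) \<longlonglongrightarrow> 0"
    using part[of Re] part[of Im] by auto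
  then show ?thesis
  proof (rule AE_mp, intro AE_I2 impI)
    fix \<omega>
    assume *: "(\<lambda>n. Re (Z n \<omega>) - expectation (\<lambda>\<omega>. Re (Z n \<omega>))) \<longlonglongrightarrow> 0
     \<and> (\<lambda>n. Im (Z n \<omega>) - expectation (\<lambda>\<omega>. Im (Z n \<omega>))) \<longlonglongrightarrow> 0"
    show "(\<lambda>n. emp_char n t (\<lambda>d. clip C (X d \<omega>))
      - expectation (\<lambda>\<omega>. emp_char n t (\<lambda>d. clip C (X d \<omega>)))) \<longlonglongrightarrow> 0"
      unfolding Z_def[symmetric] tendsto_complex_iff
      using * integral_Re[OF Zi] integral_Im[OF Zi] by simp
  qed
qed

section \<open>The Gaussian limit of the expectation\<close>

abbreviation tail_square :: "real \<Rightarrow> real \<Rightarrow> real" where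
  "tail_square K y \<equiv> if K < \<bar>y\<bar> then y\<^sup>2 else 0"

text \<open>
  Uniform integrability of the squares; it provides the Lindeberg condition for all weighted sums with
  uniformly small weights.
\<close>
definition (in prob_space) uniformly_square_integrable :: "(nat \<Rightarrow> 'a \<Rightarrow> real) \<Rightarrow> bool" where
  "uniformly_square_integrable X \<longleftrightarrow>
    (\<forall>\<epsilon>>0. \<exists>K\<ge>0. \<forall>i. expectation (\<lambda>\<omega>. tail_square K (X i \<omega>)) \<le> \<epsilon>)"

lemma exp_minus_bounds:
  fixes a :: real
  assumes "0 \<le> a"
  shows "\<bar>exp (- a) - (1 - a)\<bar> \<le> a\<^sup>2"
proof -
  have "1 - a \<le> exp (- a)" using exp_ge_add_one_self[of "- a"] by simp
  moreover have "exp (- a) \<le> 1 - a + a\<^sup>2"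
  proof -
    have "1 \<le> (1 - a + a\<^sup>2) * (1 + a)"
      using assms by (simp add: algebra_simps power2_eq_square)
    also have "\<dots> \<le> (1 - a + a\<^sup>2) * exp a"
    proof (rule mult_left_mono)
      show "1 + a \<le> exp a" by (rule exp_ge_add_one_self)
      have "0 \<le> (1 - a)\<^sup>2 + (1 + a\<^sup>2)" by simp
      then show "0 \<le> 1 - a + a\<^sup>2" using assms by (simp add: power2_diff)
    qed
    finally show ?thesis by (simp add: exp_minus field_simps)
  qed
  ultimately show ?thesis by linarith
qed

lemma exp_minus_lipschitz:
  fixes a b :: real
  assumes "0 \<le> a" "0 \<le> b"
  shows "\<bar>exp (- a) - exp (- b)\<bar> \<le> \<bar>a - b\<bar>"
proof -
  have *: "exp (- a) - exp (- b) \<le> b - a" if "0 \<le> a" "a \<le> b" for a b :: real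
  proof -
    have "exp (- a) - exp (- b) = exp (- a) * (1 - exp (- (b - a)))"
      by (simp add: algebra_simps flip: exp_add)
    also have "\<dots> \<le> 1 * (b - a)"
    proof (rule mult_mono)
      show "1 - exp (- (b - a)) \<le> b - a"
        using exp_ge_add_one_self[of "- (b - a)"] by linarith
    qed (use that in auto)
    finally show ?thesis by simp
  qed
  show ?thesis
    using *[of a b] *[of b a] assms by (cases "a \<le> b") (auto simp: abs_if)
qed

text \<open>
  Second-order expansion of a characteristic function with the Lindeberg splitting of the remainder
  \<open>min (6 c\<^sup>2 X\<^sup>2) (\<bar>c X\<bar> ^ 3)\<close>: the first argument is used where \<open>\<bar>X\<bar> > K\<close>, the second one elsewhere.
\<close>
lemma (in prob_space) char_scaled_close:
  fixes X :: "'a \<Rightarrow> real"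
  assumes [measurable]: "random_variable borel X"
    and i1: "integrable M X" and i2: "integrable M (\<lambda>\<omega>. (X \<omega>)\<^sup>2)"
    and mean: "expectation X = 0" and var: "expectation (\<lambda>\<omega>. (X \<omega>)\<^sup>2) = 1"
    and K: "0 \<le> K" and tail: "expectation (\<lambda>\<omega>. tail_square K (X \<omega>)) \<le> \<epsilon>"
  shows "cmod (char (distr M borel (\<lambda>\<omega>. c * X \<omega>)) 1 - of_real (exp (- (c\<^sup>2 / 2))))
    \<le> c\<^sup>2 * (\<epsilon> + \<bar>c\<bar> * K / 6 + c\<^sup>2 / 4)"
proof -
  have tail_i: "integrable M (\<lambda>\<omega>. tail_square K (X \<omega>))"
    by (rule Bochner_Integration.integrable_bound[OF i2]) auto
  have "cmod (char (distr M borel (\<lambda>\<omega>. c * X \<omega>)) 1 - (1 - 1\<^sup>2 * c\<^sup>2 / 2))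
    \<le> (1\<^sup>2 / 6) * expectation (\<lambda>\<omega>. min (6 * (c * X \<omega>)\<^sup>2) (\<bar>1\<bar> * \<bar>c * X \<omega>\<bar> ^ 3))"
    by (rule char_approx3') (use i1 i2 mean var in \<open>auto simp: power_mult_distrib\<close>)
  also have "\<dots> \<le> (1\<^sup>2 / 6) * expectation (\<lambda>\<omega>. c\<^sup>2 * (6 * (tail_square K (X \<omega>)) + \<bar>c\<bar> * K * (X \<omega>)\<^sup>2))"
  proof (rule mult_left_mono[OF integral_mono])
    show "integrable M (\<lambda>\<omega>. min (6 * (c * X \<omega>)\<^sup>2) (\<bar>1\<bar> * \<bar>c * X \<omega>\<bar> ^ 3))"
    proof (rule Bochner_Integration.integrable_bound)
      show "integrable M (\<lambda>\<omega>. 6 * (c * X \<omega>)\<^sup>2)" using i2 by (simp add: power_mult_distrib)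
    qed auto
    show "integrable M (\<lambda>\<omega>. c\<^sup>2 * (6 * (tail_square K (X \<omega>)) + \<bar>c\<bar> * K * (X \<omega>)\<^sup>2))"
      using i2 tail_i by (intro integrable_mult_right Bochner_Integration.integrable_add)
    fix \<omega>
    show "min (6 * (c * X \<omega>)\<^sup>2) (\<bar>1\<bar> * \<bar>c * X \<omega>\<bar> ^ 3)
      \<le> c\<^sup>2 * (6 * (tail_square K (X \<omega>)) + \<bar>c\<bar> * K * (X \<omega>)\<^sup>2)"
    proof (cases "K < \<bar>X \<omega>\<bar>")
      case True
      have "min (6 * (c * X \<omega>)\<^sup>2) (\<bar>1\<bar> * \<bar>c * X \<omega>\<bar> ^ 3) \<le> 6 * (c * X \<omega>)\<^sup>2" by simp
      also have "\<dots> \<le> c\<^sup>2 * (6 * (X \<omega>)\<^sup>2 + \<bar>c\<bar> * K * (X \<omega>)\<^sup>2)"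
        using K by (simp add: power_mult_distrib distrib_left)
      finally show ?thesis using True by simp
    next
      case False
      have "min (6 * (c * X \<omega>)\<^sup>2) (\<bar>1\<bar> * \<bar>c * X \<omega>\<bar> ^ 3) \<le> \<bar>c * X \<omega>\<bar> ^ 3" by simp
      also have "\<dots> = c\<^sup>2 * (\<bar>c\<bar> * \<bar>X \<omega>\<bar> * (X \<omega>)\<^sup>2)"
      proof -
        have "c\<^sup>2 = \<bar>c\<bar> * \<bar>c\<bar>" "(X \<omega>)\<^sup>2 = \<bar>X \<omega>\<bar> * \<bar>X \<omega>\<bar>" by (simp_all add: power2_eq_square)
        then show ?thesis by (simp only: power3_eq_cube abs_mult mult_ac)
      qed
      also have "\<dots> \<le> c\<^sup>2 * (\<bar>c\<bar> * K * (X \<omega>)\<^sup>2)"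
        using False by (intro mult_left_mono mult_right_mono) auto
      finally show ?thesis using False by simp
    qed
  qed simp
  also have "\<dots> = c\<^sup>2 * (expectation (\<lambda>\<omega>. tail_square K (X \<omega>)) + \<bar>c\<bar> * K / 6)"
    using i2 tail_i var by (simp add: algebra_simps)
  also have "\<dots> \<le> c\<^sup>2 * (\<epsilon> + \<bar>c\<bar> * K / 6)"
    using tail by (intro mult_left_mono) auto
  finally have 1: "cmod (char (distr M borel (\<lambda>\<omega>. c * X \<omega>)) 1 - of_real (1 - c\<^sup>2 / 2)) \<le> c\<^sup>2 * (\<epsilon> + \<bar>c\<bar> * K / 6)"
    by simp
  have "cmod (of_real (1 - c\<^sup>2 / 2) - of_real (exp (- (c\<^sup>2 / 2)))) = \<bar>exp (- (c\<^sup>2 / 2)) - (1 - c\<^sup>2 / 2)\<bar>"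
    unfolding of_real_diff[symmetric] norm_of_real by (rule abs_minus_commute)
  also have "\<dots> \<le> (c\<^sup>2 / 2)\<^sup>2" by (rule exp_minus_bounds) simp
  also have "\<dots> = c\<^sup>2 * (c\<^sup>2 / 4)" by (simp add: power2_eq_square)
  finally have 2: "cmod (of_real (1 - c\<^sup>2 / 2) - of_real (exp (- (c\<^sup>2 / 2)))) \<le> c\<^sup>2 * (c\<^sup>2 / 4)" .
  show ?thesis
    using norm_triangle_le[OF add_mono[OF 1 2]] by (simp add: distrib_left)
qed

text \<open>
  By independence both sides are products of factors of modulus at most \<open>1\<close>, so the errors of
  \<open>char_scaled_close\<close> add up.
\<close>
lemma (in prob_space) char_linear_combination_close:
  fixes X :: "nat \<Rightarrow> 'a \<Rightarrow> real" and c :: "nat \<Rightarrow> real"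
  assumes std: "indep_standardized X" and fin: "finite I"
    and K: "0 \<le> K" and tail: "\<And>i. expectation (\<lambda>\<omega>. tail_square K (X i \<omega>)) \<le> \<epsilon>"
    and c: "\<And>i. i \<in> I \<Longrightarrow> \<bar>c i\<bar> \<le> \<eta>"
  shows "cmod (expectation (\<lambda>\<omega>. iexp (\<Sum>i\<in>I. c i * X i \<omega>)) - of_real (exp (- ((\<Sum>i\<in>I. (c i)\<^sup>2) / 2))))
    \<le> (\<Sum>i\<in>I. (c i)\<^sup>2) * (\<epsilon> + \<eta> * K / 6 + \<eta>\<^sup>2 / 4)"
proof -
  have indep: "indep_vars (\<lambda>_. borel) X UNIV"
    and i: "integrable M (X i)" "integrable M (\<lambda>\<omega>. (X i \<omega>)\<^sup>2)" "expectation (X i) = 0"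
    and v: "variance (X i) = 1" for i
    using std unfolding indep_standardized_def by blast+
  have v': "expectation (\<lambda>\<omega>. (X i \<omega>)\<^sup>2) = 1" for i using v[of i] i(3)[of i] by simp
  have rv [measurable]: "random_variable borel (X i)" for i using indep by (auto simp: indep_vars_def)
  define \<nu> where "\<nu> j = distr M borel (\<lambda>\<omega>. c j * X j \<omega>)" for j
  have \<nu>: "real_distribution (\<nu> j)" for j
    unfolding \<nu>_def by (rule real_distribution_distr) measurable
  have indepc: "indep_vars (\<lambda>_. borel) (\<lambda>j \<omega>. c j * X j \<omega>) I"
    by (rule indep_vars_compose2[where X = X and Y = "\<lambda>j y. c j * y", OF indep_vars_subset[OF indep]]) auto
  have "expectation (\<lambda>\<omega>. iexp (\<Sum>i\<in>I. c i * X i \<omega>)) = char (distr M borel (\<lambda>\<omega>. \<Sum>i\<in>I. c i * X i \<omega>)) 1"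
    unfolding char_def by (subst integral_distr) (auto simp: )
  also have "\<dots> = (\<Prod>i\<in>I. char (\<nu> i) 1)"
    unfolding \<nu>_def by (rule char_distr_sum[OF indepc])
  finally have 1: "expectation (\<lambda>\<omega>. iexp (\<Sum>i\<in>I. c i * X i \<omega>)) = (\<Prod>i\<in>I. char (\<nu> i) 1)" .
  have 2: "of_real (exp (- ((\<Sum>i\<in>I. (c i)\<^sup>2) / 2))) = (\<Prod>i\<in>I. complex_of_real (exp (- ((c i)\<^sup>2 / 2))))"
    using fin by (simp add: exp_sum sum_divide_distrib flip: sum_negf of_real_prod)
  have "cmod ((\<Prod>i\<in>I. char (\<nu> i) 1) - (\<Prod>i\<in>I. complex_of_real (exp (- ((c i)\<^sup>2 / 2)))))
    \<le> (\<Sum>i\<in>I. cmod (char (\<nu> i) 1 - complex_of_real (exp (- ((c i)\<^sup>2 / 2)))))"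
    by (rule norm_prod_diff) (auto intro: real_distribution.cmod_char_le_1[OF \<nu>])
  also have "\<dots> \<le> (\<Sum>i\<in>I. (c i)\<^sup>2 * (\<epsilon> + \<eta> * K / 6 + \<eta>\<^sup>2 / 4))"
  proof (rule sum_mono)
    fix j assume j: "j \<in> I"
    have "cmod (char (\<nu> j) 1 - complex_of_real (exp (- ((c j)\<^sup>2 / 2)))) \<le> (c j)\<^sup>2 * (\<epsilon> + \<bar>c j\<bar> * K / 6 + (c j)\<^sup>2 / 4)"
      unfolding \<nu>_def by (rule char_scaled_close[OF rv i v' K tail])
    also have "\<dots> \<le> (c j)\<^sup>2 * (\<epsilon> + \<eta> * K / 6 + \<eta>\<^sup>2 / 4)"
      using c[OF j] K power_mono[OF c[OF j], of 2] by (intro mult_left_mono add_mono divide_right_mono mult_right_mono) auto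
    finally show "cmod (char (\<nu> j) 1 - complex_of_real (exp (- ((c j)\<^sup>2 / 2)))) \<le> (c j)\<^sup>2 * (\<epsilon> + \<eta> * K / 6 + \<eta>\<^sup>2 / 4)" .
  qed
  finally show ?thesis unfolding 1 2 by (simp add: sum_distrib_right)
qed

text \<open>
  Averages \<open>char_linear_combination_close\<close> over \<open>k\<close>. The variance \<open>S k / t\<^sup>2\<close> of the \<open>k\<close>-th linear form is within \<open>1 / n\<close>
  of \<open>1\<close> by \<open>mode_energy\<close>, except for at most one index, whose weight is \<open>1 / n\<close>.
\<close>
lemma (in prob_space) expectation_emp_char_close:
  fixes X :: "nat \<Rightarrow> 'a \<Rightarrow> real" and t :: real
  assumes std: "indep_standardized X" and n: "0 < n"
    and K: "0 \<le> K" and tail: "\<And>i. expectation (\<lambda>\<omega>. tail_square K (X i \<omega>)) \<le> \<epsilon>"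
  defines "\<eta> \<equiv> 2 * \<bar>t\<bar> / sqrt (real n)"
  shows "cmod (expectation (\<lambda>\<omega>. emp_char n t (\<lambda>d. X d \<omega>)) - of_real (exp (- (t\<^sup>2 / 2))))
    \<le> 2 * t\<^sup>2 * (\<epsilon> + \<eta> * K / 6 + \<eta>\<^sup>2 / 4) + (t\<^sup>2 / 2 + 1) / real n"
proof -
  have N: "0 < real n" using n by simp
  have indep: "indep_vars (\<lambda>_. borel) X UNIV" using std by (auto simp: indep_standardized_def)
  have rv [measurable]: "random_variable borel (X i)" for i using indep by (auto simp: indep_vars_def)
  have \<epsilon>: "0 \<le> \<epsilon>" by (rule order_trans[OF Bochner_Integration.integral_nonneg tail]) simp
  have \<eta>: "0 \<le> \<eta>" by (simp add: \<eta>_def)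
  define E where "E = \<epsilon> + \<eta> * K / 6 + \<eta>\<^sup>2 / 4"
  have E: "0 \<le> E" using \<epsilon> \<eta> K by (simp add: E_def)
  define I where "I = freqs n"
  define c where "c k d = t / sqrt (real n) * mode n k d" for k d
  define S where "S k = (\<Sum>d\<in>I. (c k d)\<^sup>2)" for k
  have S_eq: "S k = t\<^sup>2 / real n * (\<Sum>d\<in>I. (mode n k d)\<^sup>2)" for k
    unfolding S_def c_def sum_distrib_left
    by (intro sum.cong refl) (use N in \<open>simp add: power_mult_distrib power_divide\<close>)
  have S_le: "S k \<le> 2 * t\<^sup>2" for k
  proof -
    have "(\<Sum>d\<in>I. (mode n k d)\<^sup>2) \<le> (\<Sum>d\<in>I. 4)"
      using power_mono[OF abs_mode_le, of n k _ 2] by (intro sum_mono) simp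
    also have "\<dots> \<le> 2 * real n"
    proof -
      have "real (2 * (n div 2)) \<le> real n" by (simp only: of_nat_le_iff)
      then show ?thesis by (simp add: I_def)
    qed
    finally have "S k \<le> t\<^sup>2 / real n * (2 * real n)"
      unfolding S_eq by (rule mult_left_mono) simp
    then show ?thesis using N by simp
  qed
  have S0: "0 \<le> S k" for k unfolding S_def by (rule sum_nonneg) simp
  have char_k: "cmod (expectation (\<lambda>\<omega>. iexp (t * eigval n k (\<lambda>d. X d \<omega>) / sqrt (real n))) - of_real (exp (- (S k / 2))))
    \<le> 2 * t\<^sup>2 * E" for k
  proof -
    have "t * eigval n k (\<lambda>d. X d \<omega>) / sqrt (real n) = (\<Sum>d\<in>I. c k d * X d \<omega>)" for \<omega>
      unfolding eigval_def c_def I_def by (simp add: sum_distrib_left sum_divide_distrib mult_ac)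
    then have "cmod (expectation (\<lambda>\<omega>. iexp (t * eigval n k (\<lambda>d. X d \<omega>) / sqrt (real n))) - of_real (exp (- (S k / 2))))
      = cmod (expectation (\<lambda>\<omega>. iexp (\<Sum>d\<in>I. c k d * X d \<omega>)) - of_real (exp (- (S k / 2))))" by simp
    also have "\<dots> \<le> S k * E"
      unfolding S_def E_def
    proof (rule char_linear_combination_close[OF std _ K tail])
      fix d
      have "\<bar>t\<bar> / sqrt (real n) * \<bar>mode n k d\<bar> \<le> \<bar>t\<bar> / sqrt (real n) * 2"
        by (intro mult_left_mono abs_mode_le) simp
      then show "\<bar>c k d\<bar> \<le> \<eta>" by (simp add: c_def \<eta>_def abs_mult mult_ac)
    qed (simp add: I_def)
    also have "\<dots> \<le> 2 * t\<^sup>2 * E" using S_le E by (rule mult_right_mono)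
    finally show ?thesis .
  qed
  have gauss_k: "\<bar>exp (- (S k / 2)) - exp (- (t\<^sup>2 / 2))\<bar> \<le> (if 2 * k + 1 = n then 1 else t\<^sup>2 / (2 * real n))"
    if k: "k < n" for k
  proof (cases "2 * k + 1 = n")
    case True
    have "0 < exp (- (S k / 2))" "exp (- (S k / 2)) \<le> 1" "0 < exp (- (t\<^sup>2 / 2))" "exp (- (t\<^sup>2 / 2)) \<le> 1"
      using S0[of k] by simp_all
    then have "\<bar>exp (- (S k / 2)) - exp (- (t\<^sup>2 / 2))\<bar> \<le> 1" by linarith
    then show ?thesis using True by simp
  next
    case False
    have "\<bar>exp (- (S k / 2)) - exp (- (t\<^sup>2 / 2))\<bar> \<le> \<bar>S k / 2 - t\<^sup>2 / 2\<bar>"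
      using S0[of k] by (intro exp_minus_lipschitz) auto
    also have "S k / 2 - t\<^sup>2 / 2 = t\<^sup>2 / (2 * real n) * ((\<Sum>d\<in>I. (mode n k d)\<^sup>2) - real n)"
      using N by (simp add: S_eq field_simps)
    also have "\<bar>\<dots>\<bar> = t\<^sup>2 / (2 * real n) * \<bar>(\<Sum>d\<in>I. (mode n k d)\<^sup>2) - real n\<bar>" by (simp add: abs_mult)
    also have "\<dots> \<le> t\<^sup>2 / (2 * real n) * 1"
      unfolding I_def by (intro mult_left_mono mode_energy k False) simp
    finally show ?thesis using False by simp
  qed
  have meas: "(\<lambda>\<omega>. iexp (t * eigval n k (\<lambda>d. X d \<omega>) / sqrt (real n))) \<in> borel_measurable M" for k
    unfolding eigval_def by measurable
  have int: "integrable M (\<lambda>\<omega>. iexp (t * eigval n k (\<lambda>d. X d \<omega>) / sqrt (real n)))" for k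
    by (rule integrable_const_bound[where B = 1]) (use meas in auto)
  have "expectation (\<lambda>\<omega>. emp_char n t (\<lambda>d. X d \<omega>)) - of_real (exp (- (t\<^sup>2 / 2)))
     = (\<Sum>k<n. expectation (\<lambda>\<omega>. iexp (t * eigval n k (\<lambda>d. X d \<omega>) / sqrt (real n))) - of_real (exp (- (t\<^sup>2 / 2)))) / of_nat n"
  proof -
    have "expectation (\<lambda>\<omega>. emp_char n t (\<lambda>d. X d \<omega>))
      = (\<Sum>k<n. expectation (\<lambda>\<omega>. iexp (t * eigval n k (\<lambda>d. X d \<omega>) / sqrt (real n)))) / of_nat n"
      unfolding emp_char_def
      by (subst integral_divide_zero, subst Bochner_Integration.integral_sum) (use int in auto)
    then show ?thesis using n by (simp add: sum_subtractf diff_divide_distrib)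
  qed
  also have "cmod \<dots> \<le> (\<Sum>k<n. 2 * t\<^sup>2 * E + (if 2 * k + 1 = n then 1 else t\<^sup>2 / (2 * real n))) / real n"
    unfolding norm_divide norm_of_nat
  proof (rule divide_right_mono[OF sum_norm_le])
    fix k assume "k \<in> {..<n}"
    then have k: "k < n" by simp
    have "cmod (of_real (exp (- (S k / 2))) - of_real (exp (- (t\<^sup>2 / 2)))) \<le> (if 2 * k + 1 = n then 1 else t\<^sup>2 / (2 * real n))"
      unfolding of_real_diff[symmetric] norm_of_real by (rule gauss_k[OF k])
    from norm_triangle_le[OF add_mono[OF char_k[of k] this]]
    show "cmod (expectation (\<lambda>\<omega>. iexp (t * eigval n k (\<lambda>d. X d \<omega>) / sqrt (real n))) - of_real (exp (- (t\<^sup>2 / 2))))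
       \<le> 2 * t\<^sup>2 * E + (if 2 * k + 1 = n then 1 else t\<^sup>2 / (2 * real n))" by simp
  qed simp
  also have "\<dots> \<le> (real n * (2 * t\<^sup>2 * E) + (t\<^sup>2 / 2 + 1)) / real n"
  proof (rule divide_right_mono)
    have "(\<Sum>k<n. (if 2 * k + 1 = n then 1 else t\<^sup>2 / (2 * real n))) \<le> (\<Sum>k<n. t\<^sup>2 / (2 * real n) + (if k = n div 2 then 1 else 0))"
      by (rule sum_mono) auto
    also have "\<dots> \<le> t\<^sup>2 / 2 + 1"
      using N by (simp add: sum.distrib)
    finally show "(\<Sum>k<n. 2 * t\<^sup>2 * E + (if 2 * k + 1 = n then 1 else t\<^sup>2 / (2 * real n))) \<le> real n * (2 * t\<^sup>2 * E) + (t\<^sup>2 / 2 + 1)"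
      by (simp add: sum.distrib)
  qed simp
  also have "\<dots> = 2 * t\<^sup>2 * E + (t\<^sup>2 / 2 + 1) / real n" using N by (simp add: add_divide_distrib)
  finally show ?thesis unfolding E_def .
qed

section \<open>A one-sided strong law of large numbers\<close>

lemma (in prob_space) second_moment_sum_indep:
  fixes V :: "'i \<Rightarrow> 'a \<Rightarrow> real"
  assumes fin: "finite I" and indep: "indep_vars (\<lambda>_. borel) V I"
    and bd: "\<And>i \<omega>. i \<in> I \<Longrightarrow> \<bar>V i \<omega>\<bar> \<le> b i" and mean: "\<And>i. i \<in> I \<Longrightarrow> expectation (V i) = 0"
  shows "expectation (\<lambda>\<omega>. (\<Sum>i\<in>I. V i \<omega>)\<^sup>2) = (\<Sum>i\<in>I. expectation (\<lambda>\<omega>. (V i \<omega>)\<^sup>2))"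
  using assms
proof (induction I rule: finite_induct)
  case empty
  then show ?case by simp
next
  case (insert j I)
  have rv: "random_variable borel (V i)" if "i \<in> insert j I" for i
    using insert.prems(1) that by (auto simp: indep_vars_def)
  let ?S = "\<lambda>\<omega>. \<Sum>i\<in>I. V i \<omega>"
  have Sm: "random_variable borel ?S" using rv by (intro borel_measurable_sum) auto
  have Sb: "\<bar>?S \<omega>\<bar> \<le> (\<Sum>i\<in>I. b i)" for \<omega>
    using insert.prems(2) by (intro order_trans[OF sum_abs] sum_mono) auto
  have Vi: "integrable M (V j)" using rv insert.prems(2)[of j] by (intro integrable_bounded[where B = "b j"]) auto
  have Si: "integrable M ?S" by (rule integrable_bounded[OF Sm Sb])
  have V2i: "integrable M (\<lambda>\<omega>. (V j \<omega>)\<^sup>2)"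
    using rv power_mono[OF insert.prems(2)[of j], of _ 2]
    by (intro integrable_bounded[where B = "(b j)\<^sup>2"]) auto
  have S2i: "integrable M (\<lambda>\<omega>. (?S \<omega>)\<^sup>2)"
    using Sm power_mono[OF Sb, of _ 2] by (intro integrable_bounded[where B = "(\<Sum>i\<in>I. b i)\<^sup>2"]) auto
  have ind: "indep_var borel (V j) borel ?S"
    by (rule indep_vars_sum[OF insert.hyps(1,2) insert.prems(1)])
  have VSi: "integrable M (\<lambda>\<omega>. V j \<omega> * ?S \<omega>)" by (rule indep_var_integrable[OF ind Vi Si])
  have VS: "expectation (\<lambda>\<omega>. V j \<omega> * ?S \<omega>) = 0"
    using indep_var_lebesgue_integral[OF ind Vi Si] insert.prems(3)[of j] by simp
  have "expectation (\<lambda>\<omega>. (\<Sum>i\<in>insert j I. V i \<omega>)\<^sup>2)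
    = expectation (\<lambda>\<omega>. (V j \<omega>)\<^sup>2 + (?S \<omega>)\<^sup>2 + 2 * (V j \<omega> * ?S \<omega>))"
    using insert.hyps by (simp add: power2_sum mult.assoc)
  also have "\<dots> = expectation (\<lambda>\<omega>. (V j \<omega>)\<^sup>2) + expectation (\<lambda>\<omega>. (?S \<omega>)\<^sup>2)"
    using V2i S2i VSi VS by simp
  also have "expectation (\<lambda>\<omega>. (?S \<omega>)\<^sup>2) = (\<Sum>i\<in>I. expectation (\<lambda>\<omega>. (V i \<omega>)\<^sup>2))"
    using insert.prems by (intro insert.IH indep_vars_subset[OF insert.prems(1)]) auto
  finally show ?case using insert.hyps by simp
qed

text \<open>
  A geometric series starting at the first \<open>j\<close> with \<open>2 ^ j > i\<close>.
\<close>
lemma sum_inverse_four_powers: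
  "(\<Sum>j<N. if i < 2 ^ j then 1 / 4 ^ j else 0) \<le> 2 / (real (i + 1))\<^sup>2"
proof -
  have "\<exists>j. i < 2 ^ j" using less_exp by blast
  define m where "m = (LEAST j. i < 2 ^ j)"
  have m: "i < 2 ^ m" unfolding m_def by (rule LeastI_ex) fact
  have "(\<Sum>j<N. if i < 2 ^ j then 1 / 4 ^ j else 0) \<le> (\<Sum>j<N. if m \<le> j then (1 / 4) ^ j else (0 :: real))"
    by (intro sum_mono) (auto simp: m_def power_one_over intro: Least_le)
  also have "\<dots> = (\<Sum>j\<in>{m..<N}. (1 / 4) ^ j)"
    by (auto simp: sum.If_cases intro!: sum.cong)
  also have "\<dots> \<le> 4 / 3 * (1 / 4) ^ m"
  proof (cases "m \<le> N")
    case True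
    then have "(\<Sum>j\<in>{m..<N}. (1 / 4) ^ j) = 4 / 3 * ((1 / 4) ^ m - (1 / 4 :: real) ^ N)"
      by (induction N rule: dec_induct) simp_all
    then show ?thesis by simp
  qed simp
  also have "(1 / 4) ^ m \<le> 1 / (real (i + 1))\<^sup>2"
  proof -
    have "i + 1 \<le> 2 ^ m" using m by simp
    then have "real (i + 1) \<le> real (2 ^ m)" by (simp only: of_nat_le_iff)
    then have "real (i + 1) \<le> 2 ^ m" by (simp only: of_nat_power of_nat_numeral)
    then have "(real (i + 1))\<^sup>2 \<le> (2 ^ m)\<^sup>2" by (rule power_mono) simp
    also have "(2 ^ m)\<^sup>2 = (4 :: real) ^ m" by (simp flip: power_mult_distrib add: power2_eq_square)
    finally show ?thesis by (simp add: power_one_over frac_le)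
  qed
  finally have "(\<Sum>j<N. if i < 2 ^ j then 1 / 4 ^ j else 0) \<le> 4 / 3 * (1 / (real (i + 1))\<^sup>2)" by simp
  also have "\<dots> \<le> 2 * (1 / (real (i + 1))\<^sup>2)" by (rule mult_right_mono) auto
  finally show ?thesis by simp
qed

text \<open>
  Exchanging the two summations, \<open>a i\<close> is weighted by the sum of \<open>1 / 4 ^ j\<close> over the \<open>j\<close> with \<open>2 ^ j > i\<close>.
\<close>
lemma summable_dyadic_averages:
  fixes a :: "nat \<Rightarrow> real"
  assumes a: "\<And>i. 0 \<le> a i" and s: "summable (\<lambda>i. a i / (real (i + 1))\<^sup>2)"
  shows "summable (\<lambda>j. (\<Sum>i<2 ^ j. a i) / 4 ^ j)"
proof (rule summableI_nonneg_bounded)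
  show "0 \<le> (\<Sum>i<2 ^ j. a i) / 4 ^ j" for j using a by (simp add: sum_nonneg)
  fix N
  have "(\<Sum>j<N. (\<Sum>i<2 ^ j. a i) / 4 ^ j) = (\<Sum>j<N. \<Sum>i<2 ^ N. if i < 2 ^ j then a i / 4 ^ j else 0)"
  proof (rule sum.cong)
    fix j assume "j \<in> {..<N}"
    then have "(2::nat) ^ j \<le> 2 ^ N" by (intro power_increasing) auto
    then have "{..<2 ^ N} \<inter> {i. i < 2 ^ j} = {..<(2::nat) ^ j}" by (auto intro: less_le_trans)
    then show "(\<Sum>i<2 ^ j. a i) / 4 ^ j = (\<Sum>i<2 ^ N. if i < 2 ^ j then a i / 4 ^ j else 0)"
      by (simp add: sum.If_cases sum_divide_distrib)
  qed simp
  also have "\<dots> = (\<Sum>i<2 ^ N. \<Sum>j<N. if i < 2 ^ j then a i / 4 ^ j else 0)" by (rule sum.swap)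
  also have "\<dots> = (\<Sum>i<2 ^ N. a i * (\<Sum>j<N. if i < 2 ^ j then 1 / 4 ^ j else 0))"
    unfolding sum_distrib_left by (intro sum.cong) auto
  also have "\<dots> \<le> (\<Sum>i<2 ^ N. a i * (2 / (real (i + 1))\<^sup>2))"
    by (intro sum_mono mult_left_mono sum_inverse_four_powers a)
  also have "\<dots> = 2 * (\<Sum>i<2 ^ N. a i / (real (i + 1))\<^sup>2)"
    by (simp add: sum_distrib_left mult_ac)
  also have "\<dots> \<le> 2 * (\<Sum>i. a i / (real (i + 1))\<^sup>2)"
    using a by (intro mult_left_mono sum_le_suminf s) auto
  finally show "(\<Sum>j<N. (\<Sum>i<2 ^ j. a i) / 4 ^ j) \<le> 2 * (\<Sum>i. a i / (real (i + 1))\<^sup>2)" .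
qed

text \<open>
  The truncations \<open>U i = min (Z i) (i + 1)\<close> agree with \<open>Z i\<close> for all large \<open>i\<close>, because \<open>(U i / (i + 1))\<^sup>2\<close> has
  summable expectations, hence tends to \<open>0\<close> almost surely, and equals \<open>1\<close> whenever the truncation is effective. Along \<open>n = 2 ^ j\<close> the variances of the averages of
  the \<open>U i\<close> are summable, so the averages are eventually at most \<open>2 \<delta>\<close>; since the partial sums increase,
  passing to general \<open>n\<close> costs a factor \<open>2\<close>, and the finitely many truncated terms cost another \<open>\<delta>\<close>.
\<close>
theorem (in prob_space) averages_eventually_bounded:
  fixes Z :: "nat \<Rightarrow> 'a \<Rightarrow> real"
  assumes indep: "indep_vars (\<lambda>_. borel) Z UNIV" and nonneg: "\<And>i \<omega>. 0 \<le> Z i \<omega>"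
    and int: "\<And>i. integrable M (Z i)" and mean: "\<And>i. expectation (Z i) \<le> \<delta>" and \<delta>: "0 < \<delta>"
    and summ: "summable (\<lambda>i. expectation (\<lambda>\<omega>. (min (Z i \<omega>) (real (i + 1)))\<^sup>2) / (real (i + 1))\<^sup>2)"
  shows "AE \<omega> in M. \<forall>\<^sub>F n in sequentially. (\<Sum>i<n. Z i \<omega>) \<le> 5 * \<delta> * real n"
proof -
  have rv [measurable]: "random_variable borel (Z i)" for i using int by auto
  define U where "U i \<omega> = min (Z i \<omega>) (real (i + 1))" for i \<omega>
  have Um [measurable]: "random_variable borel (U i)" for i unfolding U_def by measurable
  have U0: "0 \<le> U i \<omega>" for i \<omega> using nonneg by (simp add: U_def)
  have Ub: "\<bar>U i \<omega>\<bar> \<le> real (i + 1)" for i \<omega> using nonneg[of i \<omega>] by (simp add: U_def abs_le_iff)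
  have UZ: "U i \<omega> \<le> Z i \<omega>" for i \<omega> by (simp add: U_def)
  have Ui: "integrable M (U i)" for i by (rule integrable_bounded[OF Um Ub])
  have U2b: "\<bar>(U i \<omega>)\<^sup>2\<bar> \<le> (real (i + 1))\<^sup>2" for i \<omega> using power_mono[OF Ub, of i \<omega> 2] by simp
  have U2i: "integrable M (\<lambda>\<omega>. (U i \<omega>)\<^sup>2)" for i by (rule integrable_bounded[OF _ U2b]) measurable
  have EU: "expectation (U i) \<le> \<delta>" for i
    by (rule order_trans[OF integral_mono mean]) (use Ui int UZ in auto)
  define a where "a i = expectation (\<lambda>\<omega>. (U i \<omega>)\<^sup>2)" for i
  have a0: "0 \<le> a i" for i unfolding a_def by (rule Bochner_Integration.integral_nonneg) simp
  have summ_a: "summable (\<lambda>i. a i / (real (i + 1))\<^sup>2)" using summ by (simp add: a_def U_def)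
  \<comment> \<open>Almost surely only finitely many truncations are effective.\<close>
  have eq: "AE \<omega> in M. \<forall>\<^sub>F i in sequentially. U i \<omega> = Z i \<omega>"
  proof -
    have "AE \<omega> in M. (\<lambda>i. (U i \<omega>)\<^sup>2 / (real (i + 1))\<^sup>2) \<longlonglongrightarrow> 0"
    proof (rule AE_tendsto_zero_of_summable_expectation)
      show "integrable M (\<lambda>\<omega>. (U i \<omega>)\<^sup>2 / (real (i + 1))\<^sup>2)" for i using U2i by simp
      show "summable (\<lambda>i. expectation (\<lambda>\<omega>. (U i \<omega>)\<^sup>2 / (real (i + 1))\<^sup>2))"
        using summ_a by (simp add: a_def)
    qed simp
    then show ?thesis
    proof (rule AE_mp, intro AE_I2 impI)
      fix \<omega> assume "(\<lambda>i. (U i \<omega>)\<^sup>2 / (real (i + 1))\<^sup>2) \<longlonglongrightarrow> 0"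
      then have "\<forall>\<^sub>F i in sequentially. (U i \<omega>)\<^sup>2 / (real (i + 1))\<^sup>2 < 1"
        by (rule order_tendstoD) simp
      then show "\<forall>\<^sub>F i in sequentially. U i \<omega> = Z i \<omega>"
      proof (rule eventually_mono)
        fix i assume "(U i \<omega>)\<^sup>2 / (real (i + 1))\<^sup>2 < 1"
        then have "U i \<omega> \<noteq> real (i + 1)" by auto
        then show "U i \<omega> = Z i \<omega>" by (auto simp: U_def min_def split: if_splits)
      qed
    qed
  qed
  define V where "V i \<omega> = U i \<omega> - expectation (U i)" for i \<omega>
  have EU0: "0 \<le> expectation (U i)" for i by (rule Bochner_Integration.integral_nonneg) (rule U0)
  have Vb: "\<bar>V i \<omega>\<bar> \<le> 2 * real (i + 1)" for i \<omega>
    unfolding V_def mult_2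
    by (rule order_trans[OF abs_triangle_ineq4 add_mono[OF Ub abs_expectation_le[OF Ub]]])
  have EV: "expectation (V i) = 0" for i unfolding V_def using Ui by (simp add: prob_space)
  have EV2: "expectation (\<lambda>\<omega>. (V i \<omega>)\<^sup>2) \<le> a i" for i
    unfolding V_def a_def using variance_eq[OF Ui U2i] by simp
  have indepV: "indep_vars (\<lambda>_. borel) V J" for J
    unfolding V_def U_def
    by (rule indep_vars_compose2[where X = Z and Y = "\<lambda>i z. min z (real (i + 1)) - c i" for c, OF indep_vars_subset[OF indep]]) auto
  have dyadic: "AE \<omega> in M. (\<lambda>j. ((\<Sum>i<2 ^ j. V i \<omega>))\<^sup>2 / 4 ^ j) \<longlonglongrightarrow> 0"
  proof (rule AE_tendsto_zero_of_summable_expectation)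
    have sb: "\<bar>\<Sum>i<2 ^ j. V i \<omega>\<bar> \<le> (\<Sum>i<2 ^ j. 2 * real (i + 1))" for j :: nat and \<omega>
      by (rule order_trans[OF sum_abs]) (rule sum_mono, rule Vb)
    show "integrable M (\<lambda>\<omega>. ((\<Sum>i<2 ^ j. V i \<omega>))\<^sup>2 / 4 ^ j)" for j :: nat
    proof (intro integrable_divide_zero integrable_bounded)
      show "(\<lambda>\<omega>. ((\<Sum>i<2 ^ j. V i \<omega>))\<^sup>2) \<in> borel_measurable M" unfolding V_def by measurable
      show "\<bar>(\<Sum>i<2 ^ j. V i \<omega>)\<^sup>2\<bar> \<le> (\<Sum>i<2 ^ j. 2 * real (i + 1))\<^sup>2" for \<omega>
        unfolding power_abs by (rule power_mono[OF sb]) simp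
    qed
    show "summable (\<lambda>j. expectation (\<lambda>\<omega>. ((\<Sum>i<2 ^ j. V i \<omega>))\<^sup>2 / 4 ^ j))"
    proof (rule summable_comparison_test[OF _ summable_dyadic_averages[OF a0 summ_a]], intro exI allI impI)
      fix j :: nat
      have "expectation (\<lambda>\<omega>. (\<Sum>i<2 ^ j. V i \<omega>)\<^sup>2) = (\<Sum>i<2 ^ j. expectation (\<lambda>\<omega>. (V i \<omega>)\<^sup>2))"
        by (rule second_moment_sum_indep[where b = "\<lambda>i. 2 * real (i + 1)", OF _ indepV Vb EV]) auto
      also have "\<dots> \<le> (\<Sum>i<2 ^ j. a i)" by (rule sum_mono) (rule EV2)
      finally have "expectation (\<lambda>\<omega>. (\<Sum>i<2 ^ j. V i \<omega>)\<^sup>2) / 4 ^ j \<le> (\<Sum>i<2 ^ j. a i) / 4 ^ j"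
        by (rule divide_right_mono) simp
      then show "norm (expectation (\<lambda>\<omega>. ((\<Sum>i<2 ^ j. V i \<omega>))\<^sup>2 / 4 ^ j)) \<le> (\<Sum>i<2 ^ j. a i) / 4 ^ j"
        by simp
    qed
  qed simp
  show ?thesis
    using eq dyadic
  proof (eventually_elim)
    case (elim \<omega>)
    from elim(1) obtain N where N: "\<And>i. N \<le> i \<Longrightarrow> U i \<omega> = Z i \<omega>" by (auto simp: eventually_sequentially)
    have "\<forall>\<^sub>F j in sequentially. ((\<Sum>i<2 ^ j. V i \<omega>))\<^sup>2 / 4 ^ j < \<delta>\<^sup>2"
      using elim(2) by (rule order_tendstoD) (use \<delta> in simp)
    then obtain J where J: "\<And>j. J \<le> j \<Longrightarrow> ((\<Sum>i<2 ^ j. V i \<omega>))\<^sup>2 / 4 ^ j < \<delta>\<^sup>2"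
      by (auto simp: eventually_sequentially)
    have SU: "(\<Sum>i<2 ^ j. U i \<omega>) \<le> 2 * \<delta> * 2 ^ j" if "J \<le> j" for j
    proof -
      have "(\<Sum>i<2 ^ j. V i \<omega>)\<^sup>2 \<le> \<delta>\<^sup>2 * 4 ^ j"
        using J[OF that] by (simp add: field_simps)
      also have "\<dots> = (\<delta> * 2 ^ j)\<^sup>2"
        by (simp add: power_mult_distrib flip: power_mult) (simp add: mult.commute[of j] power_mult)
      finally have "(\<Sum>i<2 ^ j. V i \<omega>) \<le> \<delta> * 2 ^ j"
        by (rule power2_le_imp_le) (use \<delta> in simp)
      moreover have "(\<Sum>i<2 ^ j. V i \<omega>) = (\<Sum>i<2 ^ j. U i \<omega>) - (\<Sum>i<2 ^ j. expectation (U i))"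
        unfolding V_def by (rule sum_subtractf)
      moreover have "(\<Sum>i<2 ^ j. expectation (U i)) \<le> \<delta> * 2 ^ j"
      proof -
        have "(\<Sum>i<2 ^ j. expectation (U i)) \<le> (\<Sum>i<(2::nat) ^ j. \<delta>)" by (rule sum_mono) (rule EU)
        then show ?thesis by (simp add: mult.commute)
      qed
      ultimately show ?thesis by linarith
    qed
    define R where "R = (\<Sum>i<N. Z i \<omega>)"
    have R: "\<forall>\<^sub>F n in sequentially. R \<le> \<delta> * real n"
    proof -
      obtain m :: nat where "R / \<delta> \<le> real m" using real_arch_simple by blast
      then have "R \<le> \<delta> * real m" using \<delta> by (simp add: field_simps)
      then have "R \<le> \<delta> * real n" if "m \<le> n" for n
        using that \<delta> by (meson mult_left_mono of_nat_mono order_trans less_imp_le)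
      then show ?thesis by (auto simp: eventually_sequentially)
    qed
    show "\<forall>\<^sub>F n in sequentially. (\<Sum>i<n. Z i \<omega>) \<le> 5 * \<delta> * real n"
      using R eventually_ge_at_top[of "2 ^ J"]
    proof eventually_elim
      case (elim n)
      have n: "0 < n" using elim(2) by (metis less_le_trans zero_less_power pos2)
      obtain j where j: "2 ^ j \<le> n" "n < 2 ^ (j + 1)" using ex_power_ivl1[of 2 n] n by auto
      have "J < j + 1"
        using elim(2) j(2) by (metis le_less_trans nat_power_less_imp_less pos2)
      then have Jj: "J \<le> j + 1" by simp
      have "(\<Sum>i<n. Z i \<omega>) \<le> (\<Sum>i<n. U i \<omega> + (if i < N then Z i \<omega> else 0))"
        using N U0 by (intro sum_mono) (auto simp: not_less)
      also have "\<dots> = (\<Sum>i<n. U i \<omega>) + (\<Sum>i<n. if i < N then Z i \<omega> else 0)" by (rule sum.distrib)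
      also have "(\<Sum>i<n. if i < N then Z i \<omega> else 0) \<le> R"
      proof -
        have "(\<Sum>i<n. if i < N then Z i \<omega> else 0) = (\<Sum>i\<in>{..<n} \<inter> {i. i < N}. Z i \<omega>)"
          by (simp add: sum.If_cases)
        also have "\<dots> \<le> R" unfolding R_def using nonneg by (intro sum_mono2) auto
        finally show ?thesis .
      qed
      also have "(\<Sum>i<n. U i \<omega>) \<le> (\<Sum>i<2 ^ (j + 1). U i \<omega>)"
        using j U0 by (intro sum_mono2) auto
      also have "\<dots> \<le> 2 * \<delta> * 2 ^ (j + 1)" by (rule SU[OF Jj])
      also have "\<dots> = 4 * \<delta> * real (2 ^ j)" by simp
      also have "\<dots> \<le> 4 * \<delta> * real n" using j(1) \<delta> by (intro mult_left_mono) (auto simp del: of_nat_power)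
      finally have "(\<Sum>i<n. Z i \<omega>) \<le> 4 * \<delta> * real n + R" by simp
      then show ?case using elim(1) by simp
    qed
  qed
qed

section \<open>The three assumptions on the input\<close>

text \<open>
  The hypothesis of \<open>averages_eventually_bounded\<close> for the squares of the input variables.
\<close>
definition (in prob_space) summable_truncated_fourth_moments :: "(nat \<Rightarrow> 'a \<Rightarrow> real) \<Rightarrow> bool" where
  "summable_truncated_fourth_moments X \<longleftrightarrow>
    summable (\<lambda>i. expectation (\<lambda>\<omega>. (min ((X i \<omega>)\<^sup>2) (real (i + 1)))\<^sup>2) / (real (i + 1))\<^sup>2)"

lemma (in prob_space) indep_standardizedD:
  assumes "indep_standardized X"
  shows "indep_vars (\<lambda>_. borel) X UNIV" "random_variable borel (X i)" "integrable M (X i)"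
    "integrable M (\<lambda>\<omega>. (X i \<omega>)\<^sup>2)" "expectation (X i) = 0" "expectation (\<lambda>\<omega>. (X i \<omega>)\<^sup>2) = 1"
proof -
  show i: "indep_vars (\<lambda>_. borel) X UNIV" "integrable M (X i)"
    "integrable M (\<lambda>\<omega>. (X i \<omega>)\<^sup>2)" and e: "expectation (X i) = 0"
    using assms unfolding indep_standardized_def by blast+
  have v: "variance (X i) = 1" using assms unfolding indep_standardized_def by blast
  show "expectation (\<lambda>\<omega>. (X i \<omega>)\<^sup>2) = 1" using v e by simp
  show "random_variable borel (X i)" using i(2) by auto
qed

lemma (in prob_space) assumption_A1_imp_A3:
  assumes "assumption_A1 X"
  shows "assumption_A3 X"
proof -
  from assms obtain C where std: "indep_standardized X" and C: "\<And>i. AE \<omega> in M. \<bar>X i \<omega>\<bar> \<le> C"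
    by (auto simp: assumption_A1_def)
  note [measurable] = indep_standardizedD(2)[OF std]
  have "integrable M (\<lambda>\<omega>. \<bar>X i \<omega>\<bar> ^ k) \<and> expectation (\<lambda>\<omega>. \<bar>X i \<omega>\<bar> ^ k) \<le> C ^ k" for i k
  proof -
    have ae: "AE \<omega> in M. \<bar>X i \<omega>\<bar> ^ k \<le> C ^ k"
      using C[of i] by eventually_elim (rule power_mono, auto)
    have int: "integrable M (\<lambda>\<omega>. \<bar>X i \<omega>\<bar> ^ k)"
      by (rule integrable_const_bound[where B = "C ^ k"]) (use ae in auto)
    moreover have "expectation (\<lambda>\<omega>. \<bar>X i \<omega>\<bar> ^ k) \<le> expectation (\<lambda>_. C ^ k)"
      by (rule integral_mono_AE[OF int _ ae]) simp
    ultimately show ?thesis by (simp add: prob_space)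
  qed
  then show ?thesis using std unfolding assumption_A3_def by blast
qed

text \<open>
  Third moments control the tails of the squares, and fourth moments give summability against \<open>1 / (i + 1)\<^sup>2\<close>.
\<close>
lemma (in prob_space) assumption_A3_integrability:
  assumes "assumption_A3 X"
  shows "uniformly_square_integrable X" "summable_truncated_fourth_moments X"
proof -
  have std: "indep_standardized X" using assms by (simp add: assumption_A3_def)
  note [measurable] = indep_standardizedD(2)[OF std]
  from assms obtain C where C: "\<And>i. integrable M (\<lambda>\<omega>. \<bar>X i \<omega>\<bar> ^ 3)" "\<And>i. expectation (\<lambda>\<omega>. \<bar>X i \<omega>\<bar> ^ 3) \<le> C"
    unfolding assumption_A3_def by meson
  from assms obtain D where D: "\<And>i. integrable M (\<lambda>\<omega>. \<bar>X i \<omega>\<bar> ^ 4)" "\<And>i. expectation (\<lambda>\<omega>. \<bar>X i \<omega>\<bar> ^ 4) \<le> D"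
    unfolding assumption_A3_def by meson
  have C0: "0 \<le> C" by (rule order_trans[OF Bochner_Integration.integral_nonneg C(2)]) simp
  show "uniformly_square_integrable X"
    unfolding uniformly_square_integrable_def
  proof (intro allI impI)
    fix \<epsilon> :: real assume \<epsilon>: "0 < \<epsilon>"
    \<comment> \<open>The tail is at most \<open>C / K\<close>; adding \<open>1\<close> keeps \<open>K\<close> positive when \<open>C = 0\<close>.\<close>
    define K where "K = C / \<epsilon> + 1"
    have K: "0 < K" using C0 \<epsilon> by (simp add: K_def add_nonneg_pos)
    have "expectation (\<lambda>\<omega>. tail_square K (X i \<omega>)) \<le> \<epsilon>" for i
    proof -
      have "expectation (\<lambda>\<omega>. tail_square K (X i \<omega>)) \<le> expectation (\<lambda>\<omega>. \<bar>X i \<omega>\<bar> ^ 3 / K)"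
      proof (rule integral_mono)
        show "integrable M (\<lambda>\<omega>. tail_square K (X i \<omega>))"
          by (rule Bochner_Integration.integrable_bound[OF indep_standardizedD(4)[OF std, of i]]) auto
        show "integrable M (\<lambda>\<omega>. \<bar>X i \<omega>\<bar> ^ 3 / K)" using C(1) by simp
        fix \<omega>
        have "K * (X i \<omega>)\<^sup>2 \<le> \<bar>X i \<omega>\<bar> * \<bar>X i \<omega>\<bar>\<^sup>2" if "K < \<bar>X i \<omega>\<bar>"
          using that by (simp add: mult_right_mono)
        then show "(tail_square K (X i \<omega>)) \<le> \<bar>X i \<omega>\<bar> ^ 3 / K"
          using K by (cases "K < \<bar>X i \<omega>\<bar>")
            (simp add: pos_le_divide_eq power3_eq_cube power2_eq_square mult_ac, simp)
      qed
      also have "\<dots> \<le> C / K" using C(2) K by (simp add: divide_right_mono)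
      also have "\<dots> \<le> \<epsilon>"
      proof -
        have "C \<le> \<epsilon> * K" using \<epsilon> by (simp add: K_def field_simps)
        then show ?thesis using K by (simp add: pos_divide_le_eq mult.commute)
      qed
      finally show ?thesis .
    qed
    then show "\<exists>K\<ge>0. \<forall>i. expectation (\<lambda>\<omega>. tail_square K (X i \<omega>)) \<le> \<epsilon>"
      using K less_imp_le by blast
  qed
  show "summable_truncated_fourth_moments X"
    unfolding summable_truncated_fourth_moments_def
  proof (rule summable_comparison_test[OF exI[of _ 0]], intro allI impI)
    fix i :: nat
    have *: "(min ((X i \<omega>)\<^sup>2) (real (i + 1)))\<^sup>2 \<le> \<bar>X i \<omega>\<bar> ^ 4" for \<omega>
    proof -
      have "(min ((X i \<omega>)\<^sup>2) (real (i + 1)))\<^sup>2 \<le> ((X i \<omega>)\<^sup>2)\<^sup>2" by (rule power_mono) auto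
      then show ?thesis by (simp flip: power_mult)
    qed
    have "expectation (\<lambda>\<omega>. (min ((X i \<omega>)\<^sup>2) (real (i + 1)))\<^sup>2) \<le> expectation (\<lambda>\<omega>. \<bar>X i \<omega>\<bar> ^ 4)"
    proof (rule integral_mono)
      show "integrable M (\<lambda>\<omega>. (min ((X i \<omega>)\<^sup>2) (real (i + 1)))\<^sup>2)"
        by (rule Bochner_Integration.integrable_bound[OF D(1)[of i]]) (use * in auto)
    qed (use D * in auto)
    also have "\<dots> \<le> D" by (rule D)
    finally have "expectation (\<lambda>\<omega>. (min ((X i \<omega>)\<^sup>2) (real (i + 1)))\<^sup>2) \<le> D" .
    then show "norm (expectation (\<lambda>\<omega>. (min ((X i \<omega>)\<^sup>2) (real (i + 1)))\<^sup>2) / (real (i + 1))\<^sup>2)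
      \<le> D * inverse ((real (i + 1))\<^sup>2)"
      by (simp add: divide_inverse mult_right_mono)
  next
    have "summable (\<lambda>i. inverse ((real (Suc i))\<^sup>2))"
      by (subst summable_Suc_iff) (rule inverse_power_summable, simp)
    then show "summable (\<lambda>i. D * inverse ((real (i + 1))\<^sup>2))"
      by (intro summable_mult) (simp add: add.commute)
  qed
qed

text \<open>
  The terms are \<open>1\<close> while \<open>i + 1 \<le> z\<close> and \<open>z\<^sup>2 / (i + 1)\<^sup>2\<close> afterwards; the bound proved by induction telescopes the
  second part through \<open>1 / (N + 1)\<^sup>2 \<le> 1 / N - 1 / (N + 1)\<close>.
\<close>
lemma sum_truncated_squares_le:
  fixes z :: real
  assumes z: "0 \<le> z"
  shows "(\<Sum>i<N. (min z (real (i + 1)))\<^sup>2 / (real (i + 1))\<^sup>2) \<le> 3 * z"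
proof -
  have "(\<Sum>i<N. (min z (real (i + 1)))\<^sup>2 / (real (i + 1))\<^sup>2)
    \<le> (if real N \<le> z then real N else 3 * z - z\<^sup>2 / real N)"
  proof (induction N)
    case 0
    then show ?case using z by simp
  next
    case (Suc N)
    let ?a = "(\<Sum>i<N. (min z (real (i + 1)))\<^sup>2 / (real (i + 1))\<^sup>2)"
    let ?m = "real (Suc N)"
    show ?case
    proof (cases "?m \<le> z")
      case True
      then have "real N \<le> z" by simp
      then show ?thesis using True Suc.IH by (simp add: min_absorb2)
    next
      case False
      then have z': "z < ?m" by simp
      have S: "(\<Sum>i<Suc N. (min z (real (i + 1)))\<^sup>2 / (real (i + 1))\<^sup>2) = ?a + z\<^sup>2 / ?m\<^sup>2"
        using z' by (simp add: min_absorb1)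
      show ?thesis
      proof (cases "real N \<le> z")
        case True
        have m: "0 < ?m" by simp
        have "z * z \<le> z * ?m" using z z' by (intro mult_left_mono) auto
        then have 1: "z\<^sup>2 / ?m \<le> z" using m by (simp add: pos_divide_le_eq power2_eq_square)
        have "z\<^sup>2 / ?m\<^sup>2 = z\<^sup>2 / ?m / ?m" by (simp add: power2_eq_square)
        also have "\<dots> \<le> z / ?m" using 1 m by (intro divide_right_mono) auto
        also have "\<dots> \<le> z" using z by (simp add: pos_divide_le_eq distrib_left)
        finally have 2: "z\<^sup>2 / ?m\<^sup>2 \<le> z" .
        show ?thesis using S Suc.IH True False 1 2 by simp
      next
        case N: False
        then have N0: "0 < real N" using z by (cases N) auto
        have "1 / ?m\<^sup>2 \<le> 1 / real N - 1 / ?m"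
        proof -
          have "1 / real N - 1 / ?m = 1 / (real N * ?m)" using N0 by (simp add: field_simps)
          moreover have "1 / ?m\<^sup>2 \<le> 1 / (real N * ?m)"
            using N0 by (intro divide_left_mono) (auto simp: power2_eq_square mult_right_mono)
          ultimately show ?thesis by simp
        qed
        then have "z\<^sup>2 * (1 / ?m\<^sup>2) \<le> z\<^sup>2 * (1 / real N - 1 / ?m)" by (rule mult_left_mono) simp
        then have "z\<^sup>2 / ?m\<^sup>2 \<le> z\<^sup>2 / real N - z\<^sup>2 / ?m" by (simp add: right_diff_distrib)
        then show ?thesis using S Suc.IH N False by simp
      qed
    qed
  qed
  also have "\<dots> \<le> 3 * z" using z by auto
  finally show ?thesis .
qed

text \<open>
  For identically distributed variables all expectations can be evaluated at \<open>X 0\<close>. Uniform integrability is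
  then dominated convergence, and summability follows by summing inside the expectation with
  \<open>sum_truncated_squares_le\<close>, so that second moments suffice.
\<close>
lemma (in prob_space) assumption_A2_integrability:
  assumes "assumption_A2 X"
  shows "uniformly_square_integrable X" "summable_truncated_fourth_moments X"
proof -
  have std: "indep_standardized X" and id: "\<And>i j. distr M borel (X i) = distr M borel (X j)"
    using assms by (auto simp: assumption_A2_def)
  note [measurable] = indep_standardizedD(2)[OF std]
  have same: "expectation (\<lambda>\<omega>. g (X i \<omega>)) = expectation (\<lambda>\<omega>. g (X 0 \<omega>))"
    if [measurable]: "g \<in> borel_measurable borel" for g :: "real \<Rightarrow> real" and i
  proof -
    have "expectation (\<lambda>\<omega>. g (X i \<omega>)) = (\<integral>x. g x \<partial>distr M borel (X i))" by (simp add: integral_distr)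
    also have "distr M borel (X i) = distr M borel (X 0)" by (rule id)
    also have "(\<integral>x. g x \<partial>\<dots>) = expectation (\<lambda>\<omega>. g (X 0 \<omega>))" by (simp add: integral_distr)
    finally show ?thesis .
  qed
  have i2: "integrable M (\<lambda>\<omega>. (X 0 \<omega>)\<^sup>2)" by (rule indep_standardizedD(4)[OF std])
  show "uniformly_square_integrable X"
    unfolding uniformly_square_integrable_def
  proof (intro allI impI)
    fix \<epsilon> :: real assume \<epsilon>: "0 < \<epsilon>"
    have "(\<lambda>K::nat. expectation (\<lambda>\<omega>. tail_square (real K) (X 0 \<omega>))) \<longlonglongrightarrow> expectation (\<lambda>\<omega>. 0)"
    proof (rule integral_dominated_convergence[OF _ _ i2])
      show "AE \<omega> in M. (\<lambda>K::nat. tail_square (real K) (X 0 \<omega>)) \<longlonglongrightarrow> 0"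
      proof (intro AE_I2 tendsto_eventually)
        fix \<omega>
        obtain m :: nat where "\<bar>X 0 \<omega>\<bar> \<le> real m" using real_arch_simple by blast
        then have "\<forall>K\<ge>m. \<not> real K < \<bar>X 0 \<omega>\<bar>" by auto
        then show "\<forall>\<^sub>F K :: nat in sequentially. (tail_square (real K) (X 0 \<omega>)) = 0"
          by (auto simp: eventually_sequentially)
      qed
    qed auto
    then have "\<forall>\<^sub>F K :: nat in sequentially. expectation (\<lambda>\<omega>. tail_square (real K) (X 0 \<omega>)) < \<epsilon>"
      using \<epsilon> by (intro order_tendstoD) auto
    then obtain K :: nat where K: "expectation (\<lambda>\<omega>. tail_square (real K) (X 0 \<omega>)) < \<epsilon>"
      by (auto simp: eventually_sequentially)
    have eq: "expectation (\<lambda>\<omega>. tail_square (real K) (X i \<omega>))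
      = expectation (\<lambda>\<omega>. tail_square (real K) (X 0 \<omega>))" for i
      by (rule same[of "\<lambda>x. if real K < \<bar>x\<bar> then x\<^sup>2 else 0"]) measurable
    show "\<exists>K\<ge>0. \<forall>i. expectation (\<lambda>\<omega>. tail_square K (X i \<omega>)) \<le> \<epsilon>"
    proof (intro exI[of _ "real K"] conjI allI)
      show "expectation (\<lambda>\<omega>. tail_square (real K) (X i \<omega>)) \<le> \<epsilon>" for i
        using K unfolding eq[of i] by (rule less_imp_le)
    qed simp
  qed
  show "summable_truncated_fourth_moments X"
    unfolding summable_truncated_fourth_moments_def
  proof (rule summableI_nonneg_bounded)
    show "0 \<le> expectation (\<lambda>\<omega>. (min ((X i \<omega>)\<^sup>2) (real (i + 1)))\<^sup>2) / (real (i + 1))\<^sup>2" for i by simp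
    fix N
    have int: "integrable M (\<lambda>\<omega>. (min ((X 0 \<omega>)\<^sup>2) (real (i + 1)))\<^sup>2 / (real (i + 1))\<^sup>2)" for i
    proof (intro integrable_divide_zero integrable_bounded)
      show "\<bar>(min ((X 0 \<omega>)\<^sup>2) (real (i + 1)))\<^sup>2\<bar> \<le> (real (i + 1))\<^sup>2" for \<omega>
        unfolding abs_power2 by (rule power_mono) auto
    qed measurable
    have "(\<Sum>i<N. expectation (\<lambda>\<omega>. (min ((X i \<omega>)\<^sup>2) (real (i + 1)))\<^sup>2) / (real (i + 1))\<^sup>2)
      = (\<Sum>i<N. expectation (\<lambda>\<omega>. (min ((X 0 \<omega>)\<^sup>2) (real (i + 1)))\<^sup>2 / (real (i + 1))\<^sup>2))"
    proof (rule sum.cong)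
      fix i
      have "expectation (\<lambda>\<omega>. (min ((X i \<omega>)\<^sup>2) (real (i + 1)))\<^sup>2)
        = expectation (\<lambda>\<omega>. (min ((X 0 \<omega>)\<^sup>2) (real (i + 1)))\<^sup>2)"
        by (rule same[of "\<lambda>x. (min (x\<^sup>2) (real (i + 1)))\<^sup>2"]) measurable
      then show "expectation (\<lambda>\<omega>. (min ((X i \<omega>)\<^sup>2) (real (i + 1)))\<^sup>2) / (real (i + 1))\<^sup>2
        = expectation (\<lambda>\<omega>. (min ((X 0 \<omega>)\<^sup>2) (real (i + 1)))\<^sup>2 / (real (i + 1))\<^sup>2)" by simp
    qed simp
    also have "\<dots> = expectation (\<lambda>\<omega>. \<Sum>i<N. (min ((X 0 \<omega>)\<^sup>2) (real (i + 1)))\<^sup>2 / (real (i + 1))\<^sup>2)"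
      by (rule Bochner_Integration.integral_sum[symmetric]) (rule int)
    also have "\<dots> \<le> expectation (\<lambda>\<omega>. 3 * (X 0 \<omega>)\<^sup>2)"
      using int i2 by (intro integral_mono sum_truncated_squares_le) auto
    finally show "(\<Sum>i<N. expectation (\<lambda>\<omega>. (min ((X i \<omega>)\<^sup>2) (real (i + 1)))\<^sup>2) / (real (i + 1))\<^sup>2)
      \<le> expectation (\<lambda>\<omega>. 3 * (X 0 \<omega>)\<^sup>2)" .
  qed
qed

section \<open>Almost sure convergence of the empirical characteristic function\<close>

lemma clip_error_le: "0 \<le> K \<Longrightarrow> (y - clip K y)\<^sup>2 \<le> (if K < \<bar>y\<bar> then y\<^sup>2 else 0)"
  by (auto simp: clip_def min_def max_def abs_le_square_iff[symmetric] abs_if split: if_splits)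

lemma clip_error_le_square: "0 \<le> K \<Longrightarrow> (y - clip K y)\<^sup>2 \<le> y\<^sup>2"
  by (rule order_trans[OF clip_error_le]) auto

lemma half_range_le:
  fixes z :: "nat \<Rightarrow> real"
  assumes "\<And>i. 0 \<le> z i"
  shows "(\<Sum>d\<in>freqs n. z d) \<le> (\<Sum>i<n. z i)"
  using assms by (intro sum_mono2) auto

lemma emp_char_dist_of_average:
  assumes n: "0 < n" and le: "(\<Sum>i<n. (x i - y i)\<^sup>2) \<le> B * real n"
  shows "cmod (emp_char n t x - emp_char n t y) \<le> \<bar>t\<bar> * sqrt (2 * B)"
proof -
  have "(\<Sum>d\<in>freqs n. (x d - y d)\<^sup>2) \<le> B * real n"
    by (rule order_trans[OF half_range_le le]) simp
  then have "2 / real n * (\<Sum>d\<in>freqs n. (x d - y d)\<^sup>2) \<le> 2 / real n * (B * real n)"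
    by (rule mult_left_mono) simp
  also have "\<dots> = 2 * B" using n by simp
  finally have "\<bar>t\<bar> * sqrt (2 / real n * (\<Sum>d\<in>freqs n. (x d - y d)\<^sup>2)) \<le> \<bar>t\<bar> * sqrt (2 * B)"
    by (intro mult_left_mono) auto
  then show ?thesis by (rule order_trans[OF emp_char_lipschitz])
qed

text \<open>
  The modulus of the difference is at most \<open>2\<close>, hence square integrable, and its second moment is bounded by the
  Lipschitz estimate together with the tail hypothesis.
\<close>
lemma (in prob_space) expectation_emp_char_clip_close:
  assumes std: "indep_standardized X" and n: "0 < n"
    and K: "0 \<le> K" and tail: "\<And>i. expectation (\<lambda>\<omega>. tail_square K (X i \<omega>)) \<le> \<delta>"
  shows "cmod (expectation (\<lambda>\<omega>. emp_char n t (\<lambda>d. clip K (X d \<omega>))) - expectation (\<lambda>\<omega>. emp_char n t (\<lambda>d. X d \<omega>)))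
    \<le> \<bar>t\<bar> * sqrt (2 * \<delta>)"
proof -
  note [measurable] = indep_standardizedD(2)[OF std]
  let ?Y = "\<lambda>\<omega>. emp_char n t (\<lambda>d. clip K (X d \<omega>))" and ?X = "\<lambda>\<omega>. emp_char n t (\<lambda>d. X d \<omega>)"
  have N: "0 < real n" using n by simp
  have Ym [measurable]: "?Y \<in> borel_measurable M" by (rule borel_measurable_emp_char) measurable
  have Xm [measurable]: "?X \<in> borel_measurable M" by (rule borel_measurable_emp_char) measurable
  have Yi: "integrable M ?Y" by (rule integrable_const_bound[where B = 1]) (auto simp: cmod_emp_char_le)
  have Xi: "integrable M ?X" by (rule integrable_const_bound[where B = 1]) (auto simp: cmod_emp_char_le)
  let ?D = "\<lambda>\<omega>. cmod (?Y \<omega> - ?X \<omega>)"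
  have Db: "\<bar>?D \<omega>\<bar> \<le> 2" for \<omega>
    using norm_triangle_ineq4[of "?Y \<omega>" "?X \<omega>"] cmod_emp_char_le[of n t "\<lambda>d. clip K (X d \<omega>)"] cmod_emp_char_le[of n t "\<lambda>d. X d \<omega>"]
    by simp
  have Zi: "integrable M (\<lambda>\<omega>. (clip K (X d \<omega>) - X d \<omega>)\<^sup>2)" for d
    by (rule Bochner_Integration.integrable_bound[OF indep_standardizedD(4)[OF std, of d]])
       (use clip_error_le_square[OF K] in \<open>auto simp: power2_commute[of "clip _ _"]\<close>)
  have ti: "integrable M (\<lambda>\<omega>. tail_square K (X i \<omega>))" for i
    by (rule Bochner_Integration.integrable_bound[OF indep_standardizedD(4)[OF std, of i]]) auto
  have EZ: "expectation (\<lambda>\<omega>. (clip K (X d \<omega>) - X d \<omega>)\<^sup>2) \<le> \<delta>" for d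
    by (rule order_trans[OF integral_mono[OF Zi ti] tail])
       (subst power2_commute, rule clip_error_le[OF K])
  have \<delta>: "0 \<le> \<delta>" by (rule order_trans[OF Bochner_Integration.integral_nonneg EZ]) simp
  have D2: "(?D \<omega>)\<^sup>2 \<le> t\<^sup>2 * (2 / real n) * (\<Sum>d\<in>freqs n. (clip K (X d \<omega>) - X d \<omega>)\<^sup>2)" for \<omega>
  proof -
    have "(?D \<omega>)\<^sup>2 \<le> (\<bar>t\<bar> * sqrt (2 / real n * (\<Sum>d\<in>freqs n. (clip K (X d \<omega>) - X d \<omega>)\<^sup>2)))\<^sup>2"
      by (rule power_mono[OF emp_char_lipschitz]) simp
    also have "\<dots> = t\<^sup>2 * (2 / real n) * (\<Sum>d\<in>freqs n. (clip K (X d \<omega>) - X d \<omega>)\<^sup>2)"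
      by (simp add: power_mult_distrib sum_nonneg)
    finally show ?thesis .
  qed
  have "(expectation ?D)\<^sup>2 \<le> expectation (\<lambda>\<omega>. (?D \<omega>)\<^sup>2)"
    by (rule expectation_square_le[OF _ Db]) measurable
  also have "\<dots> \<le> expectation (\<lambda>\<omega>. t\<^sup>2 * (2 / real n) * (\<Sum>d\<in>freqs n. (clip K (X d \<omega>) - X d \<omega>)\<^sup>2))"
  proof (rule integral_mono[OF _ _ D2])
    show "integrable M (\<lambda>\<omega>. (?D \<omega>)\<^sup>2)"
      using power_mono[OF Db, of _ 2] by (intro integrable_bounded[where B = "2\<^sup>2"]) auto
    show "integrable M (\<lambda>\<omega>. t\<^sup>2 * (2 / real n) * (\<Sum>d\<in>freqs n. (clip K (X d \<omega>) - X d \<omega>)\<^sup>2))"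
      using Zi by auto
  qed
  also have "\<dots> = t\<^sup>2 * (2 / real n) * (\<Sum>d\<in>freqs n. expectation (\<lambda>\<omega>. (clip K (X d \<omega>) - X d \<omega>)\<^sup>2))"
    using Zi by simp
  also have "\<dots> \<le> t\<^sup>2 * (2 / real n) * (\<Sum>i<n. \<delta>)"
    by (intro mult_left_mono order_trans[OF half_range_le] sum_mono EZ) auto
  also have "\<dots> = (\<bar>t\<bar> * sqrt (2 * \<delta>))\<^sup>2" using N \<delta> by (simp add: power_mult_distrib)
  finally have "expectation ?D \<le> \<bar>t\<bar> * sqrt (2 * \<delta>)"
    by (rule power2_le_imp_le) (use \<delta> in simp)
  moreover have "cmod (expectation ?Y - expectation ?X) \<le> expectation ?D"
    using integral_norm_bound[of M "\<lambda>\<omega>. ?Y \<omega> - ?X \<omega>"] Yi Xi by simp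
  ultimately show ?thesis by linarith
qed

text \<open>
  Domination of \<open>h (X i)\<close> by the square of \<open>X i\<close> carries over the summability condition, because truncation at \<open>i + 1\<close>
  is monotone.
\<close>
lemma (in prob_space) truncation_error_averages:
  assumes std: "indep_standardized X" and st: "summable_truncated_fourth_moments X"
    and h: "h \<in> borel_measurable borel" "\<And>y. 0 \<le> h y" "\<And>y. h y \<le> y\<^sup>2"
    and mean: "\<And>i. expectation (\<lambda>\<omega>. h (X i \<omega>)) \<le> \<delta>" and \<delta>: "0 < \<delta>"
  shows "AE \<omega> in M. \<forall>\<^sub>F n in sequentially. (\<Sum>i<n. h (X i \<omega>)) \<le> 5 * \<delta> * real n"
proof (rule averages_eventually_bounded[OF _ h(2) _ mean \<delta>])
  note [measurable] = indep_standardizedD(2)[OF std] h(1)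
  show "indep_vars (\<lambda>_. borel) (\<lambda>i \<omega>. h (X i \<omega>)) UNIV"
    by (rule indep_vars_compose2[where Y = "\<lambda>_. h", OF indep_standardizedD(1)[OF std]]) (rule h(1))
  show "integrable M (\<lambda>\<omega>. h (X i \<omega>))" for i
    by (rule Bochner_Integration.integrable_bound[OF indep_standardizedD(4)[OF std, of i]]) (use h in auto)
  show "summable (\<lambda>i. expectation (\<lambda>\<omega>. (min (h (X i \<omega>)) (real (i + 1)))\<^sup>2) / (real (i + 1))\<^sup>2)"
  proof (rule summable_comparison_test[OF exI[of _ 0]
        st[unfolded summable_truncated_fourth_moments_def]], intro allI impI)
    fix i :: nat
    have "expectation (\<lambda>\<omega>. (min (h (X i \<omega>)) (real (i + 1)))\<^sup>2) \<le> expectation (\<lambda>\<omega>. (min ((X i \<omega>)\<^sup>2) (real (i + 1)))\<^sup>2)"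
    proof (rule integral_mono)
      have 1: "\<bar>min (h (X i \<omega>)) (real (i + 1))\<bar> \<le> real (i + 1)" "\<bar>min ((X i \<omega>)\<^sup>2) (real (i + 1))\<bar> \<le> real (i + 1)" for \<omega>
        using h(2)[of "X i \<omega>"] by (auto simp: abs_le_iff)
      show "integrable M (\<lambda>\<omega>. (min (h (X i \<omega>)) (real (i + 1)))\<^sup>2)"
        by (rule integrable_bounded[where B = "(real (i + 1))\<^sup>2"]) (use power_mono[OF 1(1), of _ 2] in auto)
      show "integrable M (\<lambda>\<omega>. (min ((X i \<omega>)\<^sup>2) (real (i + 1)))\<^sup>2)"
        by (rule integrable_bounded[where B = "(real (i + 1))\<^sup>2"]) (use power_mono[OF 1(2), of _ 2] in auto)
      show "(min (h (X i \<omega>)) (real (i + 1)))\<^sup>2 \<le> (min ((X i \<omega>)\<^sup>2) (real (i + 1)))\<^sup>2" for \<omega>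
        by (rule power_mono) (use h(2,3)[of "X i \<omega>"] in auto)
    qed
    then show "norm (expectation (\<lambda>\<omega>. (min (h (X i \<omega>)) (real (i + 1)))\<^sup>2) / (real (i + 1))\<^sup>2)
      \<le> expectation (\<lambda>\<omega>. (min ((X i \<omega>)\<^sup>2) (real (i + 1)))\<^sup>2) / (real (i + 1))\<^sup>2"
      by (simp add: divide_right_mono)
  qed
qed

text \<open>
  For rational \<open>t\<close> compare in turn with the clipped input, with its expectation, with the expectation for the original input,
  and with the Gaussian value; after \<open>n \<rightarrow> \<infinity>\<close> the total error is a quantity \<open>B m\<close> that vanishes with the tail bound
  \<open>\<delta> m\<close>. Only countably many null sets are discarded. Real \<open>t\<close> are reached through the equicontinuity
  \<open>emp_char_frequency_lipschitz\<close>, whose constant stays bounded because the averages of the squares do.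
\<close>
theorem (in prob_space) emp_char_tendsto_gaussian:
  assumes std: "indep_standardized X" and ui: "uniformly_square_integrable X"
    and st: "summable_truncated_fourth_moments X"
  shows "AE \<omega> in M. \<forall>t. (\<lambda>n. emp_char n t (\<lambda>d. X d \<omega>)) \<longlonglongrightarrow> of_real (exp (- (t\<^sup>2 / 2)))"
proof -
  note [measurable] = indep_standardizedD(2)[OF std]
  define \<delta> where "\<delta> m = inverse (real (Suc m))" for m
  have \<delta>: "0 < \<delta> m" for m by (simp add: \<delta>_def)
  have "\<exists>K\<ge>0. \<forall>i. expectation (\<lambda>\<omega>. tail_square K (X i \<omega>)) \<le> \<delta> m" for m
    using ui \<delta>[of m] unfolding uniformly_square_integrable_def by blast
  then obtain K where K: "\<And>m. 0 \<le> K m"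
    and tail: "\<And>m i. expectation (\<lambda>\<omega>. tail_square (K m) (X i \<omega>)) \<le> \<delta> m" by metis
  have sq: "AE \<omega> in M. \<forall>\<^sub>F n in sequentially. (\<Sum>i<n. (X i \<omega>)\<^sup>2) \<le> 5 * 1 * real n"
    using indep_standardizedD(6)[OF std]
    by (intro truncation_error_averages[OF std st, where h = "\<lambda>y. y\<^sup>2"]) auto
  have trunc: "AE \<omega> in M. \<forall>\<^sub>F n in sequentially. (\<Sum>i<n. (X i \<omega> - clip (K m) (X i \<omega>))\<^sup>2) \<le> 5 * \<delta> m * real n" for m
  proof (rule truncation_error_averages[OF std st, where h = "\<lambda>y. (y - clip (K m) y)\<^sup>2"])
    have le: "(y - clip (K m) y)\<^sup>2 \<le> (if K m < \<bar>y\<bar> then y\<^sup>2 else 0)" for y by (rule clip_error_le[OF K])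
    show le2: "(y - clip (K m) y)\<^sup>2 \<le> y\<^sup>2" for y by (rule clip_error_le_square[OF K])
    have ti: "integrable M (\<lambda>\<omega>. tail_square (K m) (X i \<omega>))" for i
      by (rule Bochner_Integration.integrable_bound[OF indep_standardizedD(4)[OF std, of i]]) auto
    have Zi: "integrable M (\<lambda>\<omega>. (X i \<omega> - clip (K m) (X i \<omega>))\<^sup>2)" for i
      by (rule Bochner_Integration.integrable_bound[OF indep_standardizedD(4)[OF std, of i]]) (use le2 in auto)
    show "expectation (\<lambda>\<omega>. (X i \<omega> - clip (K m) (X i \<omega>))\<^sup>2) \<le> \<delta> m" for i
      by (rule order_trans[OF integral_mono[OF Zi ti le] tail])
  qed (use \<delta> in auto)
  have conc: "AE \<omega> in M. \<forall>t\<in>\<rat>. (\<lambda>n. emp_char n t (\<lambda>d. clip (K m) (X d \<omega>))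
      - expectation (\<lambda>\<omega>. emp_char n t (\<lambda>d. clip (K m) (X d \<omega>)))) \<longlonglongrightarrow> 0" for m
    unfolding AE_ball_countable[OF countable_rat]
    using emp_char_concentration[OF indep_standardizedD(1)[OF std] K] by blast
  have "AE \<omega> in M. (\<forall>m. \<forall>\<^sub>F n in sequentially. (\<Sum>i<n. (X i \<omega> - clip (K m) (X i \<omega>))\<^sup>2) \<le> 5 * \<delta> m * real n)
     \<and> (\<forall>m. \<forall>t\<in>\<rat>. (\<lambda>n. emp_char n t (\<lambda>d. clip (K m) (X d \<omega>))
      - expectation (\<lambda>\<omega>. emp_char n t (\<lambda>d. clip (K m) (X d \<omega>)))) \<longlonglongrightarrow> 0)"
    using trunc conc by (simp add: AE_all_countable)
  then show ?thesis
    using sq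
  proof eventually_elim
    case (elim \<omega>)
    have rational: "(\<lambda>n. emp_char n t (\<lambda>d. X d \<omega>)) \<longlonglongrightarrow> of_real (exp (- (t\<^sup>2 / 2)))" if t: "t \<in> \<rat>" for t
    proof (rule tendstoI)
      fix e :: real assume e: "0 < e"
      define B where "B m = \<bar>t\<bar> * sqrt (2 * (5 * \<delta> m)) + \<bar>t\<bar> * sqrt (2 * \<delta> m) + 2 * t\<^sup>2 * \<delta> m + 2 * \<delta> m" for m
      have "\<delta> \<longlonglongrightarrow> 0" unfolding \<delta>_def by (rule LIMSEQ_inverse_real_of_nat)
      then have "B \<longlonglongrightarrow> \<bar>t\<bar> * sqrt (2 * (5 * 0)) + \<bar>t\<bar> * sqrt (2 * 0) + 2 * t\<^sup>2 * 0 + 2 * 0"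
        unfolding B_def by (intro tendsto_intros)
      then have "\<forall>\<^sub>F m in sequentially. B m < e" using e by (intro order_tendstoD) auto
      then obtain m where m: "B m < e" by (auto simp: eventually_sequentially)
      let ?x = "\<lambda>d. X d \<omega>" and ?y = "\<lambda>d. clip (K m) (X d \<omega>)"
      let ?Ey = "\<lambda>n. expectation (\<lambda>\<omega>. emp_char n t (\<lambda>d. clip (K m) (X d \<omega>)))"
        and ?Ex = "\<lambda>n. expectation (\<lambda>\<omega>. emp_char n t (\<lambda>d. X d \<omega>))"
      let ?g = "complex_of_real (exp (- (t\<^sup>2 / 2)))"
      have 1: "\<forall>\<^sub>F n in sequentially. cmod (emp_char n t ?x - emp_char n t ?y) \<le> \<bar>t\<bar> * sqrt (2 * (5 * \<delta> m))"
        using elim(1)[THEN conjunct1, rule_format, of m] eventually_gt_at_top[of 0]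
        by eventually_elim (rule emp_char_dist_of_average)
      have 2: "\<forall>\<^sub>F n in sequentially. cmod (emp_char n t ?y - ?Ey n) < \<delta> m"
        using tendstoD[OF elim(1)[THEN conjunct2, rule_format, OF t, of m] \<delta>[of m]] by simp
      have 3: "\<forall>\<^sub>F n in sequentially. cmod (?Ey n - ?Ex n) \<le> \<bar>t\<bar> * sqrt (2 * \<delta> m)"
        using eventually_gt_at_top[of 0]
        by eventually_elim (rule expectation_emp_char_clip_close[OF std _ K tail])
      have 4: "\<forall>\<^sub>F n in sequentially. cmod (?Ex n - ?g) < 2 * t\<^sup>2 * \<delta> m + \<delta> m"
      proof -
        define \<eta> where "\<eta> n = 2 * \<bar>t\<bar> / sqrt (real n)" for n
        have "\<eta> \<longlonglongrightarrow> 0"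
          unfolding \<eta>_def
          by (intro real_tendsto_divide_at_top[OF tendsto_const] filterlim_compose[OF sqrt_at_top] filterlim_real_sequentially)
        moreover have "(\<lambda>n. (t\<^sup>2 / 2 + 1) / real n) \<longlonglongrightarrow> 0"
          by (intro real_tendsto_divide_at_top[OF tendsto_const] filterlim_real_sequentially)
        ultimately have "(\<lambda>n. 2 * t\<^sup>2 * (\<delta> m + \<eta> n * K m / 6 + (\<eta> n)\<^sup>2 / 4) + (t\<^sup>2 / 2 + 1) / real n)
          \<longlonglongrightarrow> 2 * t\<^sup>2 * (\<delta> m + 0 * K m / 6 + 0\<^sup>2 / 4) + 0"
          by (intro tendsto_intros) auto
        then have "\<forall>\<^sub>F n in sequentially. 2 * t\<^sup>2 * (\<delta> m + \<eta> n * K m / 6 + (\<eta> n)\<^sup>2 / 4) + (t\<^sup>2 / 2 + 1) / real n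
          < 2 * t\<^sup>2 * \<delta> m + \<delta> m"
          by (rule order_tendstoD) (use \<delta>[of m] in simp)
        then show ?thesis
          using eventually_gt_at_top[of 0]
        proof eventually_elim
          case (elim n)
          show ?case
            by (rule le_less_trans[OF expectation_emp_char_close[OF std elim(2) K tail] elim(1)[unfolded \<eta>_def]])
        qed
      qed
      show "\<forall>\<^sub>F n in sequentially. dist (emp_char n t ?x) ?g < e"
        using 1 2 3 4
      proof eventually_elim
        case (elim n)
        have "dist (emp_char n t ?x) ?g \<le> cmod (emp_char n t ?x - emp_char n t ?y) + cmod (emp_char n t ?y - ?Ey n)
          + cmod (?Ey n - ?Ex n) + cmod (?Ex n - ?g)"
        proof -
          have "emp_char n t ?x - ?g = (emp_char n t ?x - emp_char n t ?y) + (emp_char n t ?y - ?Ey n)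
            + (?Ey n - ?Ex n) + (?Ex n - ?g)" by simp
          then show ?thesis
            unfolding dist_norm by (metis (no_types, lifting) norm_triangle_le norm_triangle_ineq add_mono order_refl)
        qed
        also have "\<dots> < e" using elim m unfolding B_def by linarith
        finally show ?case .
      qed
    qed
    show ?case
    proof (intro allI tendstoI)
      fix t e :: real assume e: "0 < e"
      have "isCont (\<lambda>s. exp (- (s\<^sup>2 / 2)) :: real) t" by (intro continuous_intros) auto
      then obtain d where d: "0 < d" "\<And>s. dist s t < d \<Longrightarrow> dist (exp (- (s\<^sup>2 / 2))) (exp (- (t\<^sup>2 / 2)) :: real) < e / 3"
        using e unfolding continuous_at_eps_delta by (metis divide_pos_pos zero_less_numeral dist_commute)
      \<comment> \<open>The averages of the squares are eventually at most \<open>5\<close>, so \<open>sqrt (2 * 5)\<close> is a Lipschitz constant in \<open>t\<close>.\<close>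
      define r where "r = min d (e / 3 / sqrt 10)"
      have r: "0 < r" using d e by (simp add: r_def)
      obtain s where s: "s \<in> \<rat>" "t < s" "s < t + r" using Rats_dense_in_real[of t "t + r"] r by auto
      let ?x = "\<lambda>d. X d \<omega>"
      have st1: "\<bar>t - s\<bar> * sqrt 10 \<le> e / 3"
      proof -
        have "\<bar>t - s\<bar> \<le> e / 3 / sqrt 10" using s by (auto simp: r_def)
        then show ?thesis by (simp add: pos_le_divide_eq)
      qed
      have st2: "\<bar>exp (- (s\<^sup>2 / 2)) - exp (- (t\<^sup>2 / 2))\<bar> < e / 3"
        using d(2)[of s] s by (auto simp: dist_real_def r_def)
      have "\<forall>\<^sub>F n in sequentially. dist (emp_char n s ?x) (of_real (exp (- (s\<^sup>2 / 2)))) < e / 3"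
        by (rule tendstoD[OF rational[OF s(1)]]) (use e in simp)
      then show "\<forall>\<^sub>F n in sequentially. dist (emp_char n t ?x) (of_real (exp (- (t\<^sup>2 / 2)))) < e"
        using elim(2) eventually_gt_at_top[of 0]
      proof eventually_elim
        case (elim n)
        have "2 / real n * (\<Sum>d\<in>freqs n. (X d \<omega>)\<^sup>2) \<le> 2 / real n * (5 * 1 * real n)"
          by (intro mult_left_mono order_trans[OF half_range_le elim(2)]) auto
        also have "\<dots> = 10" using elim(3) by simp
        finally have "\<bar>t - s\<bar> * sqrt (2 / real n * (\<Sum>d\<in>freqs n. (X d \<omega>)\<^sup>2)) \<le> \<bar>t - s\<bar> * sqrt 10"
          by (intro mult_left_mono) auto
        then have "dist (emp_char n t ?x) (emp_char n s ?x) \<le> e / 3"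
          unfolding dist_norm using emp_char_frequency_lipschitz[OF elim(3), of t ?x s] st1 by linarith
        moreover have "dist (complex_of_real (exp (- (s\<^sup>2 / 2)))) (of_real (exp (- (t\<^sup>2 / 2)))) < e / 3"
          unfolding dist_norm of_real_diff[symmetric] norm_of_real by (rule st2)
        ultimately show ?case
          using elim(1) dist_triangle[of "emp_char n t ?x" "complex_of_real (exp (- (t\<^sup>2 / 2)))" "emp_char n s ?x"]
            dist_triangle[of "emp_char n s ?x" "complex_of_real (exp (- (t\<^sup>2 / 2)))" "complex_of_real (exp (- (s\<^sup>2 / 2)))"]
          by linarith
      qed
    qed
  qed
qed

section \<open>From characteristic functions to counting functions\<close>

lemma isCont_cdf_std_normal: "isCont (cdf std_normal_distribution) y"
proof -
  interpret real_distribution std_normal_distribution by (rule real_dist_normal_dist)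
  have "{y} \<in> null_sets lborel" by (auto simp: null_sets_def)
  then have "{y} \<in> null_sets (density lborel std_normal_density)"
    using absolutely_continuousI_density[of "\<lambda>x. ennreal (std_normal_density x)" lborel]
    by (auto simp: absolutely_continuous_def)
  then have "measure std_normal_distribution {y} = 0"
    by (simp add: null_sets_def measure_def)
  then show ?thesis by (simp add: isCont_cdf)
qed

text \<open>
  Levy's continuity theorem for the uniform distribution on the \<open>n\<close> values. It is applied at \<open>Suc n\<close>, since for
  \<open>n = 0\<close> there is no such distribution.
\<close>
theorem eigval_count_tendsto_gaussian:
  assumes conv: "\<And>t. (\<lambda>n. emp_char n t x) \<longlonglongrightarrow> of_real (exp (- (t\<^sup>2 / 2)))"
  shows "(\<lambda>n. real (card {k. k < n \<and> eigval n k x / sqrt (real n) \<le> y}) / real n)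
    \<longlonglongrightarrow> cdf std_normal_distribution y"
proof -
  define U where "U n = uniform_count_measure {..<Suc n}" for n
  define f where "f n k = eigval (Suc n) k x / sqrt (real (Suc n))" for n k
  define \<mu> where "\<mu> n = distr (U n) borel (f n)" for n
  have U: "prob_space (U n)" for n
    unfolding U_def by (rule prob_space_uniform_count_measure) auto
  have fm: "f n \<in> borel_measurable (U n)" for n
    unfolding U_def by (simp add: uniform_count_measure_def point_measure_def)
  have \<mu>: "real_distribution (\<mu> n)" for n
  proof -
    interpret prob_space "U n" by (rule U)
    show ?thesis unfolding \<mu>_def by (rule real_distribution_distr) (rule fm)
  qed
  have char_\<mu>: "char (\<mu> n) t = emp_char (Suc n) t x" for n t
  proof -
    have "char (\<mu> n) t = (\<integral>k. iexp (t * f n k) \<partial>U n)"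
      unfolding char_def \<mu>_def by (subst integral_distr) (use fm in auto)
    also have "\<dots> = emp_char (Suc n) t x"
      unfolding U_def emp_char_def f_def uniform_count_measure_def
      by (subst lebesgue_integral_point_measure_finite)
         (simp_all add: scaleR_conv_of_real sum_divide_distrib del: sum.lessThan_Suc)
    finally show ?thesis .
  qed
  have cdf_\<mu>: "cdf (\<mu> n) y = real (card {k. k < Suc n \<and> eigval (Suc n) k x / sqrt (real (Suc n)) \<le> y}) / real (Suc n)" for n
  proof -
    have "cdf (\<mu> n) y = measure (U n) (f n -` {..y} \<inter> space (U n))"
      unfolding cdf_def \<mu>_def by (rule measure_distr) (use fm in auto)
    also have "f n -` {..y} \<inter> space (U n) = {k. k < Suc n \<and> eigval (Suc n) k x / sqrt (real (Suc n)) \<le> y}"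
      by (auto simp: U_def f_def space_uniform_count_measure)
    also have "measure (U n) \<dots> = real (card {k. k < Suc n \<and> eigval (Suc n) k x / sqrt (real (Suc n)) \<le> y}) / real (Suc n)"
      unfolding U_def by (subst measure_uniform_count_measure) auto
    finally show ?thesis .
  qed
  have "weak_conv_m \<mu> std_normal_distribution"
  proof (rule levy_continuity[OF \<mu> real_dist_normal_dist])
    fix t
    have "(\<lambda>n. emp_char (Suc n) t x) \<longlonglongrightarrow> of_real (exp (- (t\<^sup>2 / 2)))"
      using conv by (rule LIMSEQ_Suc)
    then show "(\<lambda>n. char (\<mu> n) t) \<longlonglongrightarrow> char std_normal_distribution t"
      by (simp add: char_\<mu> char_std_normal_distribution)
  qed
  then have "(\<lambda>n. cdf (\<mu> n) y) \<longlonglongrightarrow> cdf std_normal_distribution y"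
    using isCont_cdf_std_normal by (simp add: weak_conv_m_def weak_conv_def)
  then show ?thesis unfolding cdf_\<mu> by (rule LIMSEQ_imp_Suc)
qed

text \<open>
  The palindromic matrix of size \<open>n + 1\<close> is normalised by \<open>sqrt (n + 1)\<close> while its principal submatrix has size \<open>n\<close>.
  Replacing the normalisation moves the threshold by a factor tending to \<open>1\<close>, which is harmless because counting functions are
  monotone and the limit is continuous.
\<close>
lemma eigval_count_tendsto_gaussian_shifted:
  assumes conv: "\<And>y. (\<lambda>n. real (card {k. k < n \<and> eigval n k x / sqrt (real n) \<le> y}) / real n)
    \<longlonglongrightarrow> cdf std_normal_distribution y"
  shows "(\<lambda>n. real (card {k. k < n \<and> eigval n k x / sqrt (real (Suc n)) \<le> y}) / real n)
    \<longlonglongrightarrow> cdf std_normal_distribution y"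
proof -
  define F where "F n y = real (card {k. k < n \<and> eigval n k x / sqrt (real n) \<le> y}) / real n" for n y
  define y' where "y' n = y * sqrt (real (Suc n) / real n)" for n
  have mono: "F n a \<le> F n b" if "a \<le> b" for n a b
    unfolding F_def using that by (intro divide_right_mono of_nat_mono card_mono) auto
  have eq: "\<forall>\<^sub>F n in sequentially. F n (y' n) = real (card {k. k < n \<and> eigval n k x / sqrt (real (Suc n)) \<le> y}) / real n"
    using eventually_gt_at_top[of 0]
  proof eventually_elim
    case (elim n)
    have "eigval n k x / sqrt (real n) \<le> y' n \<longleftrightarrow> eigval n k x / sqrt (real (Suc n)) \<le> y" for k
      using elim by (simp add: y'_def real_sqrt_divide field_simps)
    then show ?case by (simp add: F_def)
  qed
  have "(\<lambda>n. real (Suc n) / real n) \<longlonglongrightarrow> 1"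
    by (rule LIMSEQ_Suc_n_over_n)
  then have y': "y' \<longlonglongrightarrow> y * sqrt 1"
    unfolding y'_def by (intro tendsto_intros)
  have "(\<lambda>n. F n (y' n)) \<longlonglongrightarrow> cdf std_normal_distribution y"
  proof (rule tendstoI)
    fix e :: real assume e: "0 < e"
    let ?\<Phi> = "cdf std_normal_distribution"
    from isCont_cdf_std_normal[of y] e obtain d where d: "0 < d" "\<And>z. dist z y < d \<Longrightarrow> dist (?\<Phi> z) (?\<Phi> y) < e / 2"
      unfolding continuous_at_eps_delta by (metis half_gt_zero dist_commute)
    have "\<forall>\<^sub>F n in sequentially. dist (y' n) y < d / 2"
      using tendstoD[OF y', of "d / 2"] d by simp
    moreover have "\<forall>\<^sub>F n in sequentially. dist (F n (y - d / 2)) (?\<Phi> (y - d / 2)) < e / 2"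
      using e by (intro tendstoD[OF conv[folded F_def]]) simp
    moreover have "\<forall>\<^sub>F n in sequentially. dist (F n (y + d / 2)) (?\<Phi> (y + d / 2)) < e / 2"
      using e by (intro tendstoD[OF conv[folded F_def]]) simp
    ultimately show "\<forall>\<^sub>F n in sequentially. dist (F n (y' n)) (?\<Phi> y) < e"
    proof eventually_elim
      case (elim n)
      have "F n (y - d / 2) \<le> F n (y' n)" "F n (y' n) \<le> F n (y + d / 2)"
        using elim(1) by (intro mono; unfold dist_real_def, linarith)+
      moreover have "dist (?\<Phi> (y - d / 2)) (?\<Phi> y) < e / 2" "dist (?\<Phi> (y + d / 2)) (?\<Phi> y) < e / 2"
        using d(1) by (intro d(2); simp add: dist_real_def)+
      ultimately show ?case
        using elim(2,3) unfolding dist_real_def by linarith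
    qed
  qed
  then show ?thesis by (rule Lim_transform_eventually) (rule eq)
qed

section \<open>Skew-Hermitian matrices and Cauchy interlacing\<close>

text \<open>
  Vectors and matrices are functions on natural numbers of which only the arguments below \<open>n\<close> matter. A principal
  submatrix is then the same function with a smaller \<open>n\<close>.
\<close>
definition herm :: "nat \<Rightarrow> (nat \<Rightarrow> complex) \<Rightarrow> (nat \<Rightarrow> complex) \<Rightarrow> complex" where
  "herm n v w = (\<Sum>i<n. v i * cnj (w i))"

definition mat_app :: "nat \<Rightarrow> (nat \<Rightarrow> nat \<Rightarrow> complex) \<Rightarrow> (nat \<Rightarrow> complex) \<Rightarrow> nat \<Rightarrow> complex" where
  "mat_app n B v i = (\<Sum>j<n. B i j * v j)"

text \<open>
  Incomplete systems, with \<open>m < n\<close>, are included so that a complete one can be built one vector at a time.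
\<close>
definition orthonormal_eigensystem where
  "orthonormal_eigensystem n B m u d \<longleftrightarrow>
     (\<forall>k<m. \<forall>l<m. herm n (u k) (u l) = (if k = l then 1 else 0)) \<and>
     (\<forall>k<m. \<forall>i<n. mat_app n B (u k) i = d k * u k i)"

definition skew_hermitian :: "nat \<Rightarrow> (nat \<Rightarrow> nat \<Rightarrow> complex) \<Rightarrow> bool" where
  "skew_hermitian n B \<longleftrightarrow> (\<forall>i<n. \<forall>j<n. B i j = - cnj (B j i))"

text \<open>
  Padding the system with zero rows gives a singular square matrix.
\<close>
lemma underdetermined_system_nat:
  fixes a :: "nat \<Rightarrow> nat \<Rightarrow> complex"
  assumes "m < n"
  shows "\<exists>c. (\<exists>j<n. c j \<noteq> 0) \<and> (\<forall>i<m. (\<Sum>j<n. a i j * c j) = 0)"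
proof -
  define A where "A = mat n n (\<lambda>(i, j). if i < m then a i j else 0)"
  have A: "A \<in> carrier_mat n n" by (simp add: A_def)
  have AT: "transpose_mat A \<in> carrier_mat n n" using A by simp
  have "det (transpose_mat A) = 0"
    unfolding det_0_iff_vec_prod_zero[OF AT]
  proof (intro exI conjI)
    show "unit_vec n m \<in> carrier_vec n" by simp
    show "unit_vec n m \<noteq> (0\<^sub>v n :: complex vec)" using assms by (auto simp: unit_vec_def vec_eq_iff)
    show "transpose_mat A *\<^sub>v unit_vec n m = 0\<^sub>v n"
      using assms A by (intro eq_vecI) (auto simp: A_def)
  qed
  then have "det A = 0" using det_transpose[OF A] by simp
  then obtain v where v: "v \<in> carrier_vec n" "v \<noteq> 0\<^sub>v n" "A *\<^sub>v v = 0\<^sub>v n"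
    using det_0_iff_vec_prod_zero[OF A] by auto
  have "\<exists>j<n. vec_index v j \<noteq> 0" using v(1,2) by (metis eq_vecI carrier_vecD index_zero_vec)
  moreover have "(\<Sum>j<n. a i j * vec_index v j) = 0" if i: "i < m" for i
  proof -
    have "vec_index (A *\<^sub>v v) i = (\<Sum>j<n. a i j * vec_index v j)"
      using i assms v(1) by (auto simp: A_def scalar_prod_def atLeast0LessThan intro!: sum.cong)
    then show ?thesis using v(3) i assms by simp
  qed
  ultimately show ?thesis by blast
qed

lemma underdetermined_system:
  fixes a :: "nat \<Rightarrow> 'b \<Rightarrow> complex"
  assumes fin: "finite C" and card: "m < card C"
  shows "\<exists>c. (\<exists>j\<in>C. c j \<noteq> 0) \<and> (\<forall>i<m. (\<Sum>j\<in>C. a i j * c j) = 0)"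
proof -
  obtain h where h: "bij_betw h {0..<card C} C" using ex_bij_betw_nat_finite[OF fin] by blast
  obtain c where c: "\<exists>j<card C. c j \<noteq> 0" "\<And>i. i < m \<Longrightarrow> (\<Sum>j<card C. a i (h j) * c j) = 0"
    using underdetermined_system_nat[OF card, of "\<lambda>i j. a i (h j)"] by blast
  define g where "g = the_inv_into {0..<card C} h"
  have gh: "g (h j) = j" if "j < card C" for j
    using that h unfolding g_def by (intro the_inv_into_f_f) (auto simp: bij_betw_def)
  have hC: "h j \<in> C" if "j < card C" for j using that h by (auto simp: bij_betw_def)
  have "(\<Sum>j\<in>C. a i j * c (g j)) = (\<Sum>j<card C. a i (h j) * c j)" for i
  proof -
    have "(\<Sum>j\<in>C. a i j * c (g j)) = (\<Sum>j\<in>{0..<card C}. a i (h j) * c (g (h j)))"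
      by (rule sum.reindex_bij_betw[OF h, symmetric])
    then show ?thesis by (simp add: gh atLeast0LessThan)
  qed
  then have "\<forall>i<m. (\<Sum>j\<in>C. a i j * c (g j)) = 0" using c(2) by simp
  moreover have "\<exists>j\<in>C. c (g j) \<noteq> 0" using c(1) gh hC by metis
  ultimately show ?thesis by (intro exI[of _ "\<lambda>j. c (g j)"]) simp
qed

lemma herm_cnj: "cnj (herm n v w) = herm n w v"
  by (simp add: herm_def mult.commute)

lemma herm_self: "herm n v v = of_real (\<Sum>i<n. (cmod (v i))\<^sup>2)"
  unfolding herm_def of_real_sum complex_norm_square ..

lemma herm_self_pos:
  fixes n :: nat
  assumes "i < n" "v i \<noteq> (0 :: complex)"
  shows "0 < (\<Sum>i<n. (cmod (v i))\<^sup>2)"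
proof (rule sum_pos2)
  show "i \<in> {..<n}" "0 < (cmod (v i))\<^sup>2" using assms by auto
qed auto

lemma herm_cong:
  "(\<And>i. i < n \<Longrightarrow> v i = v' i) \<Longrightarrow> (\<And>i. i < n \<Longrightarrow> w i = w' i) \<Longrightarrow> herm n v w = herm n v' w'"
  unfolding herm_def by (rule sum.cong) auto

lemma herm_app_skew:
  assumes "skew_hermitian n B"
  shows "herm n (mat_app n B v) w = - herm n v (mat_app n B w)"
proof -
  have "herm n (mat_app n B v) w = (\<Sum>i<n. \<Sum>j<n. B i j * v j * cnj (w i))"
    by (simp add: herm_def mat_app_def sum_distrib_right)
  also have "\<dots> = (\<Sum>i<n. \<Sum>j<n. - (v j * cnj (B j i * w i)))"
  proof (intro sum.cong refl)
    fix i j assume "i \<in> {..<n}" "j \<in> {..<n}"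
    then have b: "B i j = - cnj (B j i)" using assms unfolding skew_hermitian_def by blast
    show "B i j * v j * cnj (w i) = - (v j * cnj (B j i * w i))" unfolding b by simp
  qed
  also have "\<dots> = (\<Sum>j<n. \<Sum>i<n. - (v j * cnj (B j i * w i)))" by (rule sum.swap)
  also have "\<dots> = - herm n v (mat_app n B w)"
    by (simp add: herm_def mat_app_def sum_distrib_left sum_negf)
  finally show ?thesis .
qed

text \<open>
  The iterates of \<open>w\<close> under \<open>B\<close> are linearly dependent, so some nonzero polynomial in \<open>B\<close> annihilates \<open>w\<close>. Take one of
  minimal degree and split off a root \<open>r\<close> by the fundamental theorem of algebra: the cofactor applied to \<open>w\<close> is nonzero by
  minimality, lies in the subspace, and is annihilated by \<open>B - r\<close>.
\<close>
lemma eigenvector_in_invariant_subspace: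
  fixes B :: "nat \<Rightarrow> nat \<Rightarrow> complex"
  assumes w: "S w" "\<exists>i<n. w i \<noteq> 0"
    and S_app: "\<And>v. S v \<Longrightarrow> S (mat_app n B v)"
    and S_lin: "\<And>(I :: nat set) f c. finite I \<Longrightarrow> (\<And>j. j \<in> I \<Longrightarrow> S (f j)) \<Longrightarrow> S (\<lambda>i. \<Sum>j\<in>I. c j * f j i)"
  shows "\<exists>v r. S v \<and> (\<exists>i<n. v i \<noteq> 0) \<and> (\<forall>i<n. mat_app n B v i = r * v i)"
proof -
  define pw where "pw j = (mat_app n B ^^ j) w" for j
  have pw_Suc: "pw (Suc j) = mat_app n B (pw j)" for j by (simp add: pw_def)
  have S_pw: "S (pw j)" for j
    by (induction j) (use w S_app in \<open>auto simp: pw_Suc pw_def\<close>)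
  \<comment> \<open>\<open>act p\<close> is \<open>p (B)\<close> applied to \<open>w\<close>, for \<open>p\<close> of degree at most \<open>n\<close>\<close>
  define act where "act p i = (\<Sum>j\<in>{..n}. coeff p j * pw j i)" for p :: "complex poly" and i
  have S_act: "S (act p)" for p
    unfolding act_def by (rule S_lin) (use S_pw in auto)
  have "n < card {..n}" by simp
  from underdetermined_system[OF _ this, of "\<lambda>i j. pw j i"] obtain c
    where c: "\<exists>j\<in>{..n}. c j \<noteq> 0" "\<And>i. i < n \<Longrightarrow> (\<Sum>j\<in>{..n}. pw j i * c j) = 0" by auto
  define p0 where "p0 = (\<Sum>j\<in>{..n}. monom (c j) j)"
  have coeff_p0: "coeff p0 j = (if j \<le> n then c j else 0)" for j
    by (simp add: p0_def coeff_sum if_distrib sum.delta cong: if_cong)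
  have p0: "p0 \<noteq> 0" "degree p0 \<le> n" "\<forall>i<n. act p0 i = 0"
  proof -
    show "p0 \<noteq> 0" using c(1) coeff_p0 by (metis atMost_iff coeff_0)
    show "degree p0 \<le> n" by (rule degree_le) (simp add: coeff_p0)
    show "\<forall>i<n. act p0 i = 0" using c(2) by (simp add: act_def coeff_p0 mult.commute)
  qed
  define P where "P p \<longleftrightarrow> p \<noteq> 0 \<and> degree p \<le> n \<and> (\<forall>i<n. act p i = 0)" for p
  define p where "p = arg_min degree P"
  have "P p0" using p0 by (simp add: P_def)
  then have p: "P p" and min: "\<And>q. P q \<Longrightarrow> degree p \<le> degree q"
    unfolding p_def using arg_min_nat_lemma[of P p0 degree] by auto
  have "degree p \<noteq> 0"
  proof
    assume "degree p = 0"
    then obtain a where pa: "p = [:a:]" by (metis degree_eq_zeroE)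
    then have a: "a \<noteq> 0" using p by (auto simp: P_def)
    have "act p i = a * w i" for i
    proof -
      have "act p i = (\<Sum>j\<in>{..n}. if j = 0 then a * pw 0 i else 0)"
        unfolding act_def pa by (intro sum.cong) (auto simp: coeff_pCons split: nat.split)
      then show ?thesis by (simp add: pw_def)
    qed
    then show False using p a w(2) by (auto simp: P_def)
  qed
  then obtain r where r: "poly p r = 0"
    using fundamental_theorem_of_algebra[of p] constant_degree[of p] by auto
  then obtain q where q: "p = [:- r, 1:] * q" by (auto simp: poly_eq_0_iff_dvd dvd_def)
  have q0: "q \<noteq> 0" using p q by (auto simp: P_def)
  have deg: "degree p = Suc (degree q)" unfolding q using q0 by (subst degree_mult_eq) auto
  have qn: "coeff q n = 0" using p deg by (intro coeff_eq_0) (auto simp: P_def)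
  have "\<not> P q" using min[of q] deg by auto
  then have nz: "\<exists>i<n. act q i \<noteq> 0" using q0 p deg by (auto simp: P_def)
  have step: "act p i = mat_app n B (act q) i - r * act q i" for i
  proof -
    have cp: "coeff p j = (case j of 0 \<Rightarrow> 0 | Suc k \<Rightarrow> coeff q k) - r * coeff q j" for j
      unfolding q by (simp add: coeff_pCons split: nat.split)
    have "act p i = (\<Sum>j\<in>{..n}. (case j of 0 \<Rightarrow> 0 | Suc k \<Rightarrow> coeff q k) * pw j i) - r * act q i"
      unfolding act_def cp by (simp add: sum_subtractf sum_distrib_left algebra_simps)
    also have "(\<Sum>j\<in>{..n}. (case j of 0 \<Rightarrow> 0 | Suc k \<Rightarrow> coeff q k) * pw j i) = (\<Sum>k<n. coeff q k * pw (Suc k) i)"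
      by (subst lessThan_Suc_atMost[symmetric], subst sum.lessThan_Suc_shift) simp
    also have "\<dots> = (\<Sum>k\<in>{..n}. coeff q k * pw (Suc k) i)"
      using qn by (simp flip: lessThan_Suc_atMost)
    also have "\<dots> = mat_app n B (act q) i"
      unfolding pw_Suc mat_app_def act_def sum_distrib_left
      by (subst sum.swap) (simp add: mult_ac)
    finally show ?thesis .
  qed
  have "\<forall>i<n. mat_app n B (act q) i = r * act q i"
    using p step by (auto simp: P_def)
  then show ?thesis using S_act nz by blast
qed

lemma herm_sum_left: "herm n (\<lambda>i. \<Sum>j\<in>I. c j * f j i) x = (\<Sum>j\<in>I. c j * herm n (f j) x)"
  unfolding herm_def sum_distrib_left sum_distrib_right by (subst sum.swap) (simp add: mult.assoc)

lemma herm_scale_right: "herm n v (\<lambda>i. r * w i) = cnj r * herm n v w"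
  by (simp add: herm_def sum_distrib_left mult_ac)

lemma herm_scale_left: "herm n (\<lambda>i. r * v i) w = r * herm n v w"
  by (simp add: herm_def sum_distrib_left mult_ac)

text \<open>
  Orthonormal eigenvectors are added one at a time: the orthogonal complement of those already found is nonzero for
  dimension reasons and invariant because \<open>B\<close> is skew-Hermitian, so it contains a further eigenvector.
\<close>
theorem spectral_theorem_skew_hermitian:
  assumes B: "skew_hermitian n B"
  shows "\<exists>u d. orthonormal_eigensystem n B n u d"
proof -
  have "m \<le> n \<Longrightarrow> \<exists>u d. orthonormal_eigensystem n B m u d" for m
  proof (induction m)
    case 0
    then show ?case by (simp add: orthonormal_eigensystem_def)
  next
    case (Suc m)
    then obtain u d where ud: "orthonormal_eigensystem n B m u d" by auto
    have orth: "\<And>k l. k < m \<Longrightarrow> l < m \<Longrightarrow> herm n (u k) (u l) = (if k = l then 1 else 0)"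
      and eig: "\<And>k i. k < m \<Longrightarrow> i < n \<Longrightarrow> mat_app n B (u k) i = d k * u k i"
      using ud by (auto simp: orthonormal_eigensystem_def)
    define S where "S v \<longleftrightarrow> (\<forall>k<m. herm n v (u k) = 0)" for v
    have "m < n" using Suc.prems by simp
    from underdetermined_system_nat[OF this, of "\<lambda>k i. cnj (u k i)"]
    obtain w where w: "\<exists>i<n. w i \<noteq> 0" "S w"
      by (auto simp: S_def herm_def mult_ac)
    have "\<exists>v r. S v \<and> (\<exists>i<n. v i \<noteq> 0) \<and> (\<forall>i<n. mat_app n B v i = r * v i)"
    proof (rule eigenvector_in_invariant_subspace[of S, OF w(2,1)])
      fix v assume v: "S v"
      show "S (mat_app n B v)"
        unfolding S_def
      proof (intro allI impI)
        fix k assume k: "k < m"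
        have "herm n v (mat_app n B (u k)) = herm n v (\<lambda>i. d k * u k i)"
          by (rule herm_cong) (use eig k in auto)
        then show "herm n (mat_app n B v) (u k) = 0"
          using v k by (simp add: herm_app_skew[OF B] herm_scale_right S_def)
      qed
    next
      fix I :: "nat set" and f c assume "\<And>j. j \<in> I \<Longrightarrow> S (f j)"
      then show "S (\<lambda>i. \<Sum>j\<in>I. c j * f j i)" by (simp add: S_def herm_sum_left)
    qed
    then obtain v r where v: "S v" "\<exists>i<n. v i \<noteq> 0" "\<forall>i<n. mat_app n B v i = r * v i" by blast
    define s where "s = (\<Sum>i<n. (cmod (v i))\<^sup>2)"
    have s: "0 < s" using v(2) herm_self_pos unfolding s_def by blast
    define v' where "v' i = complex_of_real (1 / sqrt s) * v i" for i
    have v'S: "herm n v' (u k) = 0" if "k < m" for k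
      using v(1) that unfolding v'_def herm_scale_left by (simp add: S_def)
    then have v'S': "herm n (u k) v' = 0" if "k < m" for k
      using that herm_cnj[of n v' "u k"] by simp
    have v'1: "herm n v' v' = 1"
    proof -
      have "herm n v' v' = of_real (1 / sqrt s * (1 / sqrt s) * s)"
        unfolding v'_def herm_scale_left herm_scale_right
        unfolding herm_self s_def[symmetric]
        by (simp only: of_real_mult complex_cnj_complex_of_real mult.assoc)
      also have "1 / sqrt s * (1 / sqrt s) * s = 1" using s by (simp add: field_simps)
      finally show ?thesis by simp
    qed
    have v'e: "mat_app n B v' i = r * v' i" if "i < n" for i
    proof -
      have "mat_app n B v' i = complex_of_real (1 / sqrt s) * mat_app n B v i"
        by (simp add: mat_app_def v'_def sum_distrib_left mult_ac)
      then show ?thesis using v(3) that by (simp add: v'_def)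
    qed
    have "orthonormal_eigensystem n B (Suc m) (u(m := v')) (d(m := r))"
      unfolding orthonormal_eigensystem_def
      using orth eig v'S v'S' v'1 v'e by (auto simp: less_Suc_eq)
    then show ?case by blast
  qed
  then show ?thesis by simp
qed

text \<open>
  Links the eigensystem to eigenvalues with algebraic multiplicity: the matrix with columns \<open>u\<close> conjugates \<open>B\<close> to the
  diagonal matrix of the \<open>d k\<close>.
\<close>
lemma char_poly_of_eigensystem:
  assumes B: "B \<in> carrier_mat n n" and ud: "orthonormal_eigensystem n (\<lambda>i j. B $$ (i, j)) n u d"
  shows "proots (char_poly B) = image_mset d (mset_set {..<n})"
proof -
  define U where "U = mat n n (\<lambda>(i, k). u k i)"
  define V where "V = mat n n (\<lambda>(k, i). cnj (u k i))"
  define D where "D = mat n n (\<lambda>(k, l). if k = l then d k else 0)"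
  have car: "U \<in> carrier_mat n n" "V \<in> carrier_mat n n" "D \<in> carrier_mat n n"
    by (simp_all add: U_def V_def D_def)
  have orth: "\<And>k l. k < n \<Longrightarrow> l < n \<Longrightarrow> herm n (u k) (u l) = (if k = l then 1 else 0)"
    and eig: "\<And>k i. k < n \<Longrightarrow> i < n \<Longrightarrow> (\<Sum>j<n. B $$ (i, j) * u k j) = d k * u k i"
    using ud by (auto simp: orthonormal_eigensystem_def mat_app_def)
  have VU: "V * U = 1\<^sub>m n"
  proof (rule eq_matI)
    fix k l assume "k < dim_row (1\<^sub>m n :: complex mat)" "l < dim_col (1\<^sub>m n :: complex mat)"
    then have kl: "k < n" "l < n" by auto
    have "(V * U) $$ (k, l) = (\<Sum>i<n. cnj (u k i) * u l i)"
      using kl by (auto simp: U_def V_def scalar_prod_def atLeast0LessThan intro!: sum.cong)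
    also have "\<dots> = herm n (u l) (u k)" by (simp add: herm_def mult.commute)
    finally show "(V * U) $$ (k, l) = 1\<^sub>m n $$ (k, l)" using kl orth by auto
  qed (use car in auto)
  then have UV: "U * V = 1\<^sub>m n" by (rule mat_mult_left_right_inverse[OF car(2,1)])
  have BU: "B * U = U * D"
  proof (rule eq_matI)
    fix i k assume "i < dim_row (U * D)" "k < dim_col (U * D)"
    then have ik: "i < n" "k < n" using car by auto
    have "(B * U) $$ (i, k) = (\<Sum>j<n. B $$ (i, j) * u k j)"
      using ik B by (auto simp: U_def scalar_prod_def atLeast0LessThan intro!: sum.cong)
    also have "\<dots> = d k * u k i" by (rule eig[OF ik(2,1)])
    also have "\<dots> = (\<Sum>l<n. if l = k then u k i * d k else 0)" using ik by simp
    also have "\<dots> = (\<Sum>l<n. u l i * (if l = k then d l else 0))" by (intro sum.cong) auto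
    also have "\<dots> = (U * D) $$ (i, k)"
      using ik by (simp add: U_def D_def scalar_prod_def atLeast0LessThan)
    finally show "(B * U) $$ (i, k) = (U * D) $$ (i, k)" .
  qed (use car B in auto)
  have "B = B * (U * V)" using B UV by simp
  also have "\<dots> = B * U * V" using B car by (simp add: assoc_mult_mat)
  finally have "B = U * D * V" unfolding BU .
  then have "similar_mat B D"
    unfolding similar_mat_def
    by (intro exI[of _ U] exI[of _ V] similar_mat_witI[OF UV VU _ B car(3,1,2)])
  then have "char_poly B = char_poly D" by (rule char_poly_similar)
  also have "\<dots> = (\<Prod>a\<leftarrow>diag_mat D. [:- a, 1:])"
    by (rule char_poly_upper_triangular[OF car(3)]) (auto simp: D_def upper_triangular_def)
  also have "diag_mat D = map d [0..<n]"
    by (auto simp: diag_mat_def D_def intro!: map_cong)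
  finally have "char_poly B = (\<Prod>k\<leftarrow>[0..<n]. [:- d k, 1:])" by (simp add: o_def)
  also have "\<dots> = (\<Prod>k<n. [:- d k, 1:])"
    using prod.distinct_set_conv_list[of "[0..<n]" "\<lambda>k. [:- d k, 1:]"] by (simp add: atLeast0LessThan)
  finally have "char_poly B = (\<Prod>k<n. [:- d k, 1:])" .
  then have "proots (char_poly B) = (\<Sum>k<n. {#d k#})"
    by (simp only:) (subst proots_prod, auto)
  then show ?thesis by (simp add: sum_unfold_sum_mset)
qed

lemma herm_expand:
  fixes \<alpha> :: "nat \<Rightarrow> complex"
  assumes ud: "orthonormal_eigensystem n B m u d" and J: "J \<subseteq> {..<m}"
  defines "v \<equiv> (\<lambda>i. \<Sum>k\<in>J. \<alpha> k * u k i)"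
  shows "herm n v v = (\<Sum>k\<in>J. of_real ((cmod (\<alpha> k))\<^sup>2))"
    and "herm n (mat_app n B v) v = (\<Sum>k\<in>J. d k * of_real ((cmod (\<alpha> k))\<^sup>2))"
proof -
  have fin: "finite J" using J finite_subset by auto
  have orth: "\<And>k l. k \<in> J \<Longrightarrow> l \<in> J \<Longrightarrow> herm n (u k) (u l) = (if k = l then 1 else 0)"
    and eig: "\<And>k i. k \<in> J \<Longrightarrow> i < n \<Longrightarrow> mat_app n B (u k) i = d k * u k i"
    using ud J by (auto simp: orthonormal_eigensystem_def subset_iff)
  have uv: "herm n (u k) v = cnj (\<alpha> k)" if k: "k \<in> J" for k
  proof -
    have "herm n v (u k) = (\<Sum>l\<in>J. \<alpha> l * herm n (u l) (u k))" unfolding v_def by (rule herm_sum_left)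
    also have "\<dots> = (\<Sum>l\<in>J. if l = k then \<alpha> k else 0)" using orth k by (intro sum.cong) auto
    also have "\<dots> = \<alpha> k" using k fin by simp
    finally show ?thesis using herm_cnj[of n v "u k"] by simp
  qed
  have "herm n v v = (\<Sum>k\<in>J. \<alpha> k * herm n (u k) v)"
    by (subst (1) v_def) (rule herm_sum_left)
  also have "\<dots> = (\<Sum>k\<in>J. of_real ((cmod (\<alpha> k))\<^sup>2))"
    by (intro sum.cong refl) (simp only: uv complex_norm_square)
  finally show "herm n v v = (\<Sum>k\<in>J. of_real ((cmod (\<alpha> k))\<^sup>2))" .
  have "herm n (mat_app n B v) v = herm n (\<lambda>i. \<Sum>k\<in>J. (d k * \<alpha> k) * u k i) v"
  proof (rule herm_cong)
    fix i assume i: "i < n"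
    have "mat_app n B v i = (\<Sum>k\<in>J. \<alpha> k * mat_app n B (u k) i)"
      unfolding mat_app_def v_def sum_distrib_left by (subst sum.swap) (simp add: mult_ac)
    then show "mat_app n B v i = (\<Sum>k\<in>J. (d k * \<alpha> k) * u k i)" using eig i by (simp add: mult_ac)
  qed simp
  also have "\<dots> = (\<Sum>k\<in>J. (d k * \<alpha> k) * herm n (u k) v)" by (rule herm_sum_left)
  also have "\<dots> = (\<Sum>k\<in>J. d k * of_real ((cmod (\<alpha> k))\<^sup>2))"
    by (intro sum.cong refl) (simp only: uv complex_norm_square mult.assoc)
  finally show "herm n (mat_app n B v) v = (\<Sum>k\<in>J. d k * of_real ((cmod (\<alpha> k))\<^sup>2))" .
qed

text \<open>
  If the cardinalities added up to more than the dimension \<open>Suc n\<close>, some nonzero vector would lie both in the span of the \<open>u k\<close> with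
  \<open>k \<in> J\<close> and in the span of the \<open>w l\<close>, extended by \<open>0\<close>, with \<open>l \<in> L\<close>. On it the form \<open>Re (c * <B v, v>)\<close>
  would have both a value at most \<open>x * <v, v>\<close> and a larger one, where \<open>x\<close> is the largest \<open>Re (c * d k)\<close> on \<open>J\<close>.
\<close>
lemma separated_spectra_card:
  assumes ud: "orthonormal_eigensystem (Suc n) B (Suc n) u d"
    and we: "orthonormal_eigensystem n B n w e"
    and J: "J \<subseteq> {..<Suc n}" and L: "L \<subseteq> {..<n}"
    and sep: "\<And>k l. k \<in> J \<Longrightarrow> l \<in> L \<Longrightarrow> Re (c * d k) < Re (c * e l)"
  shows "card J + card L \<le> Suc n"
proof (rule ccontr)
  assume "\<not> card J + card L \<le> Suc n"
  moreover have fin: "finite J" "finite L" using J L finite_subset by auto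
  ultimately have "Suc n < card (J <+> L)" by (simp add: card_Plus)
  moreover have "finite (J <+> L)" using fin by simp
  ultimately obtain \<gamma> where nz: "\<exists>j\<in>J <+> L. \<gamma> j \<noteq> 0"
    and ker: "\<And>i. i < Suc n \<Longrightarrow> (\<Sum>j\<in>J <+> L. (case j of Inl k \<Rightarrow> u k i | Inr l \<Rightarrow> if i < n then w l i else 0) * \<gamma> j) = 0"
    using underdetermined_system[of "J <+> L" "Suc n" "\<lambda>i j. (case j of Inl k \<Rightarrow> u k i | Inr l \<Rightarrow> if i < n then w l i else 0)"]
    by blast
  define \<alpha> where "\<alpha> k = \<gamma> (Inl k)" for k
  define \<beta> where "\<beta> l = - \<gamma> (Inr l)" for l
  define v where "v i = (\<Sum>k\<in>J. \<alpha> k * u k i)" for i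
  define z where "z i = (\<Sum>l\<in>L. \<beta> l * w l i)" for i
  have vz: "v i = (if i < n then z i else 0)" if "i < Suc n" for i
  proof -
    have F: "(\<Sum>k\<in>J. \<gamma> (Inl k) * u k i) + (\<Sum>l\<in>L. \<gamma> (Inr l) * (if i < n then w l i else 0)) = 0"
      using ker[OF that] fin by (simp add: sum.Plus mult.commute)
    show ?thesis
    proof (cases "i < n")
      case True
      then show ?thesis
        using F by (simp add: v_def z_def \<alpha>_def \<beta>_def sum_negf eq_neg_iff_add_eq_0)
    next
      case False
      then show ?thesis using F by (simp add: v_def \<alpha>_def)
    qed
  qed
  have hv: "herm (Suc n) v v = herm n z z"
    using vz by (auto simp: herm_def intro!: sum.cong)
  have ha: "herm (Suc n) (mat_app (Suc n) B v) v = herm n (mat_app n B z) z"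
  proof -
    have "mat_app (Suc n) B v i = mat_app n B z i" for i
      using vz by (auto simp: mat_app_def intro!: sum.cong)
    then show ?thesis using vz by (auto simp: herm_def intro!: sum.cong)
  qed
  define Sa where "Sa = (\<Sum>k\<in>J. (cmod (\<alpha> k))\<^sup>2)"
  define Sb where "Sb = (\<Sum>l\<in>L. (cmod (\<beta> l))\<^sup>2)"
  have "complex_of_real Sa = of_real Sb"
    using herm_expand(1)[OF ud J, of \<alpha>] herm_expand(1)[OF we L, of \<beta>] hv
    unfolding v_def[symmetric] z_def[symmetric] Sa_def Sb_def by simp
  then have S_eq: "Sa = Sb" by simp
  have "0 < Sa \<or> 0 < Sb"
  proof -
    from nz consider k where "k \<in> J" "\<alpha> k \<noteq> 0" | l where "l \<in> L" "\<beta> l \<noteq> 0"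
      by (auto simp: \<alpha>_def \<beta>_def)
    then show ?thesis
    proof cases
      case 1
      then have "0 < Sa" unfolding Sa_def using fin by (intro sum_pos2[of _ k]) auto
      then show ?thesis ..
    next
      case 2
      then have "0 < Sb" unfolding Sb_def using fin by (intro sum_pos2[of _ l]) auto
      then show ?thesis ..
    qed
  qed
  then have pos: "0 < Sa" "0 < Sb" using S_eq by auto
  have Jne: "J \<noteq> {}" using pos(1) by (auto simp: Sa_def)
  define x where "x = Max ((\<lambda>k. Re (c * d k)) ` J)"
  have xJ: "Re (c * d k) \<le> x" if "k \<in> J" for k unfolding x_def using that fin by auto
  have xL: "x < Re (c * e l)" if "l \<in> L" for l
    unfolding x_def using that fin Jne sep by (subst Max_less_iff) auto
  have "Re (c * herm (Suc n) (mat_app (Suc n) B v) v) = (\<Sum>k\<in>J. Re (c * d k) * (cmod (\<alpha> k))\<^sup>2)"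
    unfolding v_def herm_expand(2)[OF ud J] sum_distrib_left Re_sum
    by (intro sum.cong refl) (simp add: mult.assoc[symmetric] del: of_real_power)
  also have "\<dots> \<le> (\<Sum>k\<in>J. x * (cmod (\<alpha> k))\<^sup>2)"
    by (intro sum_mono mult_right_mono xJ) auto
  also have "\<dots> = x * Sb" by (simp add: Sa_def sum_distrib_left flip: S_eq)
  also have "\<dots> < Re (c * herm n (mat_app n B z) z)"
  proof -
    obtain l where l: "l \<in> L" "\<beta> l \<noteq> 0" using pos(2) unfolding Sb_def
      by (metis (no_types, lifting) less_irrefl norm_zero power_zero_numeral sum.neutral)
    have "x * Sb = (\<Sum>l\<in>L. x * (cmod (\<beta> l))\<^sup>2)" by (simp add: Sb_def sum_distrib_left)
    also have "\<dots> < (\<Sum>l\<in>L. Re (c * e l) * (cmod (\<beta> l))\<^sup>2)"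
    proof (rule sum_strict_mono_ex1[OF fin(2)])
      show "\<forall>l\<in>L. x * (cmod (\<beta> l))\<^sup>2 \<le> Re (c * e l) * (cmod (\<beta> l))\<^sup>2"
        by (intro ballI mult_right_mono less_imp_le[OF xL]) auto
      show "\<exists>l\<in>L. x * (cmod (\<beta> l))\<^sup>2 < Re (c * e l) * (cmod (\<beta> l))\<^sup>2"
        using l by (intro bexI[OF _ l(1)] mult_strict_right_mono xL) auto
    qed
    also have "\<dots> = Re (c * herm n (mat_app n B z) z)"
      unfolding z_def herm_expand(2)[OF we L] sum_distrib_left Re_sum
      by (intro sum.cong refl) (simp add: mult.assoc[symmetric] del: of_real_power)
    finally show ?thesis .
  qed
  finally show False unfolding ha by simp
qed

text \<open>
  Both inequalities are instances of \<open>separated_spectra_card\<close>: eigenvalues at most \<open>y\<close> of the large matrix against those above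
  \<open>y\<close> of its submatrix, with \<open>c = \<i>\<close>, and conversely with \<open>c = - \<i>\<close>.
\<close>
theorem cauchy_interlacing_count:
  fixes y :: real
  assumes ud: "orthonormal_eigensystem (Suc n) B (Suc n) u d"
    and we: "orthonormal_eigensystem n B n w e"
  defines "p \<equiv> card {k. k < Suc n \<and> Re (\<i> * d k) \<le> y}" and "q \<equiv> card {l. l < n \<and> Re (\<i> * e l) \<le> y}"
  shows "q \<le> p \<and> p \<le> Suc q"
proof
  have cp: "card {k. k < Suc n \<and> y < Re (\<i> * d k)} = Suc n - p"
  proof -
    have "{k. k < Suc n \<and> y < Re (\<i> * d k)} = {..<Suc n} - {k. k < Suc n \<and> Re (\<i> * d k) \<le> y}" by auto
    then show ?thesis unfolding p_def by (simp add: card_Diff_subset subset_iff)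
  qed
  have cq: "card {l. l < n \<and> y < Re (\<i> * e l)} = n - q"
  proof -
    have "{l. l < n \<and> y < Re (\<i> * e l)} = {..<n} - {l. l < n \<and> Re (\<i> * e l) \<le> y}" by auto
    then show ?thesis unfolding q_def by (simp add: card_Diff_subset subset_iff)
  qed
  have p_le: "p \<le> Suc n" unfolding p_def using card_mono[of "{..<Suc n}" "{k. k < Suc n \<and> Re (\<i> * d k) \<le> y}"] by auto
  have q_le: "q \<le> n" unfolding q_def using card_mono[of "{..<n}" "{l. l < n \<and> Re (\<i> * e l) \<le> y}"] by auto
  have "p + (n - q) \<le> Suc n"
    unfolding p_def cq[symmetric]
    by (rule separated_spectra_card[OF ud we, where c = \<i>]) auto
  then show "p \<le> Suc q" using q_le by linarith
  have "(Suc n - p) + q \<le> Suc n"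
    unfolding q_def cp[symmetric]
    by (rule separated_spectra_card[OF ud we, where c = "- \<i>"]) auto
  then show "q \<le> p" using p_le by linarith
qed

section \<open>The spectra of the two matrix ensembles\<close>

text \<open>
  The entries of the Schur product of the sign matrix with a symmetric Toeplitz matrix; the link function \<open>L\<close> sends the distance
  from the diagonal to the index of the input variable.
\<close>
definition signed_row :: "(nat \<Rightarrow> nat) \<Rightarrow> (nat \<Rightarrow> real) \<Rightarrow> nat \<Rightarrow> nat \<Rightarrow> real" where
  "signed_row L x i j = (if i < j then x (L (j - i)) else if i = j then 0 else - x (L (i - j)))"

abbreviation SC_entry :: "nat \<Rightarrow> (nat \<Rightarrow> real) \<Rightarrow> nat \<Rightarrow> nat \<Rightarrow> real" where
  "SC_entry n \<equiv> signed_row (\<lambda>e. min e (n - e))"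

definition SC_eigenvector :: "nat \<Rightarrow> nat \<Rightarrow> nat \<Rightarrow> complex" where
  "SC_eigenvector n k j = iexp (angle n k * real j) / of_real (sqrt (real n))"

definition SC_eigenvalue :: "nat \<Rightarrow> (nat \<Rightarrow> real) \<Rightarrow> nat \<Rightarrow> complex" where
  "SC_eigenvalue n x k = (\<Sum>e\<in>{1..<n}. of_real (x (min e (n - e))) * iexp (angle n k * real e))"

lemma Re_SC_eigenvalue: "Re (\<i> * SC_eigenvalue n x k) = eigval n k x"
  unfolding eigval_eq_row_sum SC_eigenvalue_def by (simp add: Im_exp)

lemma SC_eigenvector_orthonormal:
  assumes k: "k < n" and l: "l < n"
  shows "herm n (SC_eigenvector n k) (SC_eigenvector n l) = (if k = l then 1 else 0)"
proof -
  have n: "0 < real n" using k by simp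
  define z where "z = iexp (angle n k - angle n l)"
  have "herm n (SC_eigenvector n k) (SC_eigenvector n l) = (\<Sum>j<n. z ^ j / of_nat n)"
    unfolding herm_def
  proof (intro sum.cong refl)
    fix j
    have "cnj (iexp (angle n l * real j)) = iexp (- (angle n l * real j))"
      by (simp add: exp_cnj)
    then have "SC_eigenvector n k j * cnj (SC_eigenvector n l j)
      = iexp (angle n k * real j) * iexp (- (angle n l * real j)) / of_nat n"
      by (simp add: SC_eigenvector_def flip: of_real_mult)
    also have "iexp (angle n k * real j) * iexp (- (angle n l * real j)) = iexp (real j * (angle n k - angle n l))"
      by (simp add: algebra_simps flip: exp_add)
    also have "\<dots> = z ^ j" by (simp add: z_def flip: exp_of_nat_mult) (simp add: mult_ac)
    finally show "SC_eigenvector n k j * cnj (SC_eigenvector n l j) = z ^ j / of_nat n" using n by simp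
  qed
  also have "\<dots> = (if k = l then 1 else 0)"
  proof (cases "k = l")
    case True
    then show ?thesis using n by (simp add: z_def)
  next
    case False
    have ang: "angle n k - angle n l = 2 * pi * (real k - real l) / real n"
      by (simp add: angle_def algebra_simps add_divide_distrib diff_divide_distrib)
    have "z \<noteq> 1"
    proof
      assume "z = 1"
      then obtain m :: int where "angle n k - angle n l = of_int (2 * m) * pi"
        by (auto simp: z_def exp_eq_1)
      then have "2 * pi * (real k - real l) = 2 * pi * (of_int m * real n)"
        using n unfolding ang by (simp add: field_simps)
      then have "real k - real l = of_int m * real n" by (simp only: mult_cancel_left) simp
      then have eq: "int k - int l = m * int n" by (metis of_int_diff of_int_eq_iff of_int_mult of_int_of_nat_eq)
      then have "\<bar>m * int n\<bar> < 1 * int n" using k l by linarith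
      then have "\<bar>m\<bar> < 1" using n by (simp add: abs_mult)
      then show False using eq False by simp
    qed
    moreover have "z ^ n = 1"
    proof -
      have "z ^ n = iexp (real n * (angle n k - angle n l))"
        by (simp add: z_def flip: exp_of_nat_mult) (simp add: mult_ac)
      also have "real n * (angle n k - angle n l) = of_int (2 * (int k - int l)) * pi"
        using n unfolding ang by simp
      also have "iexp \<dots> = 1"
        unfolding exp_eq_1 by (intro conjI exI[of _ "int k - int l"]) simp_all
      finally show ?thesis .
    qed
    ultimately show ?thesis
      using False by (simp add: geometric_sum flip: sum_divide_distrib)
  qed
  finally show ?thesis .
qed

text \<open>
  The eigenvectors change sign under a shift by \<open>n\<close>, because \<open>n * angle n k\<close> is an odd multiple of \<open>\<pi>\<close>.
\<close>
lemma iexp_angle_reflect: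
  assumes "e \<le> n" "0 < n"
  shows "iexp (angle n k * (a - real e)) = - iexp (angle n k * (a + real (n - e)))"
proof -
  have "angle n k * (a + real (n - e)) = angle n k * (a - real e) + real (2 * k + 1) * pi"
    using assms by (simp add: angle_def of_nat_diff field_simps)
  moreover have "iexp (real (2 * k + 1) * pi) = -1"
    using cis_conv_exp[of "real (2 * k + 1) * pi"] cos_npi[of "2 * k + 1"] sin_npi[of "2 * k + 1"]
    by (simp add: complex_eq_iff)
  ultimately show ?thesis
    by (simp add: exp_add distrib_left del: of_nat_add of_nat_mult)
qed

text \<open>
  The offsets \<open>j - i\<close> to the right of the diagonal cover \<open>1 .. n - 1 - i\<close>. An offset to the left is raised by \<open>n\<close>, which covers
  \<open>n - i .. n - 1\<close>: the input variable is unchanged by the symmetry of the circulant, and the sign of the entry cancels the sign that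
  the eigenvector acquires under a shift by \<open>n\<close>. The result is the full sum defining the eigenvalue.
\<close>
lemma SC_eigen_equation:
  assumes i: "i < n"
  shows "mat_app n (\<lambda>i j. of_real (SC_entry n x i j)) (SC_eigenvector n k) i
     = SC_eigenvalue n x k * SC_eigenvector n k i"
proof -
  define c where "c e = complex_of_real (x (min e (n - e)))" for e
  define E where "E a = iexp (angle n k * a)" for a
  have E_add: "E (a + b) = E a * E b" for a b
    by (simp add: E_def distrib_left exp_add)
  have split: "{..<n} = ({..<i} \<union> {i}) \<union> {i<..<n}" using i by auto
  define g where "g j = of_real (SC_entry n x i j) * E (real j)" for j
  have "(\<Sum>j<n. g j) = sum g ({..<i} \<union> {i}) + sum g {i<..<n}"
    unfolding split by (rule sum.union_disjoint) auto
  also have "sum g ({..<i} \<union> {i}) = sum g {..<i}"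
    by (subst sum.union_disjoint) (auto simp: g_def signed_row_def)
  finally have "(\<Sum>j<n. of_real (SC_entry n x i j) * E (real j))
    = (\<Sum>j\<in>{..<i}. of_real (SC_entry n x i j) * E (real j))
     + (\<Sum>j\<in>{i<..<n}. of_real (SC_entry n x i j) * E (real j))"
    unfolding g_def .
  also have "(\<Sum>j\<in>{..<i}. of_real (SC_entry n x i j) * E (real j))
    = (\<Sum>e\<in>{n - i..<n}. c e * E (real i + real e))"
  proof (rule sum.reindex_bij_witness[of _ "\<lambda>e. e - (n - i)" "\<lambda>j. j + (n - i)"])
    fix j assume j: "j \<in> {..<i}"
    have 1: "n - (i - j) = j + (n - i)" using j i by auto
    have 2: "real j = real i - real (i - j)" using j by simp
    have Ej: "E (real j) = - E (real i + real (n - (i - j)))"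
      unfolding E_def 2 by (rule iexp_angle_reflect) (use i in auto)
    have m: "min (i - j) (n - (i - j)) = min (j + (n - i)) (n - (j + (n - i)))" using i j by auto
    have "SC_entry n x i j = - x (min (i - j) (n - (i - j)))"
      using j by (simp add: signed_row_def)
    then have s: "complex_of_real (SC_entry n x i j) = - c (j + (n - i))"
      unfolding m c_def by (simp only: of_real_minus)
    show "c (j + (n - i)) * E (real i + real (j + (n - i)))
      = of_real (SC_entry n x i j) * E (real j)"
      unfolding s Ej 1 by simp
  qed (use i in auto)
  also have "(\<Sum>j\<in>{i<..<n}. of_real (SC_entry n x i j) * E (real j))
    = (\<Sum>e\<in>{1..<n - i}. c e * E (real i + real e))"
    by (rule sum.reindex_bij_witness[of _ "\<lambda>e. e + i" "\<lambda>j. j - i"])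
       (use i in \<open>auto simp: c_def signed_row_def\<close>)
  also have "(\<Sum>e\<in>{n - i..<n}. c e * E (real i + real e)) + (\<Sum>e\<in>{1..<n - i}. c e * E (real i + real e))
    = (\<Sum>e\<in>{1..<n}. c e * E (real i + real e))"
    using i by (subst add.commute, intro sum.atLeastLessThan_concat) auto
  also have "\<dots> = SC_eigenvalue n x k * E (real i)"
    unfolding E_add unfolding SC_eigenvalue_def c_def E_def by (simp add: sum_distrib_left mult_ac)
  finally have "(\<Sum>j<n. of_real (SC_entry n x i j) * E (real j)) = SC_eigenvalue n x k * E (real i)" .
  then show ?thesis
    unfolding mat_app_def SC_eigenvector_def E_def by (simp flip: sum_divide_distrib)
qed

lemma SC_eigensystem:
  "orthonormal_eigensystem n (\<lambda>i j. of_real (c * SC_entry n x i j)) n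
     (SC_eigenvector n) (\<lambda>k. of_real c * SC_eigenvalue n x k)"
proof -
  have "mat_app n (\<lambda>i j. of_real (c * SC_entry n x i j)) v i
    = of_real c * mat_app n (\<lambda>i j. of_real (SC_entry n x i j)) v i" for v i
    by (simp add: mat_app_def sum_distrib_left mult.assoc)
  then show ?thesis
    unfolding orthonormal_eigensystem_def
    by (simp add: SC_eigenvector_orthonormal SC_eigen_equation)
qed

lemma orthonormal_eigensystem_cong:
  assumes "\<And>i j. i < n \<Longrightarrow> j < n \<Longrightarrow> B i j = B' i j"
  shows "orthonormal_eigensystem n B m u d \<longleftrightarrow> orthonormal_eigensystem n B' m u d"
proof -
  have "mat_app n B v i = mat_app n B' v i" if "i < n" for v i
    unfolding mat_app_def using assms that by (intro sum.cong) auto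
  then show ?thesis unfolding orthonormal_eigensystem_def by auto
qed

lemma skew_ESD_of_eigensystem:
  assumes A: "A \<in> carrier_mat n n"
    and ud: "orthonormal_eigensystem n (\<lambda>i j. of_real (A $$ (i, j))) n u d"
  shows "skew_ESD A y = real (card {k. k < n \<and> Re (\<i> * d k) \<le> y}) / real n"
proof -
  have C: "map_mat complex_of_real A \<in> carrier_mat n n" using A by simp
  have "orthonormal_eigensystem n (\<lambda>i j. map_mat complex_of_real A $$ (i, j)) n u d"
    using ud A by (subst orthonormal_eigensystem_cong[where B' = "\<lambda>i j. of_real (A $$ (i, j))"]) auto
  then have "eigenvalue_mset A = image_mset d (mset_set {..<n})"
    unfolding eigenvalue_mset_def by (rule char_poly_of_eigensystem[OF C])
  moreover have "{k \<in> {..<n}. Re (\<i> * d k) \<le> y} = {k. k < n \<and> Re (\<i> * d k) \<le> y}" by auto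
  ultimately show ?thesis
    using A unfolding skew_ESD_def by (simp add: filter_mset_image_mset)
qed

lemma skew_sym_circulant_entry:
  assumes "i < n" "j < n"
  shows "(c \<cdot>\<^sub>m skew_sym_circulant n x) $$ (i, j) = c * SC_entry n x i j"
proof -
  have "nat \<bar>int i - int j\<bar> = (if i < j then j - i else i - j)" by auto
  then show ?thesis
    using assms by (auto simp: skew_sym_circulant_def hadamard_def sign_matrix_def sym_circulant_def
      SC_link_def signed_row_def Let_def)
qed

lemma skew_palindromic_toeplitz_entry:
  assumes "i < n" "j < n"
  shows "(c \<cdot>\<^sub>m skew_palindromic_toeplitz n x) $$ (i, j) = c * signed_row (\<lambda>e. min e (n - 1 - e)) x i j"
proof -
  have "nat \<bar>int i - int j\<bar> = (if i < j then j - i else i - j)" by auto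
  then show ?thesis
    using assms by (auto simp: skew_palindromic_toeplitz_def hadamard_def sign_matrix_def palindromic_toeplitz_def
      PT_link_def signed_row_def Let_def)
qed

lemma skew_sym_circulant_carrier: "c \<cdot>\<^sub>m skew_sym_circulant n x \<in> carrier_mat n n"
  by (simp add: skew_sym_circulant_def hadamard_def sign_matrix_def)

lemma skew_palindromic_toeplitz_carrier: "c \<cdot>\<^sub>m skew_palindromic_toeplitz n x \<in> carrier_mat n n"
  by (simp add: skew_palindromic_toeplitz_def hadamard_def sign_matrix_def)

lemma Re_scaled_SC_eigenvalue: "Re (\<i> * (of_real c * SC_eigenvalue n x k)) = c * eigval n k x"
proof -
  have "\<i> * (of_real c * SC_eigenvalue n x k) = of_real c * (\<i> * SC_eigenvalue n x k)" by simp
  moreover have "Re (of_real c * z) = c * Re z" for z by simp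
  ultimately show ?thesis by (simp only: Re_SC_eigenvalue)
qed

lemma skew_ESD_sym_circulant:
  "skew_ESD ((1 / sqrt (real n)) \<cdot>\<^sub>m skew_sym_circulant n x) y
    = real (card {k. k < n \<and> eigval n k x / sqrt (real n) \<le> y}) / real n"
proof -
  have "orthonormal_eigensystem n (\<lambda>i j. of_real (((1 / sqrt (real n)) \<cdot>\<^sub>m skew_sym_circulant n x) $$ (i, j))) n
     (SC_eigenvector n) (\<lambda>k. of_real (1 / sqrt (real n)) * SC_eigenvalue n x k)"
    using SC_eigensystem by (subst orthonormal_eigensystem_cong) (simp_all only: skew_sym_circulant_entry)
  from skew_ESD_of_eigensystem[OF skew_sym_circulant_carrier this] show ?thesis
    unfolding Re_scaled_SC_eigenvalue by simp
qed

text \<open>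
  For size \<open>Suc n\<close> the palindromic link \<open>min e (Suc n - 1 - e)\<close> is the circulant link of size \<open>n\<close>, so the eigensystem of the
  circulant matrix diagonalises the leading principal submatrix and interlacing applies.
\<close>
lemma skew_ESD_palindromic_toeplitz:
  fixes x :: "nat \<Rightarrow> real" and y :: real
  defines "q n \<equiv> card {k. k < n \<and> eigval n k x / sqrt (real (Suc n)) \<le> y}"
  shows "\<bar>skew_ESD ((1 / sqrt (real (Suc n))) \<cdot>\<^sub>m skew_palindromic_toeplitz (Suc n) x) y - real (q n) / real (Suc n)\<bar>
    \<le> 1 / real (Suc n)"
proof -
  define c where "c = 1 / sqrt (real (Suc n))"
  define B where "B i j = complex_of_real (c * SC_entry n x i j)" for i j
  have "skew_hermitian (Suc n) B"
    by (auto simp: skew_hermitian_def B_def signed_row_def)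
  then obtain u d where ud: "orthonormal_eigensystem (Suc n) B (Suc n) u d"
    using spectral_theorem_skew_hermitian by blast
  have "orthonormal_eigensystem (Suc n) (\<lambda>i j. of_real ((c \<cdot>\<^sub>m skew_palindromic_toeplitz (Suc n) x) $$ (i, j))) (Suc n) u d"
    using ud by (subst orthonormal_eigensystem_cong[where B' = B])
      (simp_all only: skew_palindromic_toeplitz_entry B_def diff_Suc_1)
  note E = skew_ESD_of_eigensystem[OF skew_palindromic_toeplitz_carrier this, of y]
  have we: "orthonormal_eigensystem n B n (SC_eigenvector n) (\<lambda>k. of_real c * SC_eigenvalue n x k)"
    unfolding B_def by (rule SC_eigensystem)
  have q: "q n = card {l. l < n \<and> Re (\<i> * (of_real c * SC_eigenvalue n x l)) \<le> y}"
    unfolding q_def Re_scaled_SC_eigenvalue by (simp add: c_def)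
  define p where "p = card {k. k < Suc n \<and> Re (\<i> * d k) \<le> y}"
  have "q n \<le> p \<and> p \<le> Suc (q n)"
    unfolding q p_def by (rule cauchy_interlacing_count[OF ud we])
  then have "\<bar>real p - real (q n)\<bar> \<le> 1" by (auto simp: abs_le_iff)
  then have "\<bar>real p - real (q n)\<bar> / real (Suc n) \<le> 1 / real (Suc n)" by (rule divide_right_mono) simp
  moreover have "\<bar>real p / real (Suc n) - real (q n) / real (Suc n)\<bar> = \<bar>real p - real (q n)\<bar> / real (Suc n)"
    by (simp flip: diff_divide_distrib)
  ultimately show ?thesis unfolding E[unfolded c_def] p_def by simp
qed

lemma skew_ESD_tendsto_gaussian:
  assumes conv: "\<And>t. (\<lambda>n. emp_char n t x) \<longlonglongrightarrow> of_real (exp (- (t\<^sup>2 / 2)))"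
  shows "(\<lambda>n. skew_ESD ((1 / sqrt (real n)) \<cdot>\<^sub>m skew_sym_circulant n x) y) \<longlonglongrightarrow> cdf std_normal_distribution y"
    and "(\<lambda>n. skew_ESD ((1 / sqrt (real n)) \<cdot>\<^sub>m skew_palindromic_toeplitz n x) y) \<longlonglongrightarrow> cdf std_normal_distribution y"
proof -
  note SC = eigval_count_tendsto_gaussian[OF conv]
  show "(\<lambda>n. skew_ESD ((1 / sqrt (real n)) \<cdot>\<^sub>m skew_sym_circulant n x) y) \<longlonglongrightarrow> cdf std_normal_distribution y"
    unfolding skew_ESD_sym_circulant by (rule SC)
  define q where "q n = card {k. k < n \<and> eigval n k x / sqrt (real (Suc n)) \<le> y}" for n
  have "(\<lambda>n. real (q n) / real n) \<longlonglongrightarrow> cdf std_normal_distribution y"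
    unfolding q_def by (rule eigval_count_tendsto_gaussian_shifted[OF SC])
  moreover have "(\<lambda>n. real n / real (Suc n)) \<longlonglongrightarrow> 1" by (rule LIMSEQ_n_over_Suc_n)
  ultimately have "(\<lambda>n. real (q n) / real n * (real n / real (Suc n))) \<longlonglongrightarrow> cdf std_normal_distribution y * 1"
    by (rule tendsto_mult)
  moreover have "real (q n) / real n * (real n / real (Suc n)) = real (q n) / real (Suc n)" for n
    by (cases "n = 0") (simp_all add: q_def)
  ultimately have lim: "(\<lambda>n. real (q n) / real (Suc n)) \<longlonglongrightarrow> cdf std_normal_distribution y" by simp
  have "(\<lambda>n. skew_ESD ((1 / sqrt (real (Suc n))) \<cdot>\<^sub>m skew_palindromic_toeplitz (Suc n) x) y - real (q n) / real (Suc n)) \<longlonglongrightarrow> 0"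
  proof (rule tendsto_rabs_zero_cancel, rule tendsto_sandwich[of "\<lambda>_. 0" _ _ "\<lambda>n. 1 / real (Suc n)"])
    show "(\<lambda>n. 1 / real (Suc n)) \<longlonglongrightarrow> 0"
      using LIMSEQ_inverse_real_of_nat by (simp add: inverse_eq_divide)
  qed (use skew_ESD_palindromic_toeplitz in \<open>auto simp: q_def\<close>)
  from tendsto_add[OF this lim]
  have "(\<lambda>n. skew_ESD ((1 / sqrt (real (Suc n))) \<cdot>\<^sub>m skew_palindromic_toeplitz (Suc n) x) y) \<longlonglongrightarrow> cdf std_normal_distribution y"
    by simp
  then show "(\<lambda>n. skew_ESD ((1 / sqrt (real n)) \<cdot>\<^sub>m skew_palindromic_toeplitz n x) y) \<longlonglongrightarrow> cdf std_normal_distribution y"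
    by (rule LIMSEQ_imp_Suc)
qed

theorem theorem4p3:
  fixes M :: "'a measure" and X :: "nat \<Rightarrow> 'a \<Rightarrow> real"
  assumes "prob_space M"
    and "prob_space.assumption_A1 M X \<or> prob_space.assumption_A2 M X \<or> prob_space.assumption_A3 M X"
  shows "skew_LSD M
           (\<lambda>n \<omega>. (1 / sqrt (real n)) \<cdot>\<^sub>m skew_sym_circulant n (\<lambda>k. X k \<omega>))
           std_normal_distribution
       \<and> skew_LSD M
           (\<lambda>n \<omega>. (1 / sqrt (real n)) \<cdot>\<^sub>m skew_palindromic_toeplitz n (\<lambda>k. X k \<omega>))
           std_normal_distribution"
proof -
  interpret prob_space M by fact
  have cases: "assumption_A2 X \<or> assumption_A3 X"
    using assms(2) assumption_A1_imp_A3 by blast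
  then have std: "indep_standardized X" by (auto simp: assumption_A2_def assumption_A3_def)
  have "uniformly_square_integrable X" "summable_truncated_fourth_moments X"
    using cases assumption_A2_integrability assumption_A3_integrability by blast+
  then have ae: "AE \<omega> in M. \<forall>t. (\<lambda>n. emp_char n t (\<lambda>d. X d \<omega>)) \<longlonglongrightarrow> of_real (exp (- (t\<^sup>2 / 2)))"
    by (rule emp_char_tendsto_gaussian[OF std])
  show ?thesis
    unfolding skew_LSD_def weak_conv_def
  proof (intro conjI real_dist_normal_dist)
    show "AE \<omega> in M. \<forall>y. isCont (cdf std_normal_distribution) y \<longrightarrow>
      (\<lambda>n. skew_ESD ((1 / sqrt (real n)) \<cdot>\<^sub>m skew_sym_circulant n (\<lambda>k. X k \<omega>)) y) \<longlonglongrightarrow> cdf std_normal_distribution y"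
      using ae by eventually_elim (intro allI impI skew_ESD_tendsto_gaussian, blast)
    show "AE \<omega> in M. \<forall>y. isCont (cdf std_normal_distribution) y \<longrightarrow>
      (\<lambda>n. skew_ESD ((1 / sqrt (real n)) \<cdot>\<^sub>m skew_palindromic_toeplitz n (\<lambda>k. X k \<omega>)) y) \<longlonglongrightarrow> cdf std_normal_distribution y"
      using ae by eventually_elim (intro allI impI skew_ESD_tendsto_gaussian, blast)
  qed
qed

end
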